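(* Let $H$ be a $d$-dimensional semisimple Hopf algebra over an algebraically closed field $k$ of characteristic $0$, with irreducible characters $\chi_i$ of degrees $d_i$, and let $f_{rob}=\sum_i\frac{d}{d_i}\chi_i\in H^*$. Then for any integer $l>0$, $$d^{2l-1}\,\Psi(z_{2l})=\sum_i\frac{d^{2l-1}}{d_i^{2l-1}}\chi_i=\underbrace{f_{rob}\bullet f_{rob}\bullet\cdots\bullet f_{rob}}_{l},$$ where $\Psi$ is the Frobenius map, $\bullet$ is the convolution product on $H^*$, and $z_{2l}\in H$ is the element built from the idempotent integral of $H$ (all defined in the context).
   Context: $H$ has comultiplication $\Delta(h)=\sum h_1\otimes h_2$ (Sweedler notation), counit $\varepsilon$ and antipode $S$. $\Lambda$ denotes the idempotent integral of $H$: $h\Lambda=\varepsilon(h)\Lambda=\Lambda h$ for all $h\in H$, $\varepsilon(\Lambda)=1$. Let $\Lambda^1,\Lambda^2,\dots$ be copies of $\Lambda$ with $\Delta(\Lambda^i)=\sum\Lambda^i_1\otimes\Lambda^i_2$. For $n\ge1$, $$z_n=\sum\Lambda^1_1\Lambda^2_1\cdots\Lambda^n_1\,S(\Lambda^1_2)S(\Lambda^2_2)\cdots S(\Lambda^n_2).$$ $\lambda=\chi_H=\sum_i d_i\chi_i$ is the character of the left regular representation; it is the integral of $H^*$ with $\langle\lambda,\Lambda\rangle=1$. For $p\in H^*$, $a\in H$, $p\leftharpoonup a\in H^*$ is given by $\langle p\leftharpoonup a,a'\rangle=\langle p,aa'\rangle$. The Frobenius map is the linear bijection $\Psi:H\to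 H^*$, $\Psi(h)=\lambda\leftharpoonup S(h)$; its inverse is $\Psi^{-1}(p)=\Lambda\leftharpoonup p=\sum\langle p,\Lambda_1\rangle\Lambda_2$. The convolution product on $H^*$ is $p\bullet q=d\,\Psi\big(\Psi^{-1}(p)\Psi^{-1}(q)\big)$ for $p,q\in H^*$. *)

theory Defs
  imports "HOL-Computational_Algebra.Polynomial" "Jordan_Normal_Form.Matrix"
begin

text \<open>
  Elements of the tensor powers of a vector space \<open>V\<close> are represented by formal finite sums of pure
  tensors: the pure tensor \<open>v\<^sub>1 \<otimes> \<dots> \<otimes> v\<^sub>n\<close> is the list \<open>[v\<^sub>1, \<dots>, v\<^sub>n]\<close>, and a list of such
  lists stands for the sum of its entries.  \<open>tensor_eq\<close> is equality in the tensor power, i.e. the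
  congruence on formal sums generated by commutativity of addition and the usual multilinearity
  relations (negation and scalar multiplication act on one of the factors).
\<close>

inductive (in vector_space) tensor_eq :: "'b list list \<Rightarrow> 'b list list \<Rightarrow> bool" where
  refl: "tensor_eq u u"
| sym: "tensor_eq u v \<Longrightarrow> tensor_eq v u"
| trans: "tensor_eq u v \<Longrightarrow> tensor_eq v w \<Longrightarrow> tensor_eq u w"
| append: "tensor_eq u u' \<Longrightarrow> tensor_eq v v' \<Longrightarrow> tensor_eq (u @ v) (u' @ v')"
| comm: "tensor_eq (u @ v) (v @ u)"
| add: "tensor_eq [xs @ (a + b) # ys] [xs @ a # ys, xs @ b # ys]"
| zero: "tensor_eq [xs @ 0 # ys] []"
| scale: "tensor_eq [xs @ (c *s a) # ys @ b # zs] [xs @ a # ys @ (c *s b) # zs]"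

text \<open>Evaluating a multilinear map, such as a Sweedler sum, does not depend on the formal sum
  chosen to represent a tensor.\<close>

lemma (in vector_space) tensor_eq_multilinear:
  fixes F :: "'b list \<Rightarrow> 'c::ab_group_add"
  assumes "tensor_eq u v"
    and add: "\<And>xs a b ys. F (xs @ (a + b) # ys) = F (xs @ a # ys) + F (xs @ b # ys)"
    and scale: "\<And>xs c a ys b zs.
      F (xs @ (c *s a) # ys @ b # zs) = F (xs @ a # ys @ (c *s b) # zs)"
  shows "sum_list (map F u) = sum_list (map F v)"
  using assms(1)
proof induction
  case (zero xs ys)
  show ?case using add[of xs 0 0 ys] by simp
qed (simp_all add: add scale add.commute)

text \<open>
  Finite-dimensional Hopf algebras whose underlying vector space is a whole type; \<open>Basis\<close> is an
  arbitrary basis.  \<open>\<Delta> h\<close> is a formal sum \<open>[(h\<^sub>1, h\<^sub>2), \<dots>]\<close> representing \<open>\<Sum>h\<^sub>1 \<otimes> h\<^sub>2\<close>; all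
  conditions on \<open>\<Delta>\<close> are equalities in \<open>H \<otimes> H\<close> or \<open>H \<otimes> H \<otimes> H\<close>.
\<close>

locale hopf_algebra = finite_dimensional_vector_space scale Basis
  for scale :: "'k::field \<Rightarrow> 'a::ring_1 \<Rightarrow> 'a" (infixr "*s" 75) and Basis :: "'a set" +
  fixes \<Delta> :: "'a \<Rightarrow> ('a \<times> 'a) list" and \<epsilon> :: "'a \<Rightarrow> 'k" and S :: "'a \<Rightarrow> 'a"
  assumes scale_mult_left: "(c *s x) * y = c *s (x * y)"
    and scale_mult_right: "x * (c *s y) = c *s (x * y)"
    and comult_add: "tensor_eq [[a, b]. (a, b) \<leftarrow> \<Delta> (x + y)] [[a, b]. (a, b) \<leftarrow> \<Delta> x @ \<Delta> y]"
    and comult_scale: "tensor_eq [[a, b]. (a, b) \<leftarrow> \<Delta> (c *s x)] [[c *s a, b]. (a, b) \<leftarrow> \<Delta> x]"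
    and counit_linear: "Vector_Spaces.linear scale (*) \<epsilon>"
    and antipode_linear: "Vector_Spaces.linear scale scale S"
    and coassoc: "tensor_eq [[a1, a2, b]. (a, b) \<leftarrow> \<Delta> x, (a1, a2) \<leftarrow> \<Delta> a]
                            [[a, b1, b2]. (a, b) \<leftarrow> \<Delta> x, (b1, b2) \<leftarrow> \<Delta> b]"
    and counit_left: "(\<Sum>(a, b)\<leftarrow>\<Delta> x. \<epsilon> a *s b) = x"
    and counit_right: "(\<Sum>(a, b)\<leftarrow>\<Delta> x. \<epsilon> b *s a) = x"
    and comult_mult: "tensor_eq [[a, b]. (a, b) \<leftarrow> \<Delta> (x * y)]
                                [[a * a', b * b']. (a, b) \<leftarrow> \<Delta> x, (a', b') \<leftarrow> \<Delta> y]"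
    and comult_one: "tensor_eq [[a, b]. (a, b) \<leftarrow> \<Delta> 1] [[1, 1]]"
    and counit_mult: "\<epsilon> (x * y) = \<epsilon> x * \<epsilon> y"
    and counit_one: "\<epsilon> 1 = 1"
    and antipode_left: "(\<Sum>(a, b)\<leftarrow>\<Delta> x. S a * b) = \<epsilon> x *s 1"
    and antipode_right: "(\<Sum>(a, b)\<leftarrow>\<Delta> x. a * S b) = \<epsilon> x *s 1"
begin

definition left_ideal :: "'a set \<Rightarrow> bool" where
  "left_ideal I \<longleftrightarrow> subspace I \<and> (\<forall>h. \<forall>x\<in>I. h * x \<in> I)"

definition semisimple :: bool where
  "semisimple \<longleftrightarrow>
     (\<forall>I. left_ideal I \<longrightarrow> (\<exists>J. left_ideal J \<and> I \<inter> J = {0} \<and> {x + y | x y. x \<in> I \<and> y \<in> J} = UNIV))"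

definition is_representation :: "nat \<Rightarrow> ('a \<Rightarrow> 'k mat) \<Rightarrow> bool" where
  "is_representation n \<rho> \<longleftrightarrow>
     (\<forall>x. \<rho> x \<in> carrier_mat n n) \<and>
     (\<forall>x y. \<rho> (x + y) = \<rho> x + \<rho> y) \<and>
     (\<forall>c x. \<rho> (c *s x) = c \<cdot>\<^sub>m \<rho> x) \<and>
     (\<forall>x y. \<rho> (x * y) = \<rho> x * \<rho> y) \<and>
     \<rho> 1 = 1\<^sub>m n"

definition invariant_subspace :: "nat \<Rightarrow> ('a \<Rightarrow> 'k mat) \<Rightarrow> 'k vec set \<Rightarrow> bool" where
  "invariant_subspace n \<rho> W \<longleftrightarrow>
     W \<subseteq> carrier_vec n \<and> 0\<^sub>v n \<in> W \<and>
     (\<forall>v\<in>W. \<forall>w\<in>W. v + w \<in> W) \<and> (\<forall>c. \<forall>v\<in>W. c \<cdot>\<^sub>v v \<in> W) \<and>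
     (\<forall>x. \<forall>v\<in>W. \<rho> x *\<^sub>v v \<in> W)"

definition irreducible_representation :: "nat \<Rightarrow> ('a \<Rightarrow> 'k mat) \<Rightarrow> bool" where
  "irreducible_representation n \<rho> \<longleftrightarrow>
     is_representation n \<rho> \<and> n > 0 \<and>
     (\<forall>W. invariant_subspace n \<rho> W \<longrightarrow> W = {0\<^sub>v n} \<or> W = carrier_vec n)"

text \<open>The pairs \<open>(d\<^sub>i, \<chi>\<^sub>i)\<close> of the degree and the character of an irreducible representation.
  Every irreducible representation is finite-dimensional, hence equivalent to a matrix
  representation.  Equivalent representations give the same pair; over an algebraically closed field
  of characteristic \<open>0\<close> inequivalent ones give different pairs, so a sum over this set is a sum over the
  isomorphism classes of irreducible representations.\<close>

definition irreducible_characters :: "(nat \<times> ('a \<Rightarrow> 'k)) set" where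
  "irreducible_characters =
     {(n, \<lambda>h. \<Sum>i<n. \<rho> h $$ (i, i)) | n \<rho>. irreducible_representation n \<rho>}"

text \<open>The character \<open>\<lambda>\<close> of the left regular representation: the trace of \<open>x \<mapsto> h * x\<close>.\<close>

definition regular_character :: "'a \<Rightarrow> 'k" where
  "regular_character h = (\<Sum>b\<in>Basis. representation Basis (h * b) b)"

text \<open>The idempotent integral \<open>\<Lambda>\<close>; it is unique, and exists when \<open>H\<close> is semisimple.\<close>

definition idempotent_integral :: 'a where
  "idempotent_integral = (THE t. (\<forall>h. h * t = \<epsilon> h *s t \<and> t * h = \<epsilon> h *s t) \<and> \<epsilon> t = 1)"

text \<open>The list \<open>ps\<close> ranges over the choices of one summand \<open>(\<Lambda>\<^sub>1, \<Lambda>\<^sub>2)\<close> of \<open>\<Delta> \<Lambda>\<close>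
  for each of the \<open>n\<close> copies of \<open>\<Lambda>\<close>.\<close>

definition z :: "nat \<Rightarrow> 'a" where
  "z n = (\<Sum>ps\<leftarrow>List.n_lists n (\<Delta> idempotent_integral).
            prod_list (map fst ps) * prod_list (map (\<lambda>p. S (snd p)) ps))"

text \<open>Elements of \<open>H\<^sup>*\<close> are represented by linear functions \<open>'a \<Rightarrow> 'k\<close>; \<open>frobenius_map\<close> is
  a bijection onto these when \<open>H\<close> is semisimple, so \<open>inv_into UNIV frobenius_map\<close> is its inverse.\<close>

definition dual_act :: "('a \<Rightarrow> 'k) \<Rightarrow> 'a \<Rightarrow> ('a \<Rightarrow> 'k)" (infixl "\<leftharpoonup>" 70) where
  "p \<leftharpoonup> a = (\<lambda>a'. p (a * a'))"

definition frobenius_map :: "'a \<Rightarrow> ('a \<Rightarrow> 'k)" where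
  "frobenius_map h = regular_character \<leftharpoonup> S h"

definition convolution :: "('a \<Rightarrow> 'k) \<Rightarrow> ('a \<Rightarrow> 'k) \<Rightarrow> ('a \<Rightarrow> 'k)" where
  "convolution p q = (\<lambda>a. of_nat dimension *
     frobenius_map (inv_into UNIV frobenius_map p * inv_into UNIV frobenius_map q) a)"

text \<open>The \<open>l\<close>-fold product \<open>p \<bullet> p \<bullet> \<dots> \<bullet> p\<close>, for \<open>l > 0\<close>.\<close>

definition convolution_power :: "('a \<Rightarrow> 'k) \<Rightarrow> nat \<Rightarrow> ('a \<Rightarrow> 'k)" where
  "convolution_power p l = ((\<lambda>q. convolution q p) ^^ (l - 1)) p"

definition f_rob :: "'a \<Rightarrow> 'k" where
  "f_rob = (\<lambda>h. \<Sum>(n, \<chi>)\<in>irreducible_characters. of_nat dimension / of_nat n * \<chi> h)"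

end

end

theory Submission
  imports Defs "Jordan_Normal_Form.Char_Poly" "HOL-Number_Theory.Totient"
    "HOL-Computational_Algebra.Fundamental_Theorem_Algebra"
begin

text \<open>
  Everything rests on the Casimir element \<open>\<Sum> \<Lambda>\<^sub>1 \<otimes> S \<Lambda>\<^sub>2\<close> of \<open>H\<close>.  The invariance of \<open>\<Lambda>\<close>
  makes \<open>\<Sum> \<rho>(\<Lambda>\<^sub>1) X \<sigma>(S \<Lambda>\<^sub>2)\<close> an intertwiner of the representations \<open>\<rho>\<close> and \<open>\<sigma>\<close> for every
  matrix \<open>X\<close>, so Schur's lemma determines the Casimir element on the block of each irreducible
  character \<open>c\<close> of degree \<open>d\<^sub>c\<close>: it is \<open>\<Sum> E\<^sub>k\<^sub>l \<otimes> U E\<^sub>l\<^sub>k\<close> with the matrix units \<open>E\<^sub>k\<^sub>l\<close> and an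
  invertible \<open>U\<close> whose trace on each block is \<open>1\<close> and which satisfies \<open>S\<^sup>2 x = U x U\<^sup>-\<^sup>1\<close>.

  The formula to be proved amounts to \<open>U = 1 / d\<^sub>c\<close> on each block, that is, to \<open>S\<^sup>2 = id\<close>, the theorem
  of Larson and Radford for semisimple Hopf algebras in characteristic \<open>0\<close>.  Its proof has two
  parts.  Let \<open>lam\<close> be the integral of \<open>H\<^sup>*\<close> normalised by \<open>lam \<Lambda> = 1\<close>.

  \<^item> \<open>lam 1 \<noteq> 0\<close> (lemma \<open>lam_one_nonzero\<close>).  A group-like element \<open>g\<close>, of finite order,
    measures the failure of \<open>lam\<close> to be two-sided, and \<open>g\<close> is a multiple of \<open>U\<^sup>2\<close> on each block.
    A rescaled \<open>U\<close> is therefore a square root of \<open>g\<close> and has roots of unity as eigenvalues.  It has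
    the same trace \<open>s\<^sub>c\<close> on the block as its inverse, and \<open>lam 1 = \<Sum> s\<^sub>c\<^sup>2\<close>.  Roots of unity in the
    ground field can be carried to \<open>\<complex>\<close>, where the \<open>s\<^sub>c\<close> become real, and a sum of squares of real numbers
    that do not all vanish is positive.

  \<^item> \<open>S\<^sup>2 = id\<close> (theorem \<open>antipode_involutive\<close>).  Since \<open>lam 1 \<noteq> 0\<close>, \<open>g = 1\<close> and \<open>S\<^sup>4 = id\<close>.  Let
    \<open>\<chi>\<close> be the regular character and \<open>d\<close> the dimension.  As \<open>\<chi> / d\<close> is an idempotent of \<open>H\<^sup>*\<close>, it
    defines a projection of \<open>H\<close> which commutes with \<open>S\<^sup>2\<close>; the trace of the product of the two
    is an integer, and the trace formula shows that it equals \<open>lam 1 / d = tr S\<^sup>2 / d\<close>.  So the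
    trace of the involution \<open>S\<^sup>2\<close>, whose absolute value is at most \<open>d\<close>, is a nonzero multiple of \<open>d\<close>,
    and \<open>S\<^sup>2\<close> is the identity because it fixes \<open>1\<close>.

  With \<open>U\<close> known, the rest is computation with matrix units.  Summation over two copies of
  \<open>\<Lambda>\<close> gives \<open>\<Sum> \<Lambda>\<^sup>1\<^sub>1 \<Lambda>\<^sup>2\<^sub>1 y S(\<Lambda>\<^sup>1\<^sub>2) S(\<Lambda>\<^sup>2\<^sub>2) = y / d\<^sub>c\<^sup>2\<close> on each block (lemma
  \<open>casimir_commutator\<close>), hence \<open>S z\<^sub>2\<^sub>l\<close> is central and acts as \<open>d\<^sub>c\<^sup>-\<^sup>2\<^sup>l\<close>.  The
  Frobenius map sends \<open>S\<close> of the central element acting as \<open>\<alpha>\<^sub>c\<close> to \<open>\<Sum> d\<^sub>c \<alpha>\<^sub>c \<chi>\<^sub>c\<close>; in particular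
  \<open>f_rob\<close> comes from \<open>\<alpha>\<^sub>c = d / d\<^sub>c\<^sup>2\<close>, and convolution becomes multiplication of the \<open>\<alpha>\<^sub>c\<close>.
\<close>

section \<open>Sweedler calculus\<close>

context hopf_algebra
begin

definition lin :: "('a \<Rightarrow> 'k) \<Rightarrow> bool" where
  "lin p \<longleftrightarrow> (\<forall>x y. p (x + y) = p x + p y) \<and> (\<forall>c x. p (c *s x) = c * p x)"

definition endo :: "('a \<Rightarrow> 'a) \<Rightarrow> bool" where
  "endo f \<longleftrightarrow> (\<forall>x y. f (x + y) = f x + f y) \<and> (\<forall>c x. f (c *s x) = c *s f x)"

definition bil :: "('a \<Rightarrow> 'a \<Rightarrow> 'k) \<Rightarrow> bool" where
  "bil F \<longleftrightarrow> (\<forall>b. lin (\<lambda>a. F a b)) \<and> (\<forall>a. lin (F a))"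

text \<open>A Sweedler sum \<open>\<Sum> F x\<^sub>1 x\<^sub>2\<close>.  Restricting the values to the ground field keeps all linearity
side conditions first-order in shape, so that they can be discharged by introduction rules;
identities in \<open>H\<close> are recovered by testing against all linear forms.\<close>

definition sw :: "'a \<Rightarrow> ('a \<Rightarrow> 'a \<Rightarrow> 'k) \<Rightarrow> 'k" where
  "sw x F = (\<Sum>(a, b)\<leftarrow>\<Delta> x. F a b)"

lemma lin_iff_linear: "lin p \<longleftrightarrow> Vector_Spaces.linear scale (*) p"
proof -
  have "vector_space ((*) :: 'k \<Rightarrow> 'k \<Rightarrow> 'k)"
    by unfold_locales (simp_all add: algebra_simps)
  then show ?thesis
    by (auto simp: lin_def Vector_Spaces.linear_iff vector_space_axioms)
qed

lemma endo_iff_linear: "endo f \<longleftrightarrow> Vector_Spaces.linear scale scale f"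
  by (auto simp: endo_def Vector_Spaces.linear_iff vector_space_axioms)

lemma lin_add: "lin p \<Longrightarrow> p (x + y) = p x + p y"
  and lin_scale: "lin p \<Longrightarrow> p (c *s x) = c * p x"
  by (auto simp: lin_def)

lemma lin_zero: "lin p \<Longrightarrow> p 0 = 0"
  using lin_scale[of p 0 0] by simp

lemma lin_minus: "lin p \<Longrightarrow> p (- x) = - p x"
  using lin_scale[of p "-1" x] by simp

lemma lin_diff: "lin p \<Longrightarrow> p (x - y) = p x - p y"
  using lin_add[of p x "-y"] lin_minus[of p y] by simp

lemma lin_sum: "lin p \<Longrightarrow> p (\<Sum>i\<in>I. f i) = (\<Sum>i\<in>I. p (f i))"
  by (induction I rule: infinite_finite_induct) (simp_all add: lin_zero lin_add)

lemma lin_sum_list: "lin p \<Longrightarrow> p (\<Sum>i\<leftarrow>xs. f i) = (\<Sum>i\<leftarrow>xs. p (f i))"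
  by (induction xs) (simp_all add: lin_zero lin_add)

lemma endo_add: "endo f \<Longrightarrow> f (x + y) = f x + f y"
  and endo_scale: "endo f \<Longrightarrow> f (c *s x) = c *s f x"
  by (auto simp: endo_def)

lemma endo_zero: "endo p \<Longrightarrow> p 0 = 0"
  using endo_scale[of p 0 0] by simp

lemma endo_minus: "endo p \<Longrightarrow> p (- x) = - p x"
  using endo_scale[of p "-1" x] by simp

lemma endo_diff: "endo p \<Longrightarrow> p (x - y) = p x - p y"
  using endo_add[of p x "-y"] endo_minus[of p y] by simp

lemma endo_sum: "endo p \<Longrightarrow> p (\<Sum>i\<in>I. f i) = (\<Sum>i\<in>I. p (f i))"
  by (induction I rule: infinite_finite_induct) (simp_all add: endo_zero endo_add)

lemma lin_counit: "lin \<epsilon>" and endo_antipode: "endo S"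
  using counit_linear antipode_linear by (auto simp: lin_iff_linear endo_iff_linear)

lemma lin_ext:
  assumes "\<And>p. lin p \<Longrightarrow> p x = p y" shows "x = y"
proof -
  have "representation Basis x b = representation Basis y b" for b
    by (intro assms) (simp add: lin_iff_linear linear_representation independent_Basis span_Basis)
  then have "(\<Sum>b\<in>Basis. representation Basis x b *s b) = (\<Sum>b\<in>Basis. representation Basis y b *s b)"
    by simp
  then show ?thesis
    by (subst (asm) (1 2) sum_representation_eq)
       (simp_all add: independent_Basis span_Basis finite_Basis)
qed

lemma endo_id: "endo (\<lambda>x. x)"
  and endo_mult_left: "endo f \<Longrightarrow> endo (\<lambda>x. f x * y)"
  and endo_mult_right: "endo f \<Longrightarrow> endo (\<lambda>x. y * f x)"
  and endo_antipode_comp: "endo f \<Longrightarrow> endo (\<lambda>x. S (f x))"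
  and endo_scale_const: "endo f \<Longrightarrow> endo (\<lambda>x. c *s f x)"
  and endo_plus: "endo f \<Longrightarrow> endo g \<Longrightarrow> endo (\<lambda>x. f x + g x)"
  and endo_minus': "endo f \<Longrightarrow> endo g \<Longrightarrow> endo (\<lambda>x. f x - g x)"
  and endo_comp: "endo f \<Longrightarrow> endo g \<Longrightarrow> endo (\<lambda>x. f (g x))"
  using endo_antipode by (auto simp: endo_def lin_def distrib_left distrib_right scale_mult_left
    scale_mult_right scale_right_distrib scale_left_distrib mult.commute scale_right_diff_distrib)

lemma lin_comp: "lin p \<Longrightarrow> endo f \<Longrightarrow> lin (\<lambda>x. p (f x))"
  by (auto simp: endo_def lin_def)

lemma lin_mult_left: "lin p \<Longrightarrow> lin (\<lambda>x. p x * c)"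
  and lin_mult_right: "lin p \<Longrightarrow> lin (\<lambda>x. c * p x)"
  by (auto simp: lin_def algebra_simps)

lemma lin_sum_intro: "(\<And>i. i \<in> I \<Longrightarrow> lin (f i)) \<Longrightarrow> lin (\<lambda>x. \<Sum>i\<in>I. f i x)"
  by (auto simp: lin_def sum.distrib sum_distrib_left)

lemma bilI: "(\<And>b. lin (\<lambda>a. F a b)) \<Longrightarrow> (\<And>a. lin (\<lambda>b. F a b)) \<Longrightarrow> bil F"
  by (simp add: bil_def)

lemma bilD: "bil F \<Longrightarrow> lin (\<lambda>a. F a b)" "bil F \<Longrightarrow> lin (F a)"
  by (auto simp: bil_def)

lemma bil_left: "bil F \<Longrightarrow> endo f \<Longrightarrow> lin (\<lambda>x. F (f x) b)"
  and bil_right: "bil F \<Longrightarrow> endo f \<Longrightarrow> lin (\<lambda>x. F a (f x))"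
  by (auto simp: bil_def lin_def endo_def)

text \<open>A multilinear form extends to formal sums of pure tensors of all lengths by the value \<open>0\<close> on tensors
of another length.\<close>

lemma tensor_eq_bilinear:
  assumes "tensor_eq u v" and F: "bil F"
  shows "(\<Sum>xs\<leftarrow>u. case xs of [a, b] \<Rightarrow> F a b | _ \<Rightarrow> 0) =
         (\<Sum>xs\<leftarrow>v. case xs of [a, b] \<Rightarrow> F a b | _ \<Rightarrow> 0)"
proof (rule tensor_eq_multilinear[OF assms(1)])
  show "(case xs @ (a + b) # ys of [a, b] \<Rightarrow> F a b | _ \<Rightarrow> 0) =
        (case xs @ a # ys of [a, b] \<Rightarrow> F a b | _ \<Rightarrow> 0) +
        (case xs @ b # ys of [a, b] \<Rightarrow> F a b | _ \<Rightarrow> 0)" for xs a b ys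
    using F by (cases xs rule: remdups_adj.cases; cases ys rule: remdups_adj.cases)
      (auto simp: bil_def lin_def split: list.splits)
  show "(case xs @ (c *s a) # ys @ b # zs of [a, b] \<Rightarrow> F a b | _ \<Rightarrow> 0) =
        (case xs @ a # ys @ (c *s b) # zs of [a, b] \<Rightarrow> F a b | _ \<Rightarrow> 0)" for xs c a ys b zs
    using F by (cases xs rule: remdups_adj.cases; cases ys rule: remdups_adj.cases;
      cases zs rule: remdups_adj.cases) (auto simp: bil_def lin_def split: list.splits)
qed

lemma tensor_eq_trilinear:
  assumes "tensor_eq u v" and F: "\<And>b c. lin (\<lambda>a. F a b c)" "\<And>a c. lin (\<lambda>b. F a b c)"
    "\<And>a b. lin (\<lambda>c. F a b c)"
  shows "(\<Sum>xs\<leftarrow>u. case xs of [a, b, c] \<Rightarrow> F a b c | _ \<Rightarrow> 0) =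
         (\<Sum>xs\<leftarrow>v. case xs of [a, b, c] \<Rightarrow> F a b c | _ \<Rightarrow> 0)"
proof (rule tensor_eq_multilinear[OF assms(1)])
  show "(case xs @ (a + b) # ys of [a, b, c] \<Rightarrow> F a b c | _ \<Rightarrow> 0) =
        (case xs @ a # ys of [a, b, c] \<Rightarrow> F a b c | _ \<Rightarrow> 0) +
        (case xs @ b # ys of [a, b, c] \<Rightarrow> F a b c | _ \<Rightarrow> 0)" for xs a b ys
    using F by (cases xs rule: remdups_adj.cases; cases ys rule: remdups_adj.cases)
      (auto simp: lin_def split: list.splits)
  show "(case xs @ (k *s a) # ys @ b # zs of [a, b, c] \<Rightarrow> F a b c | _ \<Rightarrow> 0) =
        (case xs @ a # ys @ (k *s b) # zs of [a, b, c] \<Rightarrow> F a b c | _ \<Rightarrow> 0)" for xs k a ys b zs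
    using F by (cases xs rule: remdups_adj.cases; cases ys rule: remdups_adj.cases;
      cases zs rule: remdups_adj.cases) (auto simp: lin_def split: list.splits)
qed

lemma sum_list_concat: "sum_list (concat xss) = (\<Sum>xs\<leftarrow>xss. sum_list xs)" for xss :: "'k list list"
  by (induction xss) simp_all

lemma sw_add: "bil F \<Longrightarrow> sw (x + y) F = sw x F + sw y F"
  using tensor_eq_bilinear[OF comult_add, of F x y]
  by (simp add: sw_def o_def split_def map_concat concat_map_singleton sum_list_concat o_def)

lemma sw_scale: "bil F \<Longrightarrow> sw (c *s x) F = c * sw x F"
  using tensor_eq_bilinear[OF comult_scale, of F c x]
  by (simp add: sw_def o_def split_def sum_list_const_mult lin_scale[OF bilD(1)])

lemma sw_coassoc:
  assumes F: "\<And>b c. lin (\<lambda>a. F a b c)" "\<And>a c. lin (\<lambda>b. F a b c)" "\<And>a b. lin (\<lambda>c. F a b c)"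
  shows "sw x (\<lambda>a b. sw a (\<lambda>a1 a2. F a1 a2 b)) = sw x (\<lambda>a b. sw b (\<lambda>b1 b2. F a b1 b2))"
  using tensor_eq_trilinear[OF coassoc F, of x]
  by (simp add: sw_def o_def split_def map_concat sum_list_concat o_def)

lemma sw_mult:
  "bil F \<Longrightarrow> sw (x * y) F = sw x (\<lambda>a b. sw y (\<lambda>a' b'. F (a * a') (b * b')))"
  using tensor_eq_bilinear[OF comult_mult, of F x y]
  by (simp add: sw_def o_def split_def map_concat sum_list_concat o_def)

lemma sw_one: "bil F \<Longrightarrow> sw 1 F = F 1 1"
  using tensor_eq_bilinear[OF comult_one, of F]
  by (simp add: sw_def o_def split_def)

lemma sw_swap:
  "sw x (\<lambda>a b. sw y (\<lambda>c d. F a b c d)) = sw y (\<lambda>c d. sw x (\<lambda>a b. F a b c d))"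
proof -
  have "(\<Sum>p\<leftarrow>xs. \<Sum>q\<leftarrow>ys. G p q) = (\<Sum>q\<leftarrow>ys. \<Sum>p\<leftarrow>xs. G p q)"
    for xs ys :: "('a \<times> 'a) list" and G :: "_ \<Rightarrow> _ \<Rightarrow> 'k"
    by (induction xs) (simp_all add: sum_list_addf)
  then show ?thesis by (simp add: sw_def split_def)
qed

lemma sw_mult_left: "c * sw x F = sw x (\<lambda>a b. c * F a b)"
  by (simp add: sw_def split_def sum_list_const_mult)

lemma sw_mult_right: "sw x F * c = sw x (\<lambda>a b. F a b * c)"
  by (simp add: sw_def split_def sum_list_mult_const)

lemma sw_sum: "sw x (\<lambda>a b. \<Sum>i\<in>I. F i a b) = (\<Sum>i\<in>I. sw x (F i))"
proof -
  have "(\<Sum>p\<leftarrow>xs. \<Sum>i\<in>I. G i p) = (\<Sum>i\<in>I. \<Sum>p\<leftarrow>xs. G i p)"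
    for xs :: "('a \<times> 'a) list" and G :: "_ \<Rightarrow> _ \<Rightarrow> 'k"
    by (induction xs) (simp_all add: sum.distrib)
  then show ?thesis by (simp add: sw_def split_def)
qed

lemma sw_cong: "(\<And>a b. F a b = G a b) \<Longrightarrow> sw x F = sw x G"
  by (simp add: sw_def)

lemma lin_sw: "bil F \<Longrightarrow> endo f \<Longrightarrow> lin (\<lambda>x. sw (f x) F)"
  by (auto simp: lin_def endo_def sw_add sw_scale)

lemma lin_sw_body: "(\<And>a b. lin (\<lambda>x. F x a b)) \<Longrightarrow> lin (\<lambda>x. sw y (F x))"
  by (auto simp: lin_def sw_def split_def sum_list_addf sum_list_const_mult)

text \<open>These rules decide linearity in a variable which occurs exactly once in a term built from products,
antipodes and nested Sweedler sums.  For a form \<open>p\<close> that occurs in the term, the instance of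
\<open>lin_comp\<close> for \<open>p\<close> is added to them.\<close>

lemmas linear_intros = endo_id endo_mult_left endo_mult_right endo_antipode_comp endo_scale_const
  lin_mult_left lin_mult_right bilI lin_sw lin_sw_body lin_comp[OF lin_counit]

lemma lin_of_sw:
  "lin p \<Longrightarrow> p (\<Sum>(a, b)\<leftarrow>\<Delta> x. f a b) = sw x (\<lambda>a b. p (f a b))"
  by (simp add: sw_def split_def lin_sum_list)

lemma sw_counit_left: "lin p \<Longrightarrow> sw x (\<lambda>a b. \<epsilon> a * p b) = p x"
  using lin_of_sw[of p "\<lambda>a b. \<epsilon> a *s b" x] by (simp add: counit_left lin_scale)

lemma sw_counit_right: "lin p \<Longrightarrow> sw x (\<lambda>a b. p a * \<epsilon> b) = p x"
  using lin_of_sw[of p "\<lambda>a b. \<epsilon> b *s a" x] by (simp add: counit_right lin_scale mult.commute)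

lemma sw_antipode_left: "lin p \<Longrightarrow> sw x (\<lambda>a b. p (S a * b)) = \<epsilon> x * p 1"
  using lin_of_sw[of p "\<lambda>a b. S a * b" x] by (simp add: antipode_left lin_scale)

lemma sw_antipode_right: "lin p \<Longrightarrow> sw x (\<lambda>a b. p (a * S b)) = \<epsilon> x * p 1"
  using lin_of_sw[of p "\<lambda>a b. a * S b" x] by (simp add: antipode_right lin_scale)

lemma sw_cancel_S_right: "bil F \<Longrightarrow> sw x (\<lambda>a b. sw b (\<lambda>c d. F a (S c * d))) = F x 1"
  and sw_cancel_right_S: "bil F \<Longrightarrow> sw x (\<lambda>a b. sw b (\<lambda>c d. F a (c * S d))) = F x 1"
  and sw_cancel_S_left: "bil F \<Longrightarrow> sw x (\<lambda>a b. sw a (\<lambda>c d. F (S c * d) b)) = F 1 x"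
  and sw_cancel_left_S: "bil F \<Longrightarrow> sw x (\<lambda>a b. sw a (\<lambda>c d. F (c * S d) b)) = F 1 x"
  by (simp_all add: sw_antipode_left[OF bilD(2)[of F]] sw_antipode_right[OF bilD(2)[of F]]
      sw_antipode_left[OF bilD(1)[of F]] sw_antipode_right[OF bilD(1)[of F]]
      sw_counit_left[OF bilD(2)] mult.commute[of "\<epsilon> _" "F _ 1"] sw_counit_right[OF bilD(1)])

lemma antipode_mult: "S (x * y) = S y * S x"
proof (rule lin_ext)
  fix p assume p: "lin p"
  note li = linear_intros lin_comp[OF p]
  \<comment> \<open>With the comultiplications iterated, \<open>\<Sum> S(x\<^sub>1 y\<^sub>1) x\<^sub>2
    y\<^sub>2 S(y\<^sub>3) S(x\<^sub>3)\<close> collapses from the left to \<open>S y S x\<close> and from the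
    right to \<open>S(x y)\<close>.\<close>
  have "p (S y * S x) = sw x (\<lambda>a b. sw y (\<lambda>c d. \<epsilon> a * (\<epsilon> c * p (S d * S b))))"
    by (simp add: sw_mult_left[symmetric] sw_counit_left lin_comp[OF p] linear_intros)
  also have "\<dots> = sw x (\<lambda>a b. sw y (\<lambda>c d. \<epsilon> (a * c) * p (1 * (S d * S b))))"
    by (simp add: counit_mult mult.assoc)
  also have "\<dots> = sw x (\<lambda>a b. sw y (\<lambda>c d. sw (a * c) (\<lambda>u v. p (S u * v * (S d * S b)))))"
    by (subst sw_antipode_left) (intro li HOL.refl)+
  also have "\<dots> = sw x (\<lambda>a b. sw y (\<lambda>c d. sw a (\<lambda>a1 a2. sw c (\<lambda>c1 c2.
      p (S (a1 * c1) * (a2 * c2) * (S d * S b))))))"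
    by (subst sw_mult) (intro li HOL.refl)+
  also have "\<dots> = sw x (\<lambda>a b. sw a (\<lambda>a1 a2. sw y (\<lambda>c d. sw c (\<lambda>c1 c2.
      p (S (a1 * c1) * (a2 * c2) * (S d * S b))))))"
    by (subst (2) sw_swap) (rule HOL.refl)
  also have "\<dots> = sw x (\<lambda>a b. sw b (\<lambda>a1 a2. sw y (\<lambda>c d. sw c (\<lambda>c1 c2.
      p (S (a * c1) * (a1 * c2) * (S d * S a2))))))"
    by (rule sw_coassoc) (intro li)+
  also have "\<dots> = sw x (\<lambda>a b. sw b (\<lambda>a1 a2. sw y (\<lambda>c d. sw d (\<lambda>c1 c2.
      p (S (a * c) * (a1 * c1) * (S c2 * S a2))))))"
    by (rule sw_cong, rule sw_cong, rule sw_coassoc) (intro li)+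
  also have "\<dots> = sw x (\<lambda>a b. sw b (\<lambda>a1 a2. sw y (\<lambda>c d. sw d (\<lambda>c1 c2.
      p (S (a * c) * a1 * (c1 * S c2) * S a2)))))"
    by (simp add: mult.assoc)
  also have "\<dots> = sw x (\<lambda>a b. sw b (\<lambda>a1 a2. p (S (a * y) * a1 * 1 * S a2)))"
    by (subst sw_cancel_right_S) (intro li HOL.refl)+
  also have "\<dots> = sw x (\<lambda>a b. sw b (\<lambda>a1 a2. p (S (a * y) * (a1 * S a2))))"
    by (simp add: mult.assoc)
  also have "\<dots> = p (S (x * y) * 1)"
    by (rule sw_cancel_right_S) (intro li)+
  finally show "p (S (x * y)) = p (S y * S x)" by simp
qed

lemma antipode_one: "S 1 = 1"
proof (rule lin_ext)
  fix p assume p: "lin p"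
  have "p (S 1 * 1) = sw 1 (\<lambda>a b. p (S a * b))"
    by (rule sw_one[symmetric]) (intro linear_intros lin_comp[OF p])+
  also have "\<dots> = p 1"
    using sw_antipode_left[OF p, of 1] by (simp add: counit_one)
  finally show "p (S 1) = p 1" by simp
qed

lemma counit_antipode: "\<epsilon> (S x) = \<epsilon> x"
proof -
  have "\<epsilon> x = sw x (\<lambda>a b. \<epsilon> (S a * b))"
    using sw_antipode_left[OF lin_counit, of x] by (simp add: counit_one)
  also have "\<dots> = sw x (\<lambda>a b. \<epsilon> (S a) * \<epsilon> b)"
    by (simp add: counit_mult)
  also have "\<dots> = \<epsilon> (S x)"
    by (rule sw_counit_right) (intro linear_intros)
  finally show ?thesis by simp
qed

lemma sw_of_antipode:
  assumes F: "bil F"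
  shows "sw (S x) F = sw x (\<lambda>a b. F (S b) (S a))"
proof -
  note li = linear_intros bil_left[OF F] bil_right[OF F]
  \<comment> \<open>The two sides are the two ways to collapse \<open>\<Sum> \<Delta>(S x\<^sub>1)
    \<Delta>(x\<^sub>2) (S(x\<^sub>4) \<otimes> S(x\<^sub>3))\<close>.\<close>
  define G where "G a b = sw a (\<lambda>u v. sw b (\<lambda>c d. F (u * S d) (v * S c)))" for a b
  have G: "bil G"
    unfolding G_def by (intro li)
  have inner: "sw b (\<lambda>c d. sw c (\<lambda>y1 y2. sw d (\<lambda>z1 z2. F (u * y1 * S z2) (v * y2 * S z1))))
      = \<epsilon> b * F u v" for b u v
  proof -
    have "sw b (\<lambda>c d. sw c (\<lambda>y1 y2. sw d (\<lambda>z1 z2. F (u * y1 * S z2) (v * y2 * S z1))))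
      = sw b (\<lambda>y1 b'. sw b' (\<lambda>y2 d. sw d (\<lambda>z1 z2. F (u * y1 * S z2) (v * y2 * S z1))))"
      by (rule sw_coassoc) (intro li)+
    also have "\<dots> = sw b (\<lambda>y1 b'. sw b' (\<lambda>e z2. sw e (\<lambda>y2 z1. F (u * y1 * S z2) (v * y2 * S z1))))"
      by (rule sw_cong, rule sw_coassoc[symmetric]) (intro li)+
    also have "\<dots> = sw b (\<lambda>y1 b'. sw b' (\<lambda>e z2. sw e (\<lambda>y2 z1. F (u * (y1 * S z2)) (v * (y2 * S z1)))))"
      by (simp add: mult.assoc)
    also have "\<dots> = sw b (\<lambda>y1 b'. F (u * (y1 * S b')) (v * 1))"
      by (rule sw_cong, rule sw_cancel_left_S) (intro li)+
    also have "\<dots> = \<epsilon> b * F (u * 1) (v * 1)"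
      by (rule sw_antipode_right) (intro li)+
    finally show ?thesis by simp
  qed
  have "sw x (\<lambda>a b. F (S b) (S a)) = sw x (\<lambda>a b. F (1 * S b) (1 * S a))"
    by simp
  also have "\<dots> = G 1 x"
    unfolding G_def by (rule sw_one[symmetric]) (intro li)
  also have "\<dots> = sw x (\<lambda>a b. sw a (\<lambda>c d. G (S c * d) b))"
    by (rule sw_cancel_S_left[symmetric, OF G])
  also have "\<dots> = sw x (\<lambda>a b. sw b (\<lambda>c d. G (S a * c) d))"
    by (rule sw_coassoc) (intro li bil_left[OF G] bil_right[OF G])+
  also have "\<dots> = sw x (\<lambda>a b. sw b (\<lambda>c d. sw (S a) (\<lambda>u v. sw c (\<lambda>y1 y2. sw d (\<lambda>z1 z2.
      F (u * y1 * S z2) (v * y2 * S z1))))))"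
    unfolding G_def by (intro sw_cong sw_mult li)
  also have "\<dots> = sw x (\<lambda>a b. sw (S a) (\<lambda>u v. sw b (\<lambda>c d. sw c (\<lambda>y1 y2. sw d (\<lambda>z1 z2.
      F (u * y1 * S z2) (v * y2 * S z1))))))"
    by (intro sw_cong sw_swap)
  also have "\<dots> = sw x (\<lambda>a b. sw (S a) F * \<epsilon> b)"
    by (simp add: inner sw_mult_left[symmetric] mult.commute)
  also have "\<dots> = sw (S x) F"
    by (rule sw_counit_right) (intro li F)
  finally show ?thesis by simp
qed

section \<open>Traces of linear operators\<close>

definition coord :: "'a \<Rightarrow> 'a \<Rightarrow> 'k" where
  "coord b x = representation Basis x b"

definition tr :: "('a \<Rightarrow> 'a) \<Rightarrow> 'k" where
  "tr f = (\<Sum>b\<in>Basis. coord b (f b))"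

lemma lin_coord: "lin (coord b)"
  unfolding lin_iff_linear coord_def
  by (rule linear_representation[OF independent_Basis span_Basis])

lemma sum_coord: "(\<Sum>b\<in>Basis. coord b x *s b) = x"
  unfolding coord_def
  by (rule sum_representation_eq) (simp_all add: independent_Basis span_Basis finite_Basis)

lemma lin_expand: assumes "lin p" shows "(\<Sum>b\<in>Basis. coord b x * p b) = p x"
  using arg_cong[OF sum_coord[of x], of p] by (simp add: lin_sum[OF assms] lin_scale[OF assms])

lemma endo_expand: assumes "endo f" shows "(\<Sum>b\<in>Basis. coord b x *s f b) = f x"
  using arg_cong[OF sum_coord[of x], of f] by (simp add: endo_sum[OF assms] endo_scale[OF assms])

lemma tr_finite_rank:
  assumes p: "\<And>j. j \<in> J \<Longrightarrow> lin (p j)" and f: "\<And>x. f x = (\<Sum>j\<in>J. p j x *s y j)"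
  shows "tr f = (\<Sum>j\<in>J. p j (y j))"
proof -
  have "tr f = (\<Sum>b\<in>Basis. \<Sum>j\<in>J. coord b (y j) * p j b)"
    by (simp add: tr_def f lin_sum[OF lin_coord] lin_scale[OF lin_coord] mult.commute)
  also have "\<dots> = (\<Sum>j\<in>J. \<Sum>b\<in>Basis. coord b (y j) * p j b)"
    by (rule sum.swap)
  also have "\<dots> = (\<Sum>j\<in>J. p j (y j))"
    by (intro sum.cong) (simp_all add: lin_expand p)
  finally show ?thesis .
qed

lemma tr_comp_commute:
  assumes f: "endo f" and g: "endo g"
  shows "tr (\<lambda>x. f (g x)) = tr (\<lambda>x. g (f x))"
proof -
  have "tr (\<lambda>x. f (g x)) = (\<Sum>b\<in>Basis. coord b (g (f b)))"
  proof (rule tr_finite_rank[where p = "\<lambda>b x. coord b (g x)"])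
    show "f (g x) = (\<Sum>b\<in>Basis. coord b (g x) *s f b)" for x
      by (rule endo_expand[OF f, symmetric])
    show "lin (\<lambda>x. coord b (g x))" for b
      by (rule lin_comp[OF lin_coord g])
  qed
  then show ?thesis by (simp add: tr_def)
qed

lemma tr_add: "tr (\<lambda>x. f x + g x) = tr f + tr g"
  and tr_sum: "tr (\<lambda>x. \<Sum>i\<in>I. h i x) = (\<Sum>i\<in>I. tr (h i))"
  by (simp_all add: tr_def lin_add[OF lin_coord] sum.distrib lin_sum[OF lin_coord] lin_scale[OF lin_coord]
      sum_distrib_left sum.swap[of _ I])

lemma tr_diff: "tr (\<lambda>x. f x - g x) = tr f - tr g"
  by (simp add: tr_def lin_diff[OF lin_coord] sum_subtractf)

lemma coord_Basis: "b \<in> Basis \<Longrightarrow> b' \<in> Basis \<Longrightarrow> coord b b' = (if b = b' then 1 else 0)"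
  by (simp add: coord_def representation_basis independent_Basis)

lemma tr_id: "tr (\<lambda>x. x) = of_nat dimension"
  by (simp add: tr_def coord_Basis dimension_def)

text \<open>The trace of an idempotent is the rank, as is seen by computing it in a basis of the range.\<close>

lemma tr_idempotent:
  assumes f: "endo f" and idem: "\<And>x. f (f x) = f x"
  obtains n where "tr f = of_nat n" and "n = 0 \<Longrightarrow> \<forall>x. f x = 0"
proof -
  obtain B where B: "B \<subseteq> range f" "independent B" "range f \<subseteq> span B" "card B = dim (range f)"
    using basis_exists[of "range f"] by blast
  have fin: "finite B" using B(2) by (rule finiteI_independent)
  have fB: "f b = b" if "b \<in> B" for b
    using that B(1) idem by auto
  have eq: "f x = (\<Sum>b\<in>B. representation B (f x) b *s b)" for x
    by (rule sum_representation_eq[symmetric]) (use B fin in auto)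
  have lin: "lin (\<lambda>x. representation B (f x) b)" for b
  proof -
    have mem: "f x \<in> span B" for x using B(3) by auto
    show ?thesis
      by (simp add: lin_def endo_add[OF f] endo_scale[OF f] representation_add representation_scale
          B(2) mem)
  qed
  have "tr f = (\<Sum>b\<in>B. representation B (f b) b)"
    by (rule tr_finite_rank[where p = "\<lambda>b x. representation B (f x) b"]) (use lin eq in auto)
  also have "\<dots> = of_nat (card B)"
    by (simp add: fB representation_basis B(2))
  finally show ?thesis
  proof (rule that)
    assume "card B = 0"
    then have "B = {}" using fin by simp
    then show "\<forall>x. f x = 0" using B(3) by auto
  qed
qed

lemma regular_character_tr: "regular_character h = tr (\<lambda>x. h * x)"
  by (simp add: regular_character_def tr_def coord_def)

lemma lin_tr: "(\<And>x. lin (\<lambda>h. coord x (f h x))) \<Longrightarrow> lin (\<lambda>h. tr (f h))"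
  unfolding tr_def by (intro lin_sum_intro)

lemma lin_regular_character: "lin regular_character"
  unfolding regular_character_tr[abs_def] by (intro lin_tr linear_intros lin_comp[OF lin_coord])

section \<open>The square of the regular character\<close>

text \<open>The action \<open>p \<rightharpoonup> x = \<Sum> p(x\<^sub>2) x\<^sub>1\<close> of \<open>H\<^sup>*\<close> on \<open>H\<close>.\<close>

definition hit :: "('a \<Rightarrow> 'k) \<Rightarrow> 'a \<Rightarrow> 'a" where
  "hit p x = (\<Sum>(a, b)\<leftarrow>\<Delta> x. p b *s a)"

lemma lin_hit: assumes "lin q" shows "q (hit p x) = sw x (\<lambda>a b. q a * p b)"
  by (simp add: hit_def lin_of_sw[OF assms] lin_scale[OF assms] mult.commute)

lemma endo_hit:
  assumes p: "lin p" shows "endo (hit p)"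
proof -
  have bil: "bil (\<lambda>a b. q a * p b)" if "lin q" for q
    by (intro linear_intros lin_comp[OF that] lin_comp[OF p])
  show ?thesis
    unfolding endo_def
    by (intro conjI allI; rule lin_ext)
       (simp_all only: lin_hit lin_add lin_scale sw_add sw_scale bil)
qed

text \<open>The tensor product of the regular module with a module \<open>V\<close> is free of rank \<open>dim V\<close>, because
\<open>x \<otimes> v \<mapsto> \<Sum> x\<^sub>1 \<otimes> x\<^sub>2 v\<close> carries the action on the first factor to the diagonal action.  For the
regular module \<open>V\<close> this is an equality of characters.  The isomorphism is written below as the
matrix \<open>M\<close> of operators on \<open>H\<close> whose entries come from the matrix coefficients \<open>r\<close> of \<open>V\<close>.\<close>

lemma regular_character_square:
  "sw h (\<lambda>a b. regular_character a * regular_character b) = of_nat dimension * regular_character h"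
proof -
  define r where "r i j h = coord i (h * j)" for i j h
  have lin_r: "lin (r i j)" for i j
    unfolding r_def[abs_def] by (intro linear_intros lin_comp[OF lin_coord])
  have r_mult: "(\<Sum>j\<in>Basis. r i j x * r j k y) = r i k (x * y)" for i k x y
  proof -
    have "(\<Sum>j\<in>Basis. coord j (y * k) * coord i (x * j)) = coord i (x * (y * k))"
      by (rule lin_expand) (intro linear_intros lin_comp[OF lin_coord])
    then show ?thesis by (simp add: r_def mult.commute mult.assoc)
  qed
  \<comment> \<open>The inverse of \<open>M\<close> is obtained by composing the coefficients with the
    antipode.\<close>
  define M where "M i j = hit (r i j)" for i j
  define M' where "M' i j = hit (\<lambda>x. r i j (S x))" for i j
  have endo_M: "endo (M i j)" "endo (M' i j)" for i j
    unfolding M_def M'_def by (intro endo_hit lin_r lin_comp[OF lin_r] linear_intros)+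
  have M_conj: "(\<Sum>j\<in>Basis. M i j (h * M' j i x)) = (\<Sum>(a, b)\<leftarrow>\<Delta> h. r i i b *s (a * x))" for i x
  proof (rule lin_ext)
    fix p assume p: "lin p"
    note li = linear_intros lin_comp[OF p] lin_comp[OF lin_r]
    have "p (\<Sum>j\<in>Basis. M i j (h * M' j i x)) = (\<Sum>j\<in>Basis. p (M i j (h * M' j i x)))"
      by (simp add: lin_sum[OF p])
    also have "\<dots> = (\<Sum>j\<in>Basis. sw x (\<lambda>a b. p (M i j (h * a)) * r j i (S b)))"
      by (intro sum.cong[OF HOL.refl])
        (unfold M'_def, intro lin_hit[where q = "\<lambda>t. p (M i _ (h * t))"] li endo_comp[OF endo_M(1)])
    also have "\<dots> = (\<Sum>j\<in>Basis. sw x (\<lambda>a b. sw (h * a) (\<lambda>c d. p c * r i j d) * r j i (S b)))"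
      by (simp add: M_def lin_hit[OF p])
    also have "\<dots> = (\<Sum>j\<in>Basis. sw x (\<lambda>a b. sw h (\<lambda>c d. sw a (\<lambda>a1 a2. p (c * a1) * r i j (d * a2))) * r j i (S b)))"
      by (subst sw_mult) (intro li HOL.refl p lin_r)+
    also have "\<dots> = sw h (\<lambda>c d. sw x (\<lambda>a b. sw a (\<lambda>a1 a2. p (c * a1) * (\<Sum>j\<in>Basis. r i j (d * a2) * r j i (S b)))))"
      by (simp add: sw_mult_right sw_sum[symmetric] sum_distrib_left mult.assoc) (subst sw_swap, rule HOL.refl)
    also have "\<dots> = sw h (\<lambda>c d. sw x (\<lambda>a b. sw b (\<lambda>b1 b2. p (c * a) * r i i (d * b1 * S b2))))"
      unfolding r_mult by (rule sw_cong, rule sw_coassoc) (intro li)+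
    also have "\<dots> = sw h (\<lambda>c d. sw x (\<lambda>a b. sw b (\<lambda>b1 b2. p (c * a) * r i i (d * (b1 * S b2)))))"
      by (simp add: mult.assoc)
    also have "\<dots> = sw h (\<lambda>c d. p (c * x) * r i i (d * 1))"
      by (rule sw_cong, rule sw_cancel_right_S) (intro li)+
    also have "\<dots> = p (\<Sum>(a, b)\<leftarrow>\<Delta> h. r i i b *s (a * x))"
      by (simp add: lin_of_sw[OF p] lin_scale[OF p] mult.commute)
    finally show "p (\<Sum>j\<in>Basis. M i j (h * M' j i x)) = p (\<Sum>(a, b)\<leftarrow>\<Delta> h. r i i b *s (a * x))" .
  qed
  have M_inverse: "(\<Sum>i\<in>Basis. M' j i (M i j x)) = x" if j: "j \<in> Basis" for j x
  proof (rule lin_ext)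
    fix p assume p: "lin p"
    note li = linear_intros lin_comp[OF p] lin_comp[OF lin_r]
    have "p (\<Sum>i\<in>Basis. M' j i (M i j x)) = (\<Sum>i\<in>Basis. p (M' j i (M i j x)))"
      by (simp add: lin_sum[OF p])
    also have "\<dots> = (\<Sum>i\<in>Basis. sw x (\<lambda>a b. p (M' j i a) * r i j b))"
      by (intro sum.cong[OF HOL.refl], subst M_def, intro lin_hit[where q = "\<lambda>t. p (M' j _ t)"] li endo_M)
    also have "\<dots> = (\<Sum>i\<in>Basis. sw x (\<lambda>a b. sw a (\<lambda>c d. p c * r j i (S d)) * r i j b))"
      by (simp add: M'_def lin_hit[OF p])
    also have "\<dots> = sw x (\<lambda>a b. sw a (\<lambda>c d. p c * (\<Sum>i\<in>Basis. r j i (S d) * r i j b)))"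
      by (simp add: sw_mult_right sw_sum[symmetric] sum_distrib_left mult.assoc)
    also have "\<dots> = sw x (\<lambda>a b. sw b (\<lambda>c d. p a * r j j (S c * d)))"
      unfolding r_mult by (rule sw_coassoc) (intro li p)+
    also have "\<dots> = p x * r j j 1"
      by (rule sw_cancel_S_right) (intro li p lin_r)+
    also have "\<dots> = p x"
      using j by (simp add: r_def coord_Basis)
    finally show "p (\<Sum>i\<in>Basis. M' j i (M i j x)) = p x" .
  qed
  have "sw h (\<lambda>a b. regular_character a * regular_character b)
      = (\<Sum>i\<in>Basis. sw h (\<lambda>a b. tr (\<lambda>x. a * x) * r i i b))"
    by (simp add: sw_sum[symmetric] sum_distrib_left[symmetric] regular_character_tr)
       (simp add: tr_def r_def)
  also have "\<dots> = (\<Sum>i\<in>Basis. tr (\<lambda>x. \<Sum>(a, b)\<leftarrow>\<Delta> h. r i i b *s (a * x)))"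
  proof (rule sum.cong[OF HOL.refl])
    fix i
    have "sw h (\<lambda>a b. tr (\<lambda>x. a * x) * r i i b) = (\<Sum>c\<in>Basis. sw h (\<lambda>a b. coord c (a * c) * r i i b))"
      by (simp only: tr_def sum_distrib_right sw_sum)
    also have "\<dots> = tr (\<lambda>x. \<Sum>(a, b)\<leftarrow>\<Delta> h. r i i b *s (a * x))"
      by (simp add: tr_def lin_of_sw[OF lin_coord] lin_scale[OF lin_coord] mult.commute)
    finally show "sw h (\<lambda>a b. tr (\<lambda>x. a * x) * r i i b) = tr (\<lambda>x. \<Sum>(a, b)\<leftarrow>\<Delta> h. r i i b *s (a * x))" .
  qed
  also have "\<dots> = (\<Sum>i\<in>Basis. \<Sum>j\<in>Basis. tr (\<lambda>x. M i j (h * M' j i x)))"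
    by (simp add: M_conj[symmetric] tr_sum)
  also have "\<dots> = (\<Sum>i\<in>Basis. \<Sum>j\<in>Basis. tr (\<lambda>x. h * M' j i (M i j x)))"
    by (intro sum.cong[OF HOL.refl] tr_comp_commute[where g = "\<lambda>x. h * M' _ _ x"] endo_M linear_intros
        endo_comp[OF endo_M(2)])
  also have "\<dots> = (\<Sum>j\<in>Basis. \<Sum>i\<in>Basis. tr (\<lambda>x. h * M' j i (M i j x)))"
    by (rule sum.swap)
  also have "\<dots> = (\<Sum>j\<in>Basis. tr (\<lambda>x. h * (\<Sum>i\<in>Basis. M' j i (M i j x))))"
    by (simp add: sum_distrib_left tr_sum)
  also have "\<dots> = of_nat dimension * regular_character h"
    by (simp add: M_inverse regular_character_tr dimension_def)
  finally show ?thesis .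
qed

end

section \<open>Integrals and the inverse of the antipode\<close>

locale semisimple_hopf_algebra = hopf_algebra scale Basis \<Delta> \<epsilon> S
  for scale :: "'k::{alg_closed_field, field_char_0} \<Rightarrow> 'a::ring_1 \<Rightarrow> 'a" (infixr "*s" 75)
    and Basis \<Delta> \<epsilon> S +
  assumes ss: semisimple
begin

text \<open>The kernel of the counit has a complement among the left ideals, on which \<open>H\<close> must act through the
counit.\<close>

lemma left_integral_exists: "\<exists>t. (\<forall>h. h * t = \<epsilon> h *s t) \<and> \<epsilon> t = 1"
proof -
  define I where "I = {x. \<epsilon> x = 0}"
  have I: "left_ideal I"
    unfolding left_ideal_def subspace_def I_def
    by (simp add: lin_zero[OF lin_counit] lin_add[OF lin_counit] lin_scale[OF lin_counit] counit_mult)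
  obtain J where J: "left_ideal J" "I \<inter> J = {0}" "{x + y | x y. x \<in> I \<and> y \<in> J} = UNIV"
    using ss[unfolded semisimple_def, rule_format, OF I] by (elim exE conjE)
  have "1 \<in> {x + y | x y. x \<in> I \<and> y \<in> J}" by (simp only: J(3) UNIV_I)
  then obtain x t where t: "1 = x + t" "x \<in> I" "t \<in> J"
    by (elim CollectE exE conjE)
  have et: "\<epsilon> t = 1"
    using t(2) lin_add[OF lin_counit, of x t] by (simp add: t(1)[symmetric] counit_one I_def)
  have "h * t = \<epsilon> h *s t" for h
  proof -
    have "h * t - \<epsilon> h *s t \<in> J"
      using J(1) t(3) unfolding left_ideal_def by (auto intro: subspace_diff subspace_scale)
    moreover have "h * t - \<epsilon> h *s t \<in> I"
      by (simp add: I_def lin_diff[OF lin_counit] lin_scale[OF lin_counit] counit_mult et)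
    ultimately have "h * t - \<epsilon> h *s t \<in> {0}" by (simp only: J(2)[symmetric] Int_iff)
    then show ?thesis by simp
  qed
  with et show ?thesis by blast
qed

text \<open>This trace is an explicit form of the integral of \<open>H\<^sup>*\<close>; a definition as the solution of
\<open>\<Sum> lam(\<Lambda>\<^sub>1) \<Lambda>\<^sub>2 = 1\<close> would first need the bijectivity of the Frobenius map.  In particular
\<open>lam 1\<close> is the trace of \<open>S\<^sup>2\<close>.\<close>

definition lam :: "'a \<Rightarrow> 'k" where
  "lam x = tr (\<lambda>a. S (S a) * x)"

lemma lin_lam: "lin lam"
  unfolding lam_def[abs_def] by (intro lin_tr linear_intros lin_comp[OF lin_coord])

text \<open>Write \<open>1 \<otimes> h\<close> as \<open>\<Sum> S(h\<^sub>1) h\<^sub>2 \<otimes> h\<^sub>3\<close> and absorb \<open>h\<^sub>2 \<otimes> h\<^sub>3\<close> into the integral.  The integral is one-sided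
here because its two-sidedness is derived below from the bijectivity of the antipode, which in turn
rests on this lemma.\<close>

lemma left_integral_shift:
  assumes t: "\<And>h. h * t = \<epsilon> h *s t" and F: "bil F"
  shows "sw t (\<lambda>a b. F a (h * b)) = sw t (\<lambda>a b. F (S h * a) b)"
proof -
  note li = linear_intros bil_left[OF F] bil_right[OF F]
  have bF: "bil (\<lambda>a b. F (u * a) b)" for u by (intro li)
  have "sw t (\<lambda>a b. F (S h * a) b) = sw h (\<lambda>a b. sw t (\<lambda>c d. F (S a * c) d) * \<epsilon> b)"
    by (rule sw_counit_right[symmetric]) (intro li)
  also have "\<dots> = sw h (\<lambda>a b. sw (b * t) (\<lambda>c d. F (S a * c) d))"
    by (simp add: t sw_scale bF mult.commute)
  also have "\<dots> = sw h (\<lambda>a b. sw b (\<lambda>b1 b2. sw t (\<lambda>c d. F (S a * (b1 * c)) (b2 * d))))"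
    by (rule sw_cong, rule sw_mult) (intro li)
  also have "\<dots> = sw h (\<lambda>a b. sw b (\<lambda>b1 b2. sw t (\<lambda>c d. F (S a * b1 * c) (b2 * d))))"
    by (simp add: mult.assoc)
  also have "\<dots> = sw h (\<lambda>a b. sw a (\<lambda>b1 b2. sw t (\<lambda>c d. F (S b1 * b2 * c) (b * d))))"
    by (rule sw_coassoc[symmetric]) (intro li)+
  also have "\<dots> = sw t (\<lambda>c d. F (1 * c) (h * d))"
    by (rule sw_cancel_S_left) (intro li)
  finally show ?thesis by simp
qed

text \<open>By \<open>left_integral_shift\<close>, \<open>\<Sum> tr(a \<mapsto> S\<^sup>2(a) t\<^sub>1) t\<^sub>2\<close> becomes \<open>\<Sum> S(t\<^sub>1) t\<^sub>2 = \<epsilon>(t)\<close>.\<close>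

lemma left_integral_lam:
  assumes t: "\<And>h. h * t = \<epsilon> h *s t" and et: "\<epsilon> t = 1" and p: "lin p"
  shows "sw t (\<lambda>a b. lam a * p b) = p 1"
proof -
  note li = linear_intros lin_comp[OF p] lin_comp[OF lin_coord] p lin_coord
  have "sw t (\<lambda>a b. lam a * p b) = (\<Sum>c\<in>Basis. sw t (\<lambda>a b. coord c (S (S c) * a) * p b))"
    by (simp only: lam_def tr_def sum_distrib_right sw_sum)
  also have "\<dots> = (\<Sum>c\<in>Basis. sw t (\<lambda>a b. coord c a * p (S c * b)))"
    by (intro sum.cong[OF HOL.refl] left_integral_shift[OF t, where F = "\<lambda>a b. coord _ a * p b", symmetric] li)
  also have "\<dots> = sw t (\<lambda>a b. \<Sum>c\<in>Basis. coord c a * p (S c * b))"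
    by (rule sw_sum[symmetric])
  also have "\<dots> = sw t (\<lambda>a b. p (S a * b))"
    by (intro sw_cong lin_expand[where p = "\<lambda>x. p (S x * _)"] li)
  also have "\<dots> = p 1"
    by (simp add: sw_antipode_left[OF p] et)
  finally show ?thesis .
qed

text \<open>By \<open>left_integral_shift\<close> and \<open>left_integral_lam\<close>, \<open>h = \<Sum> lam(S(h) t\<^sub>1) t\<^sub>2\<close> for an integral \<open>t\<close>,
so \<open>h\<close> is determined by \<open>S h\<close>.\<close>

lemma antipode_inject: "S x = S y \<Longrightarrow> x = y"
proof -
  assume eq: "S x = S y"
  obtain t where t: "\<And>h. h * t = \<epsilon> h *s t" "\<epsilon> t = 1"
    using left_integral_exists by blast
  show "x = y"
  proof (rule lin_ext)
    fix p assume p: "lin p"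
    note li = linear_intros lin_comp[OF p] lin_comp[OF lin_lam]
    have "p (h * 1) = sw t (\<lambda>a b. lam (S h * a) * p b)" for h
    proof -
      have "p (h * 1) = sw t (\<lambda>a b. lam a * p (h * b))"
        by (rule left_integral_lam[OF t, where p = "\<lambda>b. p (h * b)", symmetric]) (intro li)
      also have "\<dots> = sw t (\<lambda>a b. lam (S h * a) * p b)"
        by (rule left_integral_shift[OF t(1)]) (intro li p lin_lam)
      finally show ?thesis .
    qed
    from this[of x] this[of y] eq show "p x = p y" by simp
  qed
qed

lemma bij_antipode: "bij S"
proof -
  have "inj S" using antipode_inject by (auto intro: injI)
  moreover have "surj S"
    using linear_inj_imp_surj[OF antipode_linear \<open>inj S\<close>] .
  ultimately show ?thesis by (simp add: bij_def)
qed

abbreviation T :: "'a \<Rightarrow> 'a" where "T \<equiv> inv_into UNIV S"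

lemma antipode_inv_antipode [simp]: "S (T x) = x" and inv_antipode_antipode [simp]: "T (S x) = x"
  using bij_antipode by (simp_all add: bij_def surj_f_inv_f)

lemma endo_inv_antipode: "endo T"
  unfolding endo_def
  by (intro conjI allI; rule antipode_inject) (simp_all add: endo_add[OF endo_antipode] endo_scale[OF endo_antipode])

lemma inv_antipode_mult: "T (x * y) = T y * T x"
  by (rule antipode_inject) (simp add: antipode_mult)

lemma inv_antipode_one: "T 1 = 1"
  by (rule antipode_inject) (simp add: antipode_one)

lemma counit_inv_antipode: "\<epsilon> (T x) = \<epsilon> x"
  using counit_antipode[of "T x"] by simp

abbreviation \<Lambda> :: 'a where "\<Lambda> \<equiv> idempotent_integral"

text \<open>The antipode turns the left integral \<open>t\<close> into a right integral \<open>S t\<close>, and the product \<open>S t * t\<close>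
equals both of them.\<close>

lemma integral_exists:
  "\<exists>t. (\<forall>h. h * t = \<epsilon> h *s t \<and> t * h = \<epsilon> h *s t) \<and> \<epsilon> t = 1 \<and> S t = t"
proof -
  obtain t where t: "\<And>h. h * t = \<epsilon> h *s t" "\<epsilon> t = 1"
    using left_integral_exists by blast
  have r: "S t * h = \<epsilon> h *s S t" for h
  proof -
    have "S t * h = S (T h * t)" by (simp add: antipode_mult)
    also have "\<dots> = \<epsilon> h *s S t" by (simp add: t counit_inv_antipode endo_scale[OF endo_antipode])
    finally show ?thesis .
  qed
  have "S t * t = t" using t(1)[of "S t"] by (simp add: counit_antipode t)
  moreover have "S t * t = S t" using r[of t] by (simp add: t)
  ultimately have "S t = t" by simp
  with t r show ?thesis by metis
qed

lemma integral:
  shows mult_integral: "h * \<Lambda> = \<epsilon> h *s \<Lambda>" and integral_mult: "\<Lambda> * h = \<epsilon> h *s \<Lambda>" and counit_integral: "\<epsilon> \<Lambda> = 1"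
    and antipode_integral: "S \<Lambda> = \<Lambda>"
proof -
  obtain t where t: "\<And>h. h * t = \<epsilon> h *s t" "\<And>h. t * h = \<epsilon> h *s t" "\<epsilon> t = 1" "S t = t"
    using integral_exists by blast
  have "\<Lambda> = t"
    unfolding idempotent_integral_def
  proof (rule the_equality)
    fix t' assume t': "(\<forall>h. h * t' = \<epsilon> h *s t' \<and> t' * h = \<epsilon> h *s t') \<and> \<epsilon> t' = 1"
    have "t' * t = t" using t(1)[of t'] t' by simp
    moreover have "t' * t = t'" using t(3) t' by (metis scale_one)
    ultimately show "t' = t" by simp
  qed (use t in auto)
  with t show "h * \<Lambda> = \<epsilon> h *s \<Lambda>" "\<Lambda> * h = \<epsilon> h *s \<Lambda>" "\<epsilon> \<Lambda> = 1" "S \<Lambda> = \<Lambda>" by auto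
qed

lemma integral_shift: "bil F \<Longrightarrow> sw \<Lambda> (\<lambda>a b. F a (h * b)) = sw \<Lambda> (\<lambda>a b. F (S h * a) b)"
  by (rule left_integral_shift[OF mult_integral])

lemma integral_lam_contract: "lin p \<Longrightarrow> sw \<Lambda> (\<lambda>a b. lam a * p b) = p 1"
  by (rule left_integral_lam[OF mult_integral counit_integral])

lemma integral_flip: "bil F \<Longrightarrow> sw \<Lambda> F = sw \<Lambda> (\<lambda>a b. F (S b) (S a))"
  using sw_of_antipode[of F \<Lambda>] by (simp add: antipode_integral)

text \<open>The Casimir element \<open>\<Sum> \<Lambda>\<^sub>1 \<otimes> S \<Lambda>\<^sub>2\<close> commutes with \<open>H\<close>; this makes it produce intertwiners.\<close>

lemma casimir_shift:
  assumes F: "bil F"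
  shows "sw \<Lambda> (\<lambda>a b. F (h * a) (S b)) = sw \<Lambda> (\<lambda>a b. F a (S b * h))"
proof -
  have "sw \<Lambda> (\<lambda>a b. F (S (T h) * a) (S b)) = sw \<Lambda> (\<lambda>a b. F a (S (T h * b)))"
    by (rule integral_shift[symmetric]) (intro linear_intros bil_left[OF F] bil_right[OF F])
  then show ?thesis by (simp add: antipode_mult)
qed

text \<open>The legs of \<open>\<Lambda>\<close> form dual bases for the bilinear form given by \<open>lam\<close>: every element expands as
\<open>h = \<Sum> lam(S(h) \<Lambda>\<^sub>1) \<Lambda>\<^sub>2\<close> and as \<open>h = \<Sum> lam(h S\<^sup>-\<^sup>1(\<Lambda>\<^sub>2)) \<Lambda>\<^sub>1\<close>.\<close>

lemma lin_lam_expand_right: "lin p \<Longrightarrow> sw \<Lambda> (\<lambda>a b. lam (S h * a) * p b) = p h"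
proof -
  assume p: "lin p"
  have "sw \<Lambda> (\<lambda>a b. lam (S h * a) * p b) = sw \<Lambda> (\<lambda>a b. lam a * p (h * b))"
    by (rule integral_shift[symmetric]) (intro linear_intros lin_lam p)
  also have "\<dots> = p (h * 1)"
    by (rule integral_lam_contract) (intro linear_intros lin_comp[OF p])
  finally show ?thesis by simp
qed

lemma lin_lam_expand_left: "lin p \<Longrightarrow> sw \<Lambda> (\<lambda>a b. p a * lam (h * T b)) = p h"
proof -
  assume p: "lin p"
  have "sw \<Lambda> (\<lambda>a b. p a * lam (h * T b)) = sw \<Lambda> (\<lambda>a b. p (S b) * lam (h * T (S a)))"
    by (rule integral_flip) (intro linear_intros lin_comp[OF lin_lam] p lin_comp[OF p] endo_comp[OF endo_inv_antipode])
  also have "\<dots> = sw \<Lambda> (\<lambda>a b. lam (S (T h) * a) * p (S b))"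
    by (simp add: mult.commute)
  also have "\<dots> = p (S (T h))"
    by (rule lin_lam_expand_right) (intro linear_intros lin_comp[OF p])
  finally show ?thesis by simp
qed

lemma lam_integral: "lam \<Lambda> = 1"
  using integral_lam_contract[OF lin_counit] by (simp add: sw_counit_right[OF lin_lam] counit_one)

lemma lam_invariant:
  assumes p: "lin p"
  shows "sw h (\<lambda>a b. lam a * p b) = lam h * p 1"
proof -
  note li = linear_intros lin_lam p lin_comp[OF lin_lam] endo_comp[OF endo_inv_antipode]
  have "sw h (\<lambda>a b. lam a * p b) = sw \<Lambda> (\<lambda>a b. sw a (\<lambda>a1 a2. lam a1 * p a2) * lam (h * T b))"
    by (rule lin_lam_expand_left[symmetric]) (intro li)
  also have "\<dots> = sw \<Lambda> (\<lambda>a b. sw a (\<lambda>a1 a2. lam a1 * p a2 * lam (h * T b)))"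
    by (simp add: sw_mult_right)
  also have "\<dots> = sw \<Lambda> (\<lambda>a b. sw b (\<lambda>b1 b2. lam a * p b1 * lam (h * T b2)))"
    by (rule sw_coassoc) (intro li)+
  also have "\<dots> = sw \<Lambda> (\<lambda>a b. lam a * sw b (\<lambda>b1 b2. p b1 * lam (h * T b2)))"
    by (simp add: sw_mult_left mult.assoc)
  also have "\<dots> = sw 1 (\<lambda>b1 b2. p b1 * lam (h * T b2))"
    by (rule integral_lam_contract) (intro li)
  also have "\<dots> = p 1 * lam (h * T 1)"
    by (rule sw_one) (intro li)
  finally show ?thesis by (simp add: inv_antipode_one mult.commute)
qed

lemma invariant_unique:
  assumes Q: "lin Q" and inv: "\<And>p h. lin p \<Longrightarrow> sw h (\<lambda>a b. Q a * p b) = Q h * p 1"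
  shows "Q h = Q \<Lambda> * lam h"
proof -
  have "Q h = sw \<Lambda> (\<lambda>a b. Q a * lam (h * T b))"
    by (rule lin_lam_expand_left[OF Q, symmetric])
  also have "\<dots> = Q \<Lambda> * lam (h * T 1)"
    by (rule inv) (intro linear_intros lin_comp[OF lin_lam] endo_comp[OF endo_inv_antipode])
  finally show ?thesis by (simp add: inv_antipode_one)
qed

section \<open>The distinguished group-like element\<close>

text \<open>For a form \<open>p\<close>, \<open>h \<mapsto> \<Sum> p(h\<^sub>1) lam(h\<^sub>2)\<close> is again an integral of \<open>H\<^sup>*\<close> on the side on which \<open>lam\<close>
is one, hence a multiple of \<open>lam\<close>.  The factor is \<open>p g\<close>, and \<open>g = 1\<close> means that \<open>lam\<close> is
two-sided.\<close>

definition g :: 'a where "g = hit lam \<Lambda>"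

lemma lin_g: "lin p \<Longrightarrow> p g = sw \<Lambda> (\<lambda>a b. p a * lam b)"
  by (simp only: g_def lin_hit)

lemma lam_coinvariant_g:
  assumes p: "lin p"
  shows "sw h (\<lambda>a b. p a * lam b) = p g * lam h"
proof -
  note li = linear_intros lin_lam p lin_comp[OF lin_lam] lin_comp[OF p]
  define Q where "Q h = sw h (\<lambda>a b. p a * lam b)" for h
  have Q: "lin Q" unfolding Q_def by (intro li)
  have "Q h = Q \<Lambda> * lam h"
  proof (rule invariant_unique[OF Q])
    fix q h assume q: "lin q"
    have "sw h (\<lambda>a b. Q a * q b) = sw h (\<lambda>a b. sw a (\<lambda>a1 a2. p a1 * lam a2 * q b))"
      by (simp add: Q_def sw_mult_right)
    also have "\<dots> = sw h (\<lambda>a b. sw b (\<lambda>b1 b2. p a * lam b1 * q b2))"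
      by (rule sw_coassoc) (intro li q)+
    also have "\<dots> = sw h (\<lambda>a b. p a * (lam b * q 1))"
      by (simp add: lam_invariant[OF q] sw_mult_left[symmetric] mult.assoc)
    also have "\<dots> = Q h * q 1"
      by (simp add: Q_def sw_mult_right mult.assoc)
    finally show "sw h (\<lambda>a b. Q a * q b) = Q h * q 1" .
  qed
  then show ?thesis by (simp add: Q_def lin_g[OF p])
qed

definition grouplike :: "'a \<Rightarrow> bool" where
  "grouplike x \<longleftrightarrow> \<epsilon> x = 1 \<and> (\<forall>F. bil F \<longrightarrow> sw x F = F x x)"

lemma grouplike_g: "grouplike g"
  unfolding grouplike_def
proof (intro conjI allI impI)
  show "\<epsilon> g = 1"
    by (simp add: lin_g[OF lin_counit] sw_counit_left[OF lin_lam] lam_integral)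
  fix F assume F: "bil F"
  note li = linear_intros lin_lam bil_left[OF F] bil_right[OF F] bilD[OF F]
  have "sw g F = sw \<Lambda> (\<lambda>a b. sw a F * lam b)"
    by (rule lin_g) (intro li F)
  also have "\<dots> = sw \<Lambda> (\<lambda>a b. sw a (\<lambda>a1 a2. F a1 a2 * lam b))"
    by (simp add: sw_mult_right)
  also have "\<dots> = sw \<Lambda> (\<lambda>a b. sw b (\<lambda>b1 b2. F a b1 * lam b2))"
    by (rule sw_coassoc) (intro li)+
  also have "\<dots> = sw \<Lambda> (\<lambda>a b. F a g * lam b)"
    by (simp add: lam_coinvariant_g bilD[OF F])
  also have "\<dots> = F g g"
    by (rule lin_g[symmetric]) (intro li)
  finally show "sw g F = F g g" .
qed

lemma grouplike_one: "grouplike 1"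
  by (simp add: grouplike_def counit_one sw_one)

lemma grouplike_mult:
  assumes x: "grouplike x" and y: "grouplike y" shows "grouplike (x * y)"
  unfolding grouplike_def
proof (intro conjI allI impI)
  show "\<epsilon> (x * y) = 1" using assms by (simp add: grouplike_def counit_mult)
  fix F assume F: "bil F"
  note li = linear_intros bil_left[OF F] bil_right[OF F]
  have "sw (x * y) F = sw x (\<lambda>a b. sw y (\<lambda>c d. F (a * c) (b * d)))"
    by (rule sw_mult[OF F])
  also have "\<dots> = sw x (\<lambda>a b. F (a * y) (b * y))"
  proof (rule sw_cong)
    fix a b
    have "bil (\<lambda>c d. F (a * c) (b * d))" by (intro li)
    then show "sw y (\<lambda>c d. F (a * c) (b * d)) = F (a * y) (b * y)"
      using y unfolding grouplike_def by blast
  qed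
  also have "\<dots> = F (x * y) (x * y)"
  proof -
    have "bil (\<lambda>a b. F (a * y) (b * y))" by (intro li)
    then show ?thesis using x unfolding grouplike_def by blast
  qed
  finally show "sw (x * y) F = F (x * y) (x * y)" .
qed

lemma grouplike_power: "grouplike x \<Longrightarrow> grouplike (x ^ n)"
  by (induction n) (simp_all add: grouplike_one grouplike_mult)

lemma grouplike_antipode:
  assumes x: "grouplike x" shows "S x * x = 1" "x * S x = 1"
proof -
  have e: "\<epsilon> x = 1" and s: "\<And>F. bil F \<Longrightarrow> sw x F = F x x"
    using x by (auto simp: grouplike_def)
  have "p (S x * x) = p 1 \<and> p (x * S x) = p 1" if p: "lin p" for p
  proof -
    have "sw x (\<lambda>a b. p (S a * b)) = p (S x * x)" "sw x (\<lambda>a b. p (a * S b)) = p (x * S x)"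
      by (intro s linear_intros lin_comp[OF p])+
    then show ?thesis
      by (simp add: sw_antipode_left[OF p] sw_antipode_right[OF p] e)
  qed
  then show "S x * x = 1" "x * S x = 1" by (auto intro: lin_ext)
qed

text \<open>If a group-like \<open>x\<close> is the combination \<open>\<Sum> r\<^sub>b b\<close> of independent group-like elements, comparison of
the two expansions of \<open>\<Delta> x\<close> gives \<open>r\<^sub>b r\<^sub>c = \<delta>\<^sub>b\<^sub>c r\<^sub>b\<close>, so \<open>x\<close> is one of the \<open>b\<close>.\<close>

lemma grouplikes_independent: "independent {x. grouplike x}"
proof -
  obtain B where B: "B \<subseteq> {x. grouplike x}" "independent B" "{x. grouplike x} \<subseteq> span B"
    using maximal_independent_subset[of "{x. grouplike x}"] by blast
  have fin: "finite B" using B(2) by (rule finiteI_independent)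
  have "x \<in> B" if x: "grouplike x" for x
  proof -
    define E where "E = extend_basis B"
    have E: "independent E" "span E = UNIV" "B \<subseteq> E"
      using B(2) by (simp_all add: E_def independent_extend_basis extend_basis_superset)
    define q where "q b y = representation E y b" for b y
    have lin_q: "lin (q b)" for b
      unfolding lin_iff_linear q_def by (rule linear_representation[OF E(1,2)])
    have qB: "q b b' = (if b = b' then 1 else 0)" if "b' \<in> B" for b b'
      using that E by (auto simp: q_def representation_basis)
    define r where "r = representation B x"
    have xr: "x = (\<Sum>b\<in>B. r b *s b)"
      unfolding r_def by (rule sum_representation_eq[symmetric]) (use B x fin in auto)
    have qx: "q b x = (if b \<in> B then r b else 0)" for b
      by (subst xr) (simp add: lin_sum[OF lin_q] lin_scale[OF lin_q] qB fin sum.If_cases if_distrib cong: if_cong)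
    have rr: "r b * r c = (if b = c then r b else 0)" if b: "b \<in> B" and c: "c \<in> B" for b c
    proof -
      have F: "bil (\<lambda>u v. q b u * q c v)" by (intro linear_intros lin_q)
      have "r b * r c = sw x (\<lambda>u v. q b u * q c v)"
        using x F by (simp add: grouplike_def qx b c)
      also have "\<dots> = (\<Sum>e\<in>B. r e * sw e (\<lambda>u v. q b u * q c v))"
      proof -
        have l: "lin (\<lambda>x. sw x (\<lambda>u v. q b u * q c v))" by (intro linear_intros lin_q)
        show ?thesis by (subst xr) (simp add: lin_sum[OF l] lin_scale[OF l])
      qed
      also have "\<dots> = (\<Sum>e\<in>B. r e * (q b e * q c e))"
        using B(1) F by (intro sum.cong) (auto simp: grouplike_def)
      also have "\<dots> = (\<Sum>e\<in>B. if e = b then (if b = c then r b else 0) else 0)"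
        by (intro sum.cong) (auto simp: qB)
      also have "\<dots> = (if b = c then r b else 0)"
        using b fin by simp
      finally show ?thesis .
    qed
    have "x \<noteq> 0" using x by (auto simp: grouplike_def lin_zero[OF lin_counit])
    moreover have "x = 0" if "\<forall>b\<in>B. r b = 0"
      using that by (subst xr) simp
    ultimately obtain b where b: "b \<in> B" "r b \<noteq> 0" by blast
    have rb: "r b = 1" using rr[OF b(1) b(1)] b(2) by simp
    have rc: "r c = 0" if "c \<in> B" "c \<noteq> b" for c
      using rr[OF b(1) that(1)] that(2) rb by auto
    have "x = (\<Sum>c\<in>B. if c = b then b else 0)"
      by (subst xr, intro sum.cong) (auto simp: rb rc)
    also have "\<dots> = b" using b fin by simp
    finally show "x \<in> B" using b by simp
  qed
  then have "{x. grouplike x} \<subseteq> B" by auto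
  with B(2) show ?thesis using dependent_mono by blast
qed

lemma g_finite_order: obtains N where "N > 0" "g ^ N = 1"
proof -
  have "finite {x. grouplike x}"
    by (rule finiteI_independent[OF grouplikes_independent])
  then have "finite (range (\<lambda>n::nat. g ^ n))"
    by (rule finite_subset[rotated]) (auto simp: grouplike_power grouplike_g)
  then have "\<not> inj (\<lambda>n::nat. g ^ n)"
    using finite_imageD infinite_UNIV_nat by blast
  then obtain m n where mn: "m < n" "g ^ m = g ^ n"
    by (metis injI linorder_neqE_nat)
  have "g ^ m * g ^ (n - m) = g ^ n"
    using mn(1) by (simp add: power_add[symmetric])
  then have "g ^ m * g ^ (n - m) = g ^ m"
    by (simp only: mn(2))
  then have "S (g ^ m) * g ^ m = S (g ^ m) * (g ^ m * g ^ (n - m))"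
    by simp
  then have "1 = g ^ (n - m)"
    using grouplike_antipode(1)[OF grouplike_power[OF grouplike_g]] by (simp add: mult.assoc[symmetric])
  with mn show ?thesis by (intro that[of "n - m"]) auto
qed

text \<open>In \<open>\<Sum> lam(x \<Lambda>\<^sub>1) lam(\<Lambda>\<^sub>2)\<close>, which is \<open>lam(x g)\<close> by the definition of \<open>g\<close>, the factor \<open>x\<close> can be
moved to the second leg, where it appears as \<open>S\<^sup>-\<^sup>1 x\<close>.\<close>

lemma lam_antipode_g: "lam (S h) = lam (g * h)"
proof -
  have *: "lam (x * g) = lam (T x)" for x
  proof -
    note li = linear_intros lin_lam lin_comp[OF lin_lam] endo_comp[OF endo_inv_antipode] endo_inv_antipode
    have "lam (x * g) = sw \<Lambda> (\<lambda>a b. lam (x * a) * lam (T (S b)))"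
      by (simp) (rule lin_g, intro li)
    also have "\<dots> = sw \<Lambda> (\<lambda>a b. lam a * lam (T (S b * x)))"
      by (rule casimir_shift[where F = "\<lambda>u v. lam u * lam (T v)"]) (intro li)
    also have "\<dots> = sw \<Lambda> (\<lambda>a b. lam a * lam (T x * b))"
      by (simp add: inv_antipode_mult)
    also have "\<dots> = lam (T x * 1)"
      by (rule integral_lam_contract) (intro li)
    finally show ?thesis by simp
  qed
  have "lam (g * h) = lam (S (g * h) * g)"
    using *[of "S (g * h)"] by simp
  also have "\<dots> = lam (S h)"
    by (simp add: antipode_mult mult.assoc grouplike_antipode[OF grouplike_g])
  finally show ?thesis by simp
qed

section \<open>The trace of the square of the antipode\<close>

text \<open>Radford's trace formula.  It is the trace computed in the dual bases given by the legs of \<open>\<Lambda>\<close>.\<close>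

lemma tr_formula:
  assumes f: "endo f"
  shows "tr f = sw \<Lambda> (\<lambda>a b. lam (S (f b) * a))"
proof -
  note li = linear_intros lin_lam lin_comp[OF lin_lam] lin_comp[OF lin_coord] f endo_comp[OF f] lin_coord
  have *: "coord c (f x) = sw \<Lambda> (\<lambda>a b. lam (S x * a) * coord c (f b))" for c x
    by (rule lin_lam_expand_right[symmetric]) (intro li)
  have "tr f = (\<Sum>c\<in>Basis. sw \<Lambda> (\<lambda>a b. lam (S c * a) * coord c (f b)))"
    unfolding tr_def by (intro sum.cong[OF HOL.refl] *)
  also have "\<dots> = sw \<Lambda> (\<lambda>a b. \<Sum>c\<in>Basis. coord c (f b) * lam (S c * a))"
    by (simp add: sw_sum mult.commute)
  also have "\<dots> = sw \<Lambda> (\<lambda>a b. lam (S (f b) * a))"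
    by (intro sw_cong lin_expand[where p = "\<lambda>x. lam (S x * _)"] li)
  finally show ?thesis .
qed

lemma tr_inv_antipode_squared: "tr (\<lambda>x. T (T x) * h) = lam (S h)"
proof -
  note li = linear_intros lin_lam lin_comp[OF lin_lam] endo_inv_antipode endo_comp[OF endo_inv_antipode]
  have "tr (\<lambda>x. T (T x) * h) = sw \<Lambda> (\<lambda>a b. lam (S (T (T b) * h) * a))"
    by (rule tr_formula) (intro li)
  also have "\<dots> = sw \<Lambda> (\<lambda>a b. lam (S h * T (S a * b)))"
    by (simp add: antipode_mult inv_antipode_mult mult.assoc)
  also have "\<dots> = \<epsilon> \<Lambda> * lam (S h * T 1)"
    by (rule sw_antipode_left) (intro li)
  finally show ?thesis by (simp add: inv_antipode_one counit_integral)
qed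

lemma regular_character_integral: "regular_character \<Lambda> = 1"
proof -
  have "tr (\<lambda>x. \<Lambda> * x) = (\<Sum>j\<in>{()}. \<epsilon> \<Lambda>)"
    by (rule tr_finite_rank[where p = "\<lambda>_. \<epsilon>" and y = "\<lambda>_. \<Lambda>"]) (simp_all add: lin_counit integral_mult)
  then show ?thesis by (simp add: regular_character_tr counit_integral)
qed

lemma regular_character_antipode_squared: "regular_character (S (S h)) = regular_character h"
proof -
  have "regular_character (S (S h)) = tr (\<lambda>x. S (S (h * T (T x))))"
    by (simp add: regular_character_tr antipode_mult)
  also have "\<dots> = tr (\<lambda>x. h * T (T (S (S x))))"
    by (rule tr_comp_commute) (intro linear_intros endo_comp[OF endo_inv_antipode] endo_inv_antipode)+
  finally show ?thesis by (simp add: regular_character_tr)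
qed

lemma dimension_pos: "dimension > 0"
proof -
  have "Basis \<noteq> {}"
    using sum_coord[of 1] by auto
  then show ?thesis by (simp add: dimension_def card_gt_0_iff finite_Basis)
qed

text \<open>An operator with \<open>f\<^sup>3 = f\<close> is the difference of the idempotents \<open>(f\<^sup>2 + f) / 2\<close> and
\<open>(f\<^sup>2 - f) / 2\<close>.\<close>

lemma tr_tripotent:
  assumes f: "endo f" and fff: "\<And>x. f (f (f x)) = f x"
  obtains m :: int where "tr f = of_int m"
proof -
  define p where "p x = (1/2) *s (f (f x) + f x)" for x
  define q where "q x = (1/2) *s (f (f x) - f x)" for x
  have half: "(1/2) *s x + (1/2) *s x = x" "(1/2) *s ((1/2) *s (x + x)) = (1/2) *s x" for x
    by (simp_all add: scale_left_distrib[symmetric] scale_right_distrib)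
  have p: "endo p" and q: "endo q"
    unfolding p_def[abs_def] q_def[abs_def]
    by (intro endo_scale_const endo_plus endo_minus' f endo_comp[OF f])+
  have pp: "p (p x) = p x" for x
  proof -
    have "p (p x) = (1/2) *s ((1/2) *s ((f (f x) + f x) + (f (f x) + f x)))"
      by (simp add: p_def endo_scale[OF f] endo_add[OF f] fff scale_right_distrib[symmetric] add.commute
        del: scale_scale)
    then show ?thesis by (simp only: half(2) p_def)
  qed
  have qq: "q (q x) = q x" for x
  proof -
    have "q (q x) = (1/2) *s ((1/2) *s ((f (f x) - f x) + (f (f x) - f x)))"
      by (simp add: q_def endo_scale[OF f] endo_diff[OF f] fff scale_right_diff_distrib[symmetric]
        del: scale_scale)
    then show ?thesis by (simp only: half(2) q_def)
  qed
  obtain m where m: "tr p = of_nat m" using tr_idempotent[OF p pp] by blast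
  obtain n where n: "tr q = of_nat n" using tr_idempotent[OF q qq] by blast
  have "f x = p x - q x" for x
    using half(1)[of "f x"] by (simp add: p_def q_def scale_right_distrib scale_right_diff_distrib)
  then have "f = (\<lambda>x. p x - q x)" by (rule ext)
  then have "tr f = tr p - tr q"
    by (simp only: tr_diff)
  then have "tr f = of_int (int m - int n)" by (simp add: m n)
  then show ?thesis using that by blast
qed

text \<open>The Larson--Radford argument.  The operator \<open>f\<close> is the product of \<open>S\<^sup>2\<close> and the projection \<open>P\<close> given
by the idempotent \<open>\<chi> / d\<close> of \<open>H\<^sup>*\<close>, where \<open>\<chi>\<close> is the regular character.  Its trace is an integer, and
by the trace formula it is \<open>(\<chi> / d)(\<Lambda>) lam 1 = lam 1 / d\<close>.\<close>

lemma antipode_involutive_if_power4: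
  assumes lam1: "lam 1 \<noteq> 0" and antipode_power4: "\<And>x. S (S (S (S x))) = x"
  shows "S (S x) = x"
proof -
  define d where "d = dimension"
  define E where "E h = regular_character h / of_nat d" for h
  have d0: "(of_nat d :: 'k) \<noteq> 0" using dimension_pos by (simp add: d_def)
  have E: "lin E"
    using lin_regular_character by (auto simp: lin_def E_def add_divide_distrib)
  have EE: "sw h (\<lambda>a b. E a * E b) = E h" for h
  proof -
    have "sw h (\<lambda>a b. E a * E b)
        = (1 / (of_nat d * of_nat d)) * sw h (\<lambda>a b. regular_character a * regular_character b)"
      by (simp add: E_def sw_mult_left)
    then show ?thesis
      using d0 by (simp add: regular_character_square E_def d_def)
  qed
  define P where "P = hit E"
  have P: "endo P" unfolding P_def by (rule endo_hit[OF E])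
  have lin_P: "p (P x) = sw x (\<lambda>a b. p a * E b)" if "lin p" for p x
    unfolding P_def by (rule lin_hit[OF that])
  have PP: "P (P x) = P x" for x
  proof (rule lin_ext)
    fix p assume p: "lin p"
    note li = linear_intros p E P lin_comp[OF p]
    have "p (P (P x)) = sw x (\<lambda>a b. p (P a) * E b)"
      by (rule lin_P) (intro li)
    also have "\<dots> = sw x (\<lambda>a b. sw a (\<lambda>a1 a2. p a1 * E a2 * E b))"
      by (simp add: lin_P[OF p] sw_mult_right)
    also have "\<dots> = sw x (\<lambda>a b. sw b (\<lambda>b1 b2. p a * E b1 * E b2))"
      by (rule sw_coassoc) (intro li)+
    also have "\<dots> = p (P x)"
      by (simp add: lin_P[OF p] EE sw_mult_left[symmetric] mult.assoc)
    finally show "p (P (P x)) = p (P x)" .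
  qed
  have sw_S2: "sw (S (S b)) F = sw b (\<lambda>u v. F (S (S u)) (S (S v)))" if F: "bil F" for b F
    using sw_of_antipode[OF F, of "S b"] sw_of_antipode[of "\<lambda>u v. F (S v) (S u)" b]
    by (simp add: bilI linear_intros bil_left[OF F] bil_right[OF F])
  have PS: "P (S (S x)) = S (S (P x))" for x
  proof (rule lin_ext)
    fix p assume p: "lin p"
    note li = linear_intros p E lin_comp[OF p]
    have "p (P (S (S x))) = sw (S (S x)) (\<lambda>a b. p a * E b)"
      by (rule lin_P[OF p])
    also have "\<dots> = sw x (\<lambda>a b. p (S (S a)) * E (S (S b)))"
      by (rule sw_S2) (intro li)
    also have "\<dots> = sw x (\<lambda>a b. p (S (S a)) * E b)"
      by (simp add: E_def regular_character_antipode_squared)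
    also have "\<dots> = p (S (S (P x)))"
      by (rule lin_P[symmetric]) (intro li)
    finally show "p (P (S (S x))) = p (S (S (P x)))" .
  qed
  define f where "f x = P (S (S x))" for x
  have f: "endo f" unfolding f_def[abs_def] by (intro linear_intros endo_comp[OF P])
  have fff: "f (f (f x)) = f x" for x
    by (simp add: f_def PS PP antipode_power4)
  obtain m :: int where m: "tr f = of_int m"
    using tr_tripotent[OF f fff] by blast
  have trf: "tr f = lam 1 / of_nat d"
  proof -
    note li = linear_intros lin_lam lin_comp[OF lin_lam] E lin_comp[OF E]
    have "tr f = sw \<Lambda> (\<lambda>a b. lam (S (f b) * a))"
      by (rule tr_formula[OF f])
    also have "\<dots> = sw \<Lambda> (\<lambda>a b. sw b (\<lambda>c d. lam (S (S (S c)) * a) * E d))"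
    proof (rule sw_cong)
      fix a b
      have "lam (S (f b) * a) = lam (S (S (S (P b))) * a)"
        by (simp add: f_def PS)
      also have "\<dots> = sw b (\<lambda>c d. lam (S (S (S c)) * a) * E d)"
        by (rule lin_P) (intro li)
      finally show "lam (S (f b) * a) = sw b (\<lambda>c d. lam (S (S (S c)) * a) * E d)" .
    qed
    also have "\<dots> = sw \<Lambda> (\<lambda>a b. sw a (\<lambda>c d. lam (S (S (S d)) * c) * E b))"
      by (rule sw_coassoc[symmetric]) (intro li)+
    also have "\<dots> = sw \<Lambda> (\<lambda>a b. sw a (\<lambda>c d. lam (S (S (S (S c * d))))) * E b)"
      by (simp add: antipode_mult antipode_power4 sw_mult_right)
    also have "\<dots> = sw \<Lambda> (\<lambda>a b. (\<epsilon> a * lam (S (S (S 1)))) * E b)"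
      by (subst sw_antipode_left[where p = "\<lambda>t. lam (S (S (S t)))"]) (intro li HOL.refl)+
    also have "\<dots> = lam 1 * sw \<Lambda> (\<lambda>a b. \<epsilon> a * E b)"
      by (simp add: antipode_one sw_mult_left ac_simps)
    also have "\<dots> = lam 1 / of_nat d"
      by (simp add: sw_counit_left[OF E]) (simp add: E_def regular_character_integral)
    finally show ?thesis .
  qed
  have lam1m: "lam 1 = of_int (int d * m)"
    using trf m d0 by (simp add: field_simps)
  \<comment> \<open>The projections onto the eigenspaces of \<open>S\<^sup>2\<close> for \<open>1\<close> and
    \<open>-1\<close>; their ranks \<open>a\<close> and \<open>b\<close> satisfy \<open>a + b = d\<close> and
    \<open>a - b = d m\<close>.\<close>
  define p where "p x = (1/2) *s (x + S (S x))" for x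
  define q where "q x = (1/2) *s (x - S (S x))" for x
  have half: "(1/2) *s x + (1/2) *s x = x" "(1/2) *s ((1/2) *s (x + x)) = (1/2) *s x" for x
    by (simp_all add: scale_left_distrib[symmetric] scale_right_distrib)
  have p: "endo p" and q: "endo q"
    unfolding p_def[abs_def] q_def[abs_def]
    by (intro endo_scale_const endo_plus endo_minus' linear_intros)+
  have pp: "p (p x) = p x" for x
  proof -
    have "p (p x) = (1/2) *s ((1/2) *s ((x + S (S x)) + (x + S (S x))))"
      by (simp add: p_def endo_scale[OF endo_antipode] endo_add[OF endo_antipode] antipode_power4 scale_right_distrib[symmetric]
          add.commute del: scale_scale)
    then show ?thesis by (simp only: half(2) p_def)
  qed
  have qq: "q (q x) = q x" for x
  proof -
    have "q (q x) = (1/2) *s ((1/2) *s ((x - S (S x)) + (x - S (S x))))"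
      by (simp add: q_def endo_scale[OF endo_antipode] endo_diff[OF endo_antipode] antipode_power4 scale_right_diff_distrib[symmetric]
        del: scale_scale)
    then show ?thesis by (simp only: half(2) q_def)
  qed
  obtain a where a: "tr p = of_nat a" "a = 0 \<Longrightarrow> \<forall>x. p x = 0" using tr_idempotent[OF p pp] by blast
  obtain b where b: "tr q = of_nat b" "b = 0 \<Longrightarrow> \<forall>x. q x = 0" using tr_idempotent[OF q qq] by blast
  have "x = p x + q x" "S (S x) = p x - q x" for x
    using half(1)[of x] half(1)[of "S (S x)"]
    by (simp_all add: p_def q_def scale_right_distrib scale_right_diff_distrib)
  then have "tr (\<lambda>x. x) = tr p + tr q" "tr (\<lambda>x. S (S x)) = tr p - tr q"
    by (simp_all add: tr_add[symmetric] tr_diff[symmetric])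
  moreover have "tr (\<lambda>x. S (S x)) = lam 1"
    by (simp add: lam_def)
  ultimately have "of_nat d = (of_nat (a + b) :: 'k)" "of_int (int d * m) = (of_int (int a - int b) :: 'k)"
    using lam1m by (simp_all add: tr_id a b d_def)
  then have ab: "d = a + b" "int d * m = int a - int b"
    by (simp_all only: of_nat_eq_iff of_int_eq_iff)
  \<comment> \<open>The eigenspace for \<open>1\<close> contains the unit, which excludes \<open>m <
    0\<close>.\<close>
  have "p 1 = 1" by (simp only: p_def antipode_one scale_right_distrib half(1))
  then have a0: "a > 0" using a(2) by (metis gr0I zero_neq_one)
  have m0: "m \<noteq> 0" using lam1 lam1m by auto
  have "b = 0"
  proof (cases "m > 0")
    case True
    then have "int d * m \<ge> int d * 1" by (intro mult_left_mono) auto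
    then show ?thesis using ab by auto
  next
    case False
    then have "int d * m \<le> int d * (-1)" using m0 by (intro mult_left_mono) auto
    then show ?thesis using ab a0 by auto
  qed
  then have "q x = 0" using b(2) by blast
  then show ?thesis by (simp add: q_def)
qed

end

section \<open>Schur's lemma\<close>

lemma sum_diag_mult_commute:
  fixes A B :: "'k::comm_ring_1 mat"
  assumes "A \<in> carrier_mat n m" "B \<in> carrier_mat m n"
  shows "(\<Sum>i<n. (A * B) $$ (i, i)) = (\<Sum>i<m. (B * A) $$ (i, i))"
proof -
  have "(\<Sum>i<n. (A * B) $$ (i, i)) = (\<Sum>i<n. \<Sum>j<m. A $$ (i, j) * B $$ (j, i))"
    using assms by (intro sum.cong) (auto simp: scalar_prod_def lessThan_atLeast0)
  also have "\<dots> = (\<Sum>j<m. \<Sum>i<n. B $$ (j, i) * A $$ (i, j))"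
    by (subst sum.swap) (simp add: mult.commute)
  also have "\<dots> = (\<Sum>i<m. (B * A) $$ (i, i))"
    using assms by (intro sum.cong) (auto simp: scalar_prod_def lessThan_atLeast0)
  finally show ?thesis .
qed

lemma smult_mat_mult_vec:
  fixes v :: "'k::comm_ring_1 vec"
  shows "v \<in> carrier_vec n \<Longrightarrow> (c \<cdot>\<^sub>m 1\<^sub>m n) *\<^sub>v v = c \<cdot>\<^sub>v v"
  by (intro eq_vecI) auto

lemma mat_eq_0_of_mult_vec:
  fixes A :: "'k::comm_ring_1 mat"
  assumes A: "A \<in> carrier_mat n m" and 0: "\<And>v. v \<in> carrier_vec m \<Longrightarrow> A *\<^sub>v v = 0\<^sub>v n"
  shows "A = 0\<^sub>m n m"
proof (rule eq_matI)
  fix i j assume "i < dim_row (0\<^sub>m n m :: 'k mat)" "j < dim_col (0\<^sub>m n m :: 'k mat)"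
  then have ij: "i < n" "j < m" by auto
  have "A $$ (i, j) = (A *\<^sub>v unit_vec m j) $ i"
    using A ij by simp
  also have "\<dots> = 0"
    using 0[of "unit_vec m j"] ij by simp
  finally show "A $$ (i, j) = 0\<^sub>m n m $$ (i, j)" using ij by simp
qed (use A in auto)

context hopf_algebra
begin

lemma representation_carrier: "is_representation n \<rho> \<Longrightarrow> \<rho> x \<in> carrier_mat n n"
  by (simp add: is_representation_def)

lemma representation_mult: "is_representation n \<rho> \<Longrightarrow> \<rho> (x * y) = \<rho> x * \<rho> y"
  by (simp add: is_representation_def)

lemma representation_one: "is_representation n \<rho> \<Longrightarrow> \<rho> 1 = 1\<^sub>m n"
  by (simp add: is_representation_def)

lemma irreducible_is_representation: "irreducible_representation n \<rho> \<Longrightarrow> is_representation n \<rho>"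
  and irreducible_pos: "irreducible_representation n \<rho> \<Longrightarrow> n > 0"
  by (simp_all add: irreducible_representation_def)

lemma irreducibleD:
  "irreducible_representation n \<rho> \<Longrightarrow> invariant_subspace n \<rho> W \<Longrightarrow> W \<noteq> {0\<^sub>v n} \<Longrightarrow> W = carrier_vec n"
  by (auto simp: irreducible_representation_def)

lemma lin_entry:
  assumes \<rho>: "is_representation n \<rho>" and "i < n" "j < n"
  shows "lin (\<lambda>x. \<rho> x $$ (i, j))"
proof -
  have "dim_row (\<rho> x) = n" "dim_col (\<rho> x) = n" for x
    using representation_carrier[OF \<rho>, of x] by auto
  then show ?thesis
    using assms unfolding lin_def is_representation_def by simp
qed

lemma entry_mult:
  assumes \<rho>: "is_representation n \<rho>" and "i < n" "j < n"
  shows "\<rho> (x * y) $$ (i, j) = (\<Sum>p<n. \<rho> x $$ (i, p) * \<rho> y $$ (p, j))"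
  using assms representation_carrier[OF \<rho>, of x] representation_carrier[OF \<rho>, of y]
  by (auto simp: representation_mult scalar_prod_def lessThan_atLeast0)

definition chi :: "nat \<Rightarrow> ('a \<Rightarrow> 'k mat) \<Rightarrow> 'a \<Rightarrow> 'k" where
  "chi n \<rho> h = (\<Sum>i<n. \<rho> h $$ (i, i))"

lemma irreducible_characters_eq:
  "irreducible_characters = {(n, chi n \<rho>) | n \<rho>. irreducible_representation n \<rho>}"
  by (simp add: irreducible_characters_def chi_def[abs_def])

lemma lin_chi: "is_representation n \<rho> \<Longrightarrow> lin (chi n \<rho>)"
  unfolding chi_def[abs_def] by (intro lin_sum_intro lin_entry) auto

lemma schur_lemma:
  fixes \<rho> \<sigma> :: "'a \<Rightarrow> 'k mat"
  assumes \<rho>: "irreducible_representation n \<rho>" and \<sigma>: "irreducible_representation m \<sigma>"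
    and A: "A \<in> carrier_mat n m" and comm: "\<And>x. \<rho> x * A = A * \<sigma> x" and nz: "A \<noteq> 0\<^sub>m n m"
  obtains A' where "A' \<in> carrier_mat m n" "A * A' = 1\<^sub>m n" "A' * A = 1\<^sub>m m"
proof -
  note car = A representation_carrier[OF irreducible_is_representation[OF \<rho>]]
    representation_carrier[OF irreducible_is_representation[OF \<sigma>]]
  have comm_vec: "A *\<^sub>v (\<sigma> x *\<^sub>v v) = \<rho> x *\<^sub>v (A *\<^sub>v v)" if "v \<in> carrier_vec m" for x v
    using that car comm[of x] by (metis assoc_mult_mat_vec)
  define W where "W = {v \<in> carrier_vec m. A *\<^sub>v v = 0\<^sub>v n}"
  have "invariant_subspace m \<sigma> W"
    unfolding invariant_subspace_def W_def
  proof (intro conjI allI ballI)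
    fix x v assume "v \<in> {v \<in> carrier_vec m. A *\<^sub>v v = 0\<^sub>v n}"
    then have v: "v \<in> carrier_vec m" "A *\<^sub>v v = 0\<^sub>v n" by auto
    have "\<rho> x *\<^sub>v 0\<^sub>v n = 0\<^sub>v n" using car(2)[of x] by auto
    then show "\<sigma> x *\<^sub>v v \<in> {v \<in> carrier_vec m. A *\<^sub>v v = 0\<^sub>v n}"
      using v car(3)[of x] comm_vec[OF v(1), of x] by auto
  next
    show "0\<^sub>v m \<in> {v \<in> carrier_vec m. A *\<^sub>v v = 0\<^sub>v n}" using A by auto
  next
    fix v w assume "v \<in> {v \<in> carrier_vec m. A *\<^sub>v v = 0\<^sub>v n}" "w \<in> {v \<in> carrier_vec m. A *\<^sub>v v = 0\<^sub>v n}"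
    then show "v + w \<in> {v \<in> carrier_vec m. A *\<^sub>v v = 0\<^sub>v n}"
      using A by (auto simp: mult_add_distrib_mat_vec[of A n m])
  next
    fix c v assume "v \<in> {v \<in> carrier_vec m. A *\<^sub>v v = 0\<^sub>v n}"
    then show "c \<cdot>\<^sub>v v \<in> {v \<in> carrier_vec m. A *\<^sub>v v = 0\<^sub>v n}"
      using A by (auto simp: mult_mat_vec[of A n m])
  qed auto
  moreover have "W \<noteq> carrier_vec m"
    using mat_eq_0_of_mult_vec[OF A] nz unfolding W_def by blast
  ultimately have W: "W = {0\<^sub>v m}"
    using irreducibleD[OF \<sigma>] by blast
  define R where "R = {A *\<^sub>v v | v. v \<in> carrier_vec m}"
  have "invariant_subspace n \<rho> R"
    unfolding invariant_subspace_def R_def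
  proof (intro conjI allI ballI)
    show "{A *\<^sub>v v | v. v \<in> carrier_vec m} \<subseteq> carrier_vec n" using A by auto
    show "0\<^sub>v n \<in> {A *\<^sub>v v | v. v \<in> carrier_vec m}"
      using A by (auto intro!: exI[of _ "0\<^sub>v m"])
  next
    fix v w assume "v \<in> {A *\<^sub>v v | v. v \<in> carrier_vec m}" "w \<in> {A *\<^sub>v v | v. v \<in> carrier_vec m}"
    then obtain v' w' where "v = A *\<^sub>v v'" "w = A *\<^sub>v w'" "v' \<in> carrier_vec m" "w' \<in> carrier_vec m"
      by blast
    then have "v + w = A *\<^sub>v (v' + w')" "v' + w' \<in> carrier_vec m"
      using A by (auto simp: mult_add_distrib_mat_vec[of A n m])
    then show "v + w \<in> {A *\<^sub>v v | v. v \<in> carrier_vec m}" by blast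
  next
    fix c v assume "v \<in> {A *\<^sub>v v | v. v \<in> carrier_vec m}"
    then obtain v' where "v = A *\<^sub>v v'" "v' \<in> carrier_vec m" by blast
    then have "c \<cdot>\<^sub>v v = A *\<^sub>v (c \<cdot>\<^sub>v v')" "c \<cdot>\<^sub>v v' \<in> carrier_vec m"
      using A by (auto simp: mult_mat_vec[of A n m])
    then show "c \<cdot>\<^sub>v v \<in> {A *\<^sub>v v | v. v \<in> carrier_vec m}" by blast
  next
    fix x v assume "v \<in> {A *\<^sub>v v | v. v \<in> carrier_vec m}"
    then obtain v' where "v = A *\<^sub>v v'" "v' \<in> carrier_vec m" by blast
    then have "\<rho> x *\<^sub>v v = A *\<^sub>v (\<sigma> x *\<^sub>v v')" "\<sigma> x *\<^sub>v v' \<in> carrier_vec m"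
      using car(3)[of x] by (auto simp: comm_vec)
    then show "\<rho> x *\<^sub>v v \<in> {A *\<^sub>v v | v. v \<in> carrier_vec m}" by blast
  qed
  moreover have "R \<noteq> {0\<^sub>v n}"
    using mat_eq_0_of_mult_vec[OF A] nz unfolding R_def by blast
  ultimately have R: "R = carrier_vec n"
    using irreducibleD[OF \<rho>] by blast
  have "\<exists>v. v \<in> carrier_vec m \<and> A *\<^sub>v v = unit_vec n i" if "i < n" for i
  proof -
    have "unit_vec n i \<in> R" by (simp add: R)
    then show ?thesis unfolding R_def by force
  qed
  then obtain f where f: "\<And>i. i < n \<Longrightarrow> f i \<in> carrier_vec m \<and> A *\<^sub>v f i = unit_vec n i"
    by metis
  define A' where "A' = mat m n (\<lambda>(i, j). f j $ i)"
  have A': "A' \<in> carrier_mat m n" by (simp add: A'_def)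
  have colA': "col A' j = f j" if "j < n" for j
    using that f[OF that] by (auto simp: A'_def)
  have right: "A * A' = 1\<^sub>m n"
  proof (rule eq_matI)
    fix i j assume "i < dim_row (1\<^sub>m n :: 'k mat)" "j < dim_col (1\<^sub>m n :: 'k mat)"
    then have ij: "i < n" "j < n" by auto
    have "(A * A') $$ (i, j) = (A *\<^sub>v f j) $ i"
      using A A' ij by (simp add: colA')
    also have "\<dots> = 1\<^sub>m n $$ (i, j)"
      using f[OF ij(2)] ij by simp
    finally show "(A * A') $$ (i, j) = 1\<^sub>m n $$ (i, j)" .
  qed (use A A' in auto)
  have left: "A' * A = 1\<^sub>m m"
  proof -
    have "A' * A - 1\<^sub>m m = 0\<^sub>m m m"
    proof (rule mat_eq_0_of_mult_vec)
      fix v :: "'k vec" assume v: "v \<in> carrier_vec m"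
      have "A *\<^sub>v ((A' * A - 1\<^sub>m m) *\<^sub>v v) = (A * (A' * A - 1\<^sub>m m)) *\<^sub>v v"
        by (rule assoc_mult_mat_vec[symmetric]) (use A A' v in auto)
      also have "A * (A' * A - 1\<^sub>m m) = A * (A' * A) - A * 1\<^sub>m m"
        by (rule mult_minus_distrib_mat) (use A A' in auto)
      also have "A * (A' * A) = A"
        using A A' right by (simp add: assoc_mult_mat[symmetric, of A n m A' n A m])
      also have "A - A * 1\<^sub>m m = 0\<^sub>m n m" using A by auto
      also have "0\<^sub>m n m *\<^sub>v v = 0\<^sub>v n" using v by auto
      finally have "(A' * A - 1\<^sub>m m) *\<^sub>v v \<in> W"
        using A A' v unfolding W_def by (auto intro!: mult_mat_vec_carrier)
      then show "(A' * A - 1\<^sub>m m) *\<^sub>v v = 0\<^sub>v m" by (simp add: W)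
    qed (use A A' in auto)
    then have "A' * A - 1\<^sub>m m + 1\<^sub>m m = 0\<^sub>m m m + 1\<^sub>m m" by simp
    moreover have "A' * A - 1\<^sub>m m + 1\<^sub>m m = A' * A"
      by (rule eq_matI) (use A A' in auto)
    ultimately show ?thesis by simp
  qed
  show ?thesis using that[OF A' right left] .
qed

end

context semisimple_hopf_algebra
begin

lemma intertwiner_degree:
  assumes "A \<in> carrier_mat n m" "A' \<in> carrier_mat m n" "A * A' = (1\<^sub>m n :: 'k mat)" "A' * A = 1\<^sub>m m"
  shows "n = m"
proof -
  have "(of_nat n :: 'k) = of_nat m"
    using sum_diag_mult_commute[OF assms(1,2)] by (simp add: assms(3,4))
  then show ?thesis by simp
qed

lemma schur_scalar:
  fixes \<rho> :: "'a \<Rightarrow> 'k mat"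
  assumes \<rho>: "irreducible_representation n \<rho>"
    and A: "A \<in> carrier_mat n n" and comm: "\<And>x. \<rho> x * A = A * \<rho> x"
  obtains c where "A = c \<cdot>\<^sub>m 1\<^sub>m n"
proof -
  have "degree (char_poly A) > 0"
    using degree_monic_char_poly[OF A] irreducible_pos[OF \<rho>] by simp
  then obtain c where "poly (char_poly A) c = 0"
    using alg_closed_imp_poly_has_root by blast
  then have "eigenvalue A c" using eigenvalue_root_char_poly[OF A] by simp
  then obtain v where v: "v \<in> carrier_vec n" "v \<noteq> 0\<^sub>v n" "A *\<^sub>v v = c \<cdot>\<^sub>v v"
    using A unfolding eigenvalue_def eigenvector_def by auto
  define B where "B = A - c \<cdot>\<^sub>m 1\<^sub>m n"
  have B: "B \<in> carrier_mat n n" unfolding B_def by (intro minus_carrier_mat smult_carrier_mat one_carrier_mat)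
  have comm': "\<rho> x * B = B * \<rho> x" for x
  proof -
    have r: "\<rho> x \<in> carrier_mat n n"
      by (rule representation_carrier[OF irreducible_is_representation[OF \<rho>]])
    have "\<rho> x * B = \<rho> x * A - \<rho> x * (c \<cdot>\<^sub>m 1\<^sub>m n)"
      unfolding B_def by (rule mult_minus_distrib_mat) (use r A in auto)
    also have "\<rho> x * (c \<cdot>\<^sub>m 1\<^sub>m n) = (c \<cdot>\<^sub>m 1\<^sub>m n) * \<rho> x"
      using r by (simp add: mult_smult_distrib[OF r, of "1\<^sub>m n" n c] mult_smult_assoc_mat[of "1\<^sub>m n" n n "\<rho> x" n c])
    also have "\<rho> x * A - (c \<cdot>\<^sub>m 1\<^sub>m n) * \<rho> x = B * \<rho> x"
      unfolding B_def comm by (rule minus_mult_distrib_mat[symmetric]) (use r A in auto)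
    finally show ?thesis .
  qed
  have Bv: "B *\<^sub>v v = 0\<^sub>v n"
    using v A unfolding B_def
    by (simp add: minus_mult_distrib_mat_vec[of A n n] smult_mat_mult_vec[of v n])
  have "B = 0\<^sub>m n n"
  proof (rule ccontr)
    assume "B \<noteq> 0\<^sub>m n n"
    then obtain B' where B': "B' \<in> carrier_mat n n" "B' * B = 1\<^sub>m n"
      using schur_lemma[OF \<rho> \<rho> B comm'] by metis
    have "v = (B' * B) *\<^sub>v v" using v B'(2) by simp
    also have "\<dots> = B' *\<^sub>v (B *\<^sub>v v)" by (rule assoc_mult_mat_vec) (use B B' v in auto)
    also have "\<dots> = 0\<^sub>v n" using B' by (auto simp: Bv)
    finally show False using v(2) by simp
  qed
  then have "A - c \<cdot>\<^sub>m 1\<^sub>m n + c \<cdot>\<^sub>m 1\<^sub>m n = 0\<^sub>m n n + c \<cdot>\<^sub>m 1\<^sub>m n" by (simp add: B_def)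
  moreover have "A - c \<cdot>\<^sub>m 1\<^sub>m n + c \<cdot>\<^sub>m 1\<^sub>m n = A"
    by (rule eq_matI) (use A in auto)
  ultimately have "A = c \<cdot>\<^sub>m 1\<^sub>m n" by simp
  then show ?thesis by (rule that)
qed

section \<open>Schur orthogonality\<close>

text \<open>The matrix \<open>\<Sum> \<rho>(\<Lambda>\<^sub>1) X \<sigma>(S \<Lambda>\<^sub>2)\<close> for the elementary matrix \<open>X\<close> with entry \<open>1\<close> at \<open>(j, k)\<close>.\<close>

definition casimir :: "nat \<Rightarrow> ('a \<Rightarrow> 'k mat) \<Rightarrow> nat \<Rightarrow> ('a \<Rightarrow> 'k mat) \<Rightarrow> nat \<Rightarrow> nat \<Rightarrow> 'k mat" where
  "casimir n \<rho> m \<sigma> j k = mat n m (\<lambda>(i, l). sw \<Lambda> (\<lambda>a b. \<rho> a $$ (i, j) * \<sigma> (S b) $$ (k, l)))"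

lemma casimir_intertwines:
  assumes \<rho>: "is_representation n \<rho>" and \<sigma>: "is_representation m \<sigma>" and jk: "j < n" "k < m"
  shows "\<rho> x * casimir n \<rho> m \<sigma> j k = casimir n \<rho> m \<sigma> j k * \<sigma> x"
proof (rule eq_matI)
  fix i l assume "i < dim_row (casimir n \<rho> m \<sigma> j k * \<sigma> x)" "l < dim_col (casimir n \<rho> m \<sigma> j k * \<sigma> x)"
  then have il: "i < n" "l < m"
    using representation_carrier[OF \<sigma>, of x] by (auto simp: casimir_def)
  note car = representation_carrier[OF \<sigma>, of x] representation_carrier[OF \<rho>, of x]
  have "(\<rho> x * casimir n \<rho> m \<sigma> j k) $$ (i, l) =
      (\<Sum>p<n. \<rho> x $$ (i, p) * sw \<Lambda> (\<lambda>a b. \<rho> a $$ (p, j) * \<sigma> (S b) $$ (k, l)))"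
    using il car by (auto simp: casimir_def scalar_prod_def lessThan_atLeast0 intro!: sum.cong)
  also have "\<dots> = sw \<Lambda> (\<lambda>a b. \<rho> (x * a) $$ (i, j) * \<sigma> (S b) $$ (k, l))"
    by (simp add: sw_mult_left sw_sum[symmetric] entry_mult[OF \<rho> il(1) jk(1)] sum_distrib_right mult.assoc)
  also have "\<dots> = sw \<Lambda> (\<lambda>a b. \<rho> a $$ (i, j) * \<sigma> (S b * x) $$ (k, l))"
    by (rule casimir_shift[where F = "\<lambda>u v. \<rho> u $$ (i, j) * \<sigma> v $$ (k, l)"])
      (intro linear_intros lin_entry[OF \<rho>] lin_entry[OF \<sigma>] il jk)
  also have "\<dots> = (\<Sum>p<m. sw \<Lambda> (\<lambda>a b. \<rho> a $$ (i, j) * \<sigma> (S b) $$ (k, p)) * \<sigma> x $$ (p, l))"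
    by (simp add: sw_mult_right sw_sum[symmetric] entry_mult[OF \<sigma> jk(2) il(2)] sum_distrib_left mult.assoc)
  also have "\<dots> = (casimir n \<rho> m \<sigma> j k * \<sigma> x) $$ (i, l)"
    using il car by (auto simp: casimir_def scalar_prod_def lessThan_atLeast0 intro!: sum.cong)
  finally show "(\<rho> x * casimir n \<rho> m \<sigma> j k) $$ (i, l) = (casimir n \<rho> m \<sigma> j k * \<sigma> x) $$ (i, l)" .
qed (use representation_carrier[OF \<sigma>, of x] representation_carrier[OF \<rho>, of x] in \<open>auto simp: casimir_def\<close>)

lemma casimir_carrier: "casimir n \<rho> m \<sigma> j k \<in> carrier_mat n m"
  by (simp add: casimir_def)

lemma equivalent_chi:
  assumes \<rho>: "is_representation n \<rho>" and \<sigma>: "is_representation m \<sigma>"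
    and A: "A \<in> carrier_mat n m" "A' \<in> carrier_mat m n" "A * A' = 1\<^sub>m n" "A' * A = 1\<^sub>m m"
    and comm: "\<And>x. \<rho> x * A = A * \<sigma> x"
  shows "chi n \<rho> = chi m \<sigma>"
proof
  fix x
  note car = A(1,2) representation_carrier[OF \<sigma>, of x] representation_carrier[OF \<rho>, of x]
  have "chi n \<rho> x = (\<Sum>i<n. (\<rho> x * (A * A')) $$ (i, i))"
    using car A(3) by (simp add: chi_def)
  also have "\<rho> x * (A * A') = A * (\<sigma> x * A')"
  proof -
    have "\<rho> x * (A * A') = \<rho> x * A * A'" by (rule assoc_mult_mat[symmetric]) (use car in auto)
    also have "\<dots> = A * (\<sigma> x * A')" unfolding comm by (rule assoc_mult_mat) (use car in auto)
    finally show ?thesis .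
  qed
  also have "(\<Sum>i<n. (A * (\<sigma> x * A')) $$ (i, i)) = (\<Sum>i<m. (\<sigma> x * A' * A) $$ (i, i))"
    by (rule sum_diag_mult_commute) (use car in auto)
  also have "\<sigma> x * A' * A = \<sigma> x"
    using car A(4) by (simp add: assoc_mult_mat[of _ m m _ n _ m])
  finally show "chi n \<rho> x = chi m \<sigma> x" by (simp add: chi_def)
qed

lemma orthogonality_distinct:
  assumes \<rho>: "irreducible_representation n \<rho>" and \<sigma>: "irreducible_representation m \<sigma>"
    and ne: "(n, chi n \<rho>) \<noteq> (m, chi m \<sigma>)"
    and ijkl: "i < n" "j < n" "k < m" "l < m"
  shows "sw \<Lambda> (\<lambda>a b. \<rho> a $$ (i, j) * \<sigma> (S b) $$ (k, l)) = 0"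
proof -
  note r = irreducible_is_representation[OF \<rho>] irreducible_is_representation[OF \<sigma>]
  have "casimir n \<rho> m \<sigma> j k = 0\<^sub>m n m"
  proof (rule ccontr)
    assume "casimir n \<rho> m \<sigma> j k \<noteq> 0\<^sub>m n m"
    then obtain A' where A': "A' \<in> carrier_mat m n" "casimir n \<rho> m \<sigma> j k * A' = 1\<^sub>m n"
      "A' * casimir n \<rho> m \<sigma> j k = 1\<^sub>m m"
      using schur_lemma[OF \<rho> \<sigma> casimir_carrier casimir_intertwines[OF r ijkl(2,3)]] by metis
    then have "n = m" "chi n \<rho> = chi m \<sigma>"
      using intertwiner_degree[OF casimir_carrier A'(1)]
        equivalent_chi[OF r casimir_carrier A'(1-3) casimir_intertwines[OF r ijkl(2,3)]] by auto
    with ne show False by simp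
  qed
  then have "casimir n \<rho> m \<sigma> j k $$ (i, l) = 0" using ijkl by simp
  then show ?thesis using ijkl by (simp add: casimir_def)
qed

text \<open>The matrix \<open>u\<close> need not be \<open>1 / n\<close> times the identity; showing that it is amounts to \<open>S\<^sup>2 = id\<close>.  Its trace is found
from \<open>\<Sum> \<Lambda>\<^sub>1 S \<Lambda>\<^sub>2 = 1\<close>.\<close>

lemma orthogonality_self:
  assumes \<rho>: "irreducible_representation n \<rho>"
  shows "\<exists>u. (\<forall>i<n. \<forall>j<n. \<forall>k<n. \<forall>l<n.
      sw \<Lambda> (\<lambda>a b. \<rho> a $$ (i, j) * \<rho> (S b) $$ (k, l)) = (if i = l then u k j else 0)) \<and>
      (\<Sum>k<n. u k k) = 1"
proof -
  note r = irreducible_is_representation[OF \<rho>]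
  have "\<exists>c. casimir n \<rho> n \<rho> j k = c \<cdot>\<^sub>m 1\<^sub>m n" if "j < n" "k < n" for j k
    using schur_scalar[OF \<rho> casimir_carrier casimir_intertwines[OF r r that]] by metis
  moreover define u where "u k j = (SOME c. casimir n \<rho> n \<rho> j k = c \<cdot>\<^sub>m 1\<^sub>m n)" for k j
  ultimately have u: "casimir n \<rho> n \<rho> j k = u k j \<cdot>\<^sub>m 1\<^sub>m n" if "j < n" "k < n" for j k
    using that by (metis (mono_tags, lifting) someI_ex)
  have orth: "sw \<Lambda> (\<lambda>a b. \<rho> a $$ (i, j) * \<rho> (S b) $$ (k, l)) = (if i = l then u k j else 0)"
    if ijkl: "i < n" "j < n" "k < n" "l < n" for i j k l
  proof -
    have "casimir n \<rho> n \<rho> j k $$ (i, l) = (if i = l then u k j else 0)"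
      using ijkl by (simp add: u)
    then show ?thesis using ijkl by (simp add: casimir_def)
  qed
  have n: "0 < n" by (rule irreducible_pos[OF \<rho>])
  have "(\<Sum>k<n. u k k) = (\<Sum>k<n. sw \<Lambda> (\<lambda>a b. \<rho> a $$ (0, k) * \<rho> (S b) $$ (k, 0)))"
    using n by (simp add: orth)
  also have "\<dots> = sw \<Lambda> (\<lambda>a b. \<rho> (a * S b) $$ (0, 0))"
    using n by (simp add: sw_sum[symmetric] entry_mult[OF r])
  also have "\<dots> = \<epsilon> \<Lambda> * \<rho> 1 $$ (0, 0)"
    by (rule sw_antipode_right) (intro lin_entry[OF r] n)
  also have "\<dots> = 1" using n by (simp add: counit_integral representation_one[OF r])
  finally show ?thesis using orth by (intro exI[of _ u]) simp
qed

lemma character_orthogonality_same: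
  assumes \<rho>: "irreducible_representation n \<rho>"
  shows "sw \<Lambda> (\<lambda>a b. chi n \<rho> a * chi n \<rho> (S b)) = 1"
proof -
  obtain u where u: "\<forall>i<n. \<forall>j<n. \<forall>k<n. \<forall>l<n.
      sw \<Lambda> (\<lambda>a b. \<rho> a $$ (i, j) * \<rho> (S b) $$ (k, l)) = (if i = l then u k j else 0)"
    and t: "(\<Sum>k<n. u k k) = 1"
    using orthogonality_self[OF \<rho>] by (elim exE conjE)
  have "sw \<Lambda> (\<lambda>a b. chi n \<rho> a * chi n \<rho> (S b))
      = (\<Sum>i<n. \<Sum>k<n. sw \<Lambda> (\<lambda>a b. \<rho> a $$ (i, i) * \<rho> (S b) $$ (k, k)))"
    by (simp add: chi_def sum_product sw_sum)
  also have "\<dots> = (\<Sum>i<n. u i i)"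
    by (intro sum.cong HOL.refl) (simp add: u)
  finally show ?thesis by (simp add: t)
qed

lemma character_orthogonality_distinct:
  assumes \<rho>: "irreducible_representation n \<rho>" and \<sigma>: "irreducible_representation m \<sigma>"
    and ne: "(n, chi n \<rho>) \<noteq> (m, chi m \<sigma>)"
  shows "sw \<Lambda> (\<lambda>a b. chi n \<rho> a * chi m \<sigma> (S b)) = 0"
proof -
  have "sw \<Lambda> (\<lambda>a b. chi n \<rho> a * chi m \<sigma> (S b))
      = (\<Sum>i<n. \<Sum>k<m. sw \<Lambda> (\<lambda>a b. \<rho> a $$ (i, i) * \<sigma> (S b) $$ (k, k)))"
    by (simp add: chi_def sum_product sw_sum)
  then show ?thesis by (simp add: orthogonality_distinct[OF \<rho> \<sigma> ne])
qed

text \<open>This allows the choice of one representation for each character.  A nonzero intertwiner exists since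
otherwise the character would be orthogonal to itself.\<close>

lemma same_character_kernel:
  assumes \<rho>: "irreducible_representation n \<rho>" and \<sigma>: "irreducible_representation n \<sigma>"
    and eq: "chi n \<rho> = chi n \<sigma>" and 0: "\<sigma> h = 0\<^sub>m n n"
  shows "\<rho> h = 0\<^sub>m n n"
proof -
  note r = irreducible_is_representation[OF \<rho>] irreducible_is_representation[OF \<sigma>]
  have "\<exists>j<n. \<exists>k<n. casimir n \<rho> n \<sigma> j k \<noteq> 0\<^sub>m n n"
  proof (rule ccontr)
    assume "\<not> ?thesis"
    then have "casimir n \<rho> n \<sigma> j k = 0\<^sub>m n n" if "j < n" "k < n" for j k using that by auto
    then have "casimir n \<rho> n \<sigma> i k $$ (i, k) = 0" if "i < n" "k < n" for i k using that by simp
    then have "sw \<Lambda> (\<lambda>a b. \<rho> a $$ (i, i) * \<sigma> (S b) $$ (k, k)) = 0" if "i < n" "k < n" for i k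
      using that by (simp add: casimir_def)
    then have "sw \<Lambda> (\<lambda>a b. chi n \<rho> a * chi n \<sigma> (S b)) = 0"
      by (simp add: chi_def sum_product sw_sum)
    then show False using character_orthogonality_same[OF \<rho>] by (simp add: eq)
  qed
  then obtain j k where jk: "j < n" "k < n" "casimir n \<rho> n \<sigma> j k \<noteq> 0\<^sub>m n n" by blast
  define A where "A = casimir n \<rho> n \<sigma> j k"
  have A: "A \<in> carrier_mat n n" unfolding A_def by (rule casimir_carrier)
  obtain A' where A': "A' \<in> carrier_mat n n" "A * A' = 1\<^sub>m n"
    using schur_lemma[OF \<rho> \<sigma> casimir_carrier casimir_intertwines[OF r jk(1,2)] jk(3)] A_def by metis
  note rh = representation_carrier[OF r(1), of h]
  have "\<rho> h = \<rho> h * (A * A')" using A' rh by simp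
  also have "\<dots> = \<rho> h * A * A'" by (rule assoc_mult_mat[symmetric]) (use rh A A' in auto)
  also have "\<rho> h * A = A * \<sigma> h" unfolding A_def by (rule casimir_intertwines[OF r jk(1,2)])
  also have "\<dots> = 0\<^sub>m n n" using A by (simp add: 0)
  finally show ?thesis using A' by simp
qed

section \<open>The irreducible representations separate the elements\<close>

lemma left_idealD:
  assumes "left_ideal I"
  shows "subspace I" "x \<in> I \<Longrightarrow> h * x \<in> I"
  using assms by (auto simp: left_ideal_def)

text \<open>In a basis of the ideal, multiplication becomes a matrix representation; an invariant subspace
corresponds to a left ideal contained in the given one.\<close>

lemma minimal_left_ideal_representation:
  assumes M: "left_ideal M" "M \<noteq> {0}"
    and minimal: "\<And>I. left_ideal I \<Longrightarrow> I \<subseteq> M \<Longrightarrow> I \<noteq> {0} \<Longrightarrow> I = M"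
  shows "\<exists>n \<rho>. irreducible_representation n \<rho> \<and> (\<forall>h. \<rho> h = 0\<^sub>m n n \<longrightarrow> (\<forall>x\<in>M. h * x = 0))"
proof -
  obtain V where V: "V \<subseteq> M" "independent V" "M \<subseteq> span V"
    using maximal_independent_subset[of M] by blast
  have spanV: "span V = M"
    using V left_idealD(1)[OF M(1)] by (simp add: span_minimal subset_antisym)
  have finV: "finite V" using V(2) by (rule finiteI_independent)
  obtain vs where vs: "set vs = V" "distinct vs" using finite_distinct_list[OF finV] by blast
  define n where "n = length vs"
  define \<phi> where "\<phi> w = (\<Sum>i<n. w $ i *s vs ! i)" for w :: "'k vec"
  define \<rho> where "\<rho> h = mat n n (\<lambda>(i, j). representation V (h * vs ! j) (vs ! i))" for h
  have vsM: "vs ! i \<in> M" and vsV: "vs ! i \<in> V" if "i < n" for i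
    using that V(1) vs(1) by (auto simp: n_def)
  have hM: "h * x \<in> span V" if "x \<in> M" for h x
    using left_idealD(2)[OF M(1) that] by (simp add: spanV)
  have expand: "(\<Sum>i<n. representation V x (vs ! i) *s vs ! i) = x" if "x \<in> M" for x
  proof -
    have "(\<Sum>i<n. representation V x (vs ! i) *s vs ! i) = (\<Sum>v\<in>V. representation V x v *s v)"
      using sum.reindex_bij_betw[OF bij_betw_nth[OF vs(2) HOL.refl vs(1)[symmetric]],
          of "\<lambda>v. representation V x v *s v"]
      by (simp add: n_def lessThan_def)
    also have "\<dots> = x" by (rule sum_representation_eq) (use V(2) that spanV finV in auto)
    finally show ?thesis .
  qed
  have coeff: "representation V (\<phi> w) (vs ! i) = w $ i" if "i < n" for w i
  proof -
    have "representation V (\<phi> w) (vs ! i) = (\<Sum>j<n. w $ j * representation V (vs ! j) (vs ! i))"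
      unfolding \<phi>_def using V(2) vsM spanV
      by (subst representation_sum) (auto simp: representation_scale span_scale)
    also have "\<dots> = (\<Sum>j<n. if j = i then w $ j else 0)"
      using V(2) vsV that vs(2)
      by (intro sum.cong) (auto simp: representation_basis nth_eq_iff_index_eq n_def)
    also have "\<dots> = w $ i" using that by simp
    finally show ?thesis .
  qed
  have \<phi>_add: "\<phi> (v + w) = \<phi> v + \<phi> w" if "v \<in> carrier_vec n" "w \<in> carrier_vec n" for v w
    using that by (simp add: \<phi>_def scale_left_distrib sum.distrib)
  have \<phi>_scale: "\<phi> (c \<cdot>\<^sub>v v) = c *s \<phi> v" if "v \<in> carrier_vec n" for c v
    using that by (simp add: \<phi>_def scale_sum_right)
  have \<phi>_M: "\<phi> w \<in> M" for w
    unfolding \<phi>_def using left_idealD(1)[OF M(1)] vsM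
    by (intro subspace_sum subspace_scale) auto
  have \<phi>_inj: "v = w" if "v \<in> carrier_vec n" "w \<in> carrier_vec n" "\<phi> v = \<phi> w" for v w
    using that coeff[of _ v] coeff[of _ w] by (intro eq_vecI) auto
  have \<phi>_surj: "\<exists>w\<in>carrier_vec n. \<phi> w = x" if "x \<in> M" for x
    using expand[OF that]
    by (intro bexI[of _ "vec n (\<lambda>i. representation V x (vs ! i))"]) (simp_all add: \<phi>_def)
  have \<phi>_0: "\<phi> (0\<^sub>v n) = 0" by (simp add: \<phi>_def)
  have mult_vs: "h * vs ! j = (\<Sum>i<n. \<rho> h $$ (i, j) *s vs ! i)" if "j < n" for h j
    using expand[of "h * vs ! j"] hM[OF vsM[OF that], of h] that by (simp add: \<rho>_def spanV)
  have \<rho>_car: "\<rho> h \<in> carrier_mat n n" for h by (simp add: \<rho>_def)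
  have mult_\<phi>: "h * \<phi> w = \<phi> (\<rho> h *\<^sub>v w)" if w: "w \<in> carrier_vec n" for h w
  proof -
    have "h * \<phi> w = (\<Sum>j<n. \<Sum>i<n. (w $ j * \<rho> h $$ (i, j)) *s vs ! i)"
      by (simp add: \<phi>_def sum_distrib_left scale_mult_right mult_vs scale_sum_right)
    also have "\<dots> = (\<Sum>i<n. \<Sum>j<n. (w $ j * \<rho> h $$ (i, j)) *s vs ! i)"
      by (rule sum.swap)
    also have "\<dots> = \<phi> (\<rho> h *\<^sub>v w)"
      unfolding \<phi>_def using w \<rho>_car[of h]
      by (intro sum.cong) (auto simp: scale_sum_left scalar_prod_def lessThan_atLeast0 mult.commute
          intro!: sum.cong)
    finally show ?thesis .
  qed
  have rep: "is_representation n \<rho>"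
    unfolding is_representation_def
  proof (intro conjI allI)
    show "\<rho> x \<in> carrier_mat n n" for x by (rule \<rho>_car)
    show "\<rho> (x + y) = \<rho> x + \<rho> y" for x y
      using V(2) hM vsM by (intro eq_matI) (auto simp: \<rho>_def distrib_right representation_add)
    show "\<rho> (c *s x) = c \<cdot>\<^sub>m \<rho> x" for c x
      using V(2) hM vsM by (intro eq_matI) (auto simp: \<rho>_def scale_mult_left representation_scale)
    show "\<rho> 1 = 1\<^sub>m n"
      using V(2) vsV vs(2)
      by (intro eq_matI) (auto simp: \<rho>_def representation_basis nth_eq_iff_index_eq n_def)
    show "\<rho> (x * y) = \<rho> x * \<rho> y" for x y
    proof (rule eq_matI)
      fix i j assume "i < dim_row (\<rho> x * \<rho> y)" "j < dim_col (\<rho> x * \<rho> y)"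
      then have ij: "i < n" "j < n" using \<rho>_car[of x] \<rho>_car[of y] by auto
      have "x * y * vs ! j = x * \<phi> (col (\<rho> y) j)"
        using mult_vs[OF ij(2), of y] ij \<rho>_car[of y] by (simp add: \<phi>_def mult.assoc)
      also have "\<dots> = \<phi> (\<rho> x *\<^sub>v col (\<rho> y) j)"
        by (rule mult_\<phi>) (use \<rho>_car[of y] in auto)
      finally have "representation V (x * y * vs ! j) (vs ! i) = (\<rho> x *\<^sub>v col (\<rho> y) j) $ i"
        by (simp add: coeff ij)
      then show "\<rho> (x * y) $$ (i, j) = (\<rho> x * \<rho> y) $$ (i, j)"
        using ij \<rho>_car[of x] \<rho>_car[of y] by (simp add: \<rho>_def[of "x * y"])
    qed (use \<rho>_car in \<open>auto simp: \<rho>_def\<close>)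
  qed
  have npos: "n > 0"
  proof (rule ccontr)
    assume "\<not> n > 0"
    then have "V = {}" using vs by (simp add: n_def)
    then show False using M(2) spanV by simp
  qed
  have irr: "irreducible_representation n \<rho>"
    unfolding irreducible_representation_def
  proof (intro conjI rep npos allI impI)
    fix W assume W: "invariant_subspace n \<rho> W"
    have Wc: "W \<subseteq> carrier_vec n" "0\<^sub>v n \<in> W" and Wadd: "\<And>v w. v \<in> W \<Longrightarrow> w \<in> W \<Longrightarrow> v + w \<in> W"
      and Wsc: "\<And>c v. v \<in> W \<Longrightarrow> c \<cdot>\<^sub>v v \<in> W" and Winv: "\<And>x v. v \<in> W \<Longrightarrow> \<rho> x *\<^sub>v v \<in> W"
      using W unfolding invariant_subspace_def by auto
    have li: "left_ideal (\<phi> ` W)"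
      unfolding left_ideal_def
    proof (intro conjI allI ballI)
      show "subspace (\<phi> ` W)"
      proof (rule subspaceI)
        show "0 \<in> \<phi> ` W" using Wc(2) \<phi>_0 by (metis image_eqI)
        show "x + y \<in> \<phi> ` W" if "x \<in> \<phi> ` W" "y \<in> \<phi> ` W" for x y
          using that Wc(1) Wadd by (auto simp: \<phi>_add[symmetric] subset_iff)
        show "c *s x \<in> \<phi> ` W" if "x \<in> \<phi> ` W" for c x
          using that Wc(1) Wsc by (auto simp: \<phi>_scale[symmetric] subset_iff)
      qed
      show "h * x \<in> \<phi> ` W" if "x \<in> \<phi> ` W" for h x
        using that Wc(1) Winv by (auto simp: mult_\<phi> subset_iff)
    qed
    show "W = {0\<^sub>v n} \<or> W = carrier_vec n"
    proof (cases "\<phi> ` W = {0}")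
      case True
      have "v = 0\<^sub>v n" if "v \<in> W" for v
      proof (rule \<phi>_inj)
        show "v \<in> carrier_vec n" using that Wc(1) by auto
        have "\<phi> v \<in> \<phi> ` W" using that by (rule imageI)
        then show "\<phi> v = \<phi> (0\<^sub>v n)" by (simp add: True \<phi>_0)
      qed simp
      then have "W \<subseteq> {0\<^sub>v n}" by blast
      then show ?thesis using Wc(2) by blast
    next
      case False
      have "\<phi> ` W = M"
        by (rule minimal[OF li _ False]) (use \<phi>_M in auto)
      then have "v \<in> W" if "v \<in> carrier_vec n" for v
        using \<phi>_M[of v] \<phi>_inj[OF that] Wc(1) by (metis imageE subsetD)
      then have "carrier_vec n \<subseteq> W" by blast
      then show ?thesis using Wc(1) by blast
    qed
  qed
  have "h * x = 0" if "\<rho> h = 0\<^sub>m n n" "x \<in> M" for h x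
  proof -
    obtain w where w: "w \<in> carrier_vec n" "\<phi> w = x" using \<phi>_surj[OF \<open>x \<in> M\<close>] by blast
    have "h * x = \<phi> (0\<^sub>m n n *\<^sub>v w)" using mult_\<phi>[OF w(1), of h] w(2) that(1) by simp
    also have "0\<^sub>m n n *\<^sub>v w = 0\<^sub>v n" using w(1) by auto
    finally show ?thesis by (simp add: \<phi>_0)
  qed
  with irr show ?thesis by blast
qed

text \<open>Let \<open>J\<close> be the set of elements that vanish in all irreducible representations.  The elements killed by
\<open>J\<close> form a left ideal that contains every minimal left ideal, so it has no complement but \<open>0\<close>.\<close>

lemma irreducibles_separate:
  assumes h: "\<And>n \<rho>. irreducible_representation n \<rho> \<Longrightarrow> \<rho> h = 0\<^sub>m n n"
  shows "h = 0"
proof -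
  define J where "J = {h. \<forall>n \<rho>. irreducible_representation n \<rho> \<longrightarrow> \<rho> h = 0\<^sub>m n n}"
  have J_mult: "x * y \<in> J" if "x \<in> J" for x y
    unfolding J_def
  proof (intro CollectI allI impI)
    fix n \<rho> assume \<rho>: "irreducible_representation n \<rho>"
    have "\<rho> x = 0\<^sub>m n n" using that \<rho> by (auto simp: J_def)
    then show "\<rho> (x * y) = 0\<^sub>m n n"
      using representation_carrier[OF irreducible_is_representation[OF \<rho>], of y]
      by (simp add: representation_mult[OF irreducible_is_representation[OF \<rho>]])
  qed
  define A where "A = {x. \<forall>h\<in>J. h * x = 0}"
  have A: "left_ideal A"
    unfolding left_ideal_def
  proof (intro conjI allI ballI)
    show "subspace A"
      by (rule subspaceI) (auto simp: A_def distrib_left scale_mult_right)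
    show "k * x \<in> A" if "x \<in> A" for k x
      using that J_mult by (auto simp: A_def mult.assoc[symmetric])
  qed
  obtain B where B: "left_ideal B" "A \<inter> B = {0}" "{x + y | x y. x \<in> A \<and> y \<in> B} = UNIV"
    using ss[unfolded semisimple_def, rule_format, OF A] by (elim exE conjE)
  have "B = {0}"
  proof (rule ccontr)
    assume "B \<noteq> {0}"
    define P where "P I \<longleftrightarrow> left_ideal I \<and> I \<subseteq> B \<and> I \<noteq> {0}" for I
    have "P B" using B(1) \<open>B \<noteq> {0}\<close> by (simp add: P_def)
    then obtain M where M: "P M" "\<And>I. P I \<Longrightarrow> dim M \<le> dim I"
      using ex_has_least_nat[of P B dim] by blast
    have minimal: "\<And>I. left_ideal I \<Longrightarrow> I \<subseteq> M \<Longrightarrow> I \<noteq> {0} \<Longrightarrow> I = M"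
    proof -
      fix I assume I: "left_ideal I" "I \<subseteq> M" "I \<noteq> {0}"
      have "P I" using I M(1) unfolding P_def by blast
      then have "dim M \<le> dim I" by (rule M(2))
      then show "I = M"
        using I(1,2) M(1) left_idealD(1) unfolding P_def by (intro subspace_dim_equal) blast+
    qed
    have M': "left_ideal M" "M \<subseteq> B" "M \<noteq> {0}" using M(1) by (auto simp: P_def)
    obtain n \<rho> where \<rho>: "irreducible_representation n \<rho>"
      and ker: "\<forall>h. \<rho> h = 0\<^sub>m n n \<longrightarrow> (\<forall>x\<in>M. h * x = 0)"
      using minimal_left_ideal_representation[OF M'(1,3)] minimal by metis
    have "M \<subseteq> A"
      using ker \<rho> by (auto simp: A_def J_def)
    then have "M \<subseteq> {0}" using M'(2) B(2) by blast
    moreover have "0 \<in> M" using left_idealD(1)[OF M'(1)] by (rule subspace_0)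
    ultimately show False using M'(3) by blast
  qed
  moreover have "1 \<in> {x + y | x y. x \<in> A \<and> y \<in> B}" by (simp only: B(3) UNIV_I)
  ultimately have "1 \<in> A" by auto
  moreover have "h \<in> J" using h by (auto simp: J_def)
  ultimately have "h * 1 = 0" unfolding A_def by blast
  then show ?thesis by simp
qed

section \<open>Matrix units\<close>

abbreviation C :: "(nat \<times> ('a \<Rightarrow> 'k)) set" where "C \<equiv> irreducible_characters"

definition rep :: "nat \<times> ('a \<Rightarrow> 'k) \<Rightarrow> 'a \<Rightarrow> 'k mat" where
  "rep c = (SOME \<rho>. irreducible_representation (fst c) \<rho> \<and> chi (fst c) \<rho> = snd c)"

text \<open>Matrix entries in a chosen representation with the character \<open>c\<close>.\<close>

definition r :: "nat \<times> ('a \<Rightarrow> 'k) \<Rightarrow> nat \<Rightarrow> nat \<Rightarrow> 'a \<Rightarrow> 'k" where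
  "r c i j x = rep c x $$ (i, j)"

lemma rep_irreducible: "c \<in> C \<Longrightarrow> irreducible_representation (fst c) (rep c)"
  and chi_rep: "c \<in> C \<Longrightarrow> chi (fst c) (rep c) = snd c"
proof -
  assume "c \<in> C"
  then have "\<exists>\<rho>. irreducible_representation (fst c) \<rho> \<and> chi (fst c) \<rho> = snd c"
    by (auto simp: irreducible_characters_eq)
  from someI_ex[OF this]
  show "irreducible_representation (fst c) (rep c)" "chi (fst c) (rep c) = snd c"
    by (simp_all add: rep_def)
qed

lemma rep_is_representation: "c \<in> C \<Longrightarrow> is_representation (fst c) (rep c)"
  by (rule irreducible_is_representation[OF rep_irreducible])

lemma lin_r: "c \<in> C \<Longrightarrow> i < fst c \<Longrightarrow> j < fst c \<Longrightarrow> lin (r c i j)"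
  unfolding r_def[abs_def] by (rule lin_entry[OF rep_is_representation])

lemma r_mult: "c \<in> C \<Longrightarrow> i < fst c \<Longrightarrow> j < fst c \<Longrightarrow> r c i j (x * y) = (\<Sum>p<fst c. r c i p x * r c p j y)"
  unfolding r_def by (rule entry_mult[OF rep_is_representation])

lemma r_one: "c \<in> C \<Longrightarrow> i < fst c \<Longrightarrow> j < fst c \<Longrightarrow> r c i j 1 = (if i = j then 1 else 0)"
  by (simp add: r_def representation_one[OF rep_is_representation])

lemma character_r: "c \<in> C \<Longrightarrow> snd c x = (\<Sum>i<fst c. r c i i x)"
  by (simp add: chi_rep[symmetric] chi_def r_def)

lemma lin_character: "c \<in> C \<Longrightarrow> lin (snd c)"
  using lin_chi[OF rep_is_representation] by (simp add: chi_rep)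

lemma character_mult: "c \<in> C \<Longrightarrow> snd c (x * y) = (\<Sum>i<fst c. \<Sum>p<fst c. r c i p x * r c p i y)"
  by (simp add: character_r r_mult)

lemma character_commute: "c \<in> C \<Longrightarrow> snd c (x * y) = snd c (y * x)"
  by (simp add: character_mult mult.commute[of "r c _ _ x"]) (rule sum.swap)

lemma degree_pos: "c \<in> C \<Longrightarrow> fst c > 0"
  by (rule irreducible_pos[OF rep_irreducible])

text \<open>By orthogonality the characters have dual elements in \<open>H\<close>, which are then linearly independent.\<close>

lemma finite_irreducible_characters: "finite C"
proof (rule ccontr)
  assume "infinite C"
  then obtain F where F: "F \<subseteq> C" "finite F" "card F = Suc dimension"
    using infinite_arbitrarily_large by blast
  define q where "q c = (\<Sum>(a, b)\<leftarrow>\<Delta> \<Lambda>. snd c a *s S b)" for c :: "nat \<times> ('a \<Rightarrow> 'k)"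
  have q: "snd c (q c') = (if c = c' then 1 else 0)" if "c \<in> C" "c' \<in> C" for c c'
  proof -
    have "snd c (q c') = sw \<Lambda> (\<lambda>a b. snd c' a * snd c (S b))"
      using lin_character[OF that(1)] by (simp add: q_def lin_of_sw lin_scale)
    moreover have "(fst c', chi (fst c') (rep c')) = c'" "(fst c, chi (fst c) (rep c)) = c"
      using that by (simp_all add: chi_rep)
    ultimately show ?thesis
      using character_orthogonality_same[OF rep_irreducible[OF that(1)]]
        character_orthogonality_distinct[OF rep_irreducible[OF that(2)] rep_irreducible[OF that(1)]]
      by (auto simp: chi_rep that)
  qed
  have inj: "inj_on q F"
  proof (rule inj_onI)
    fix c c' assume "c \<in> F" "c' \<in> F" "q c = q c'"
    moreover from this have "c \<in> C" "c' \<in> C" using F(1) by auto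
    ultimately have "(if c = c' then 1 else 0 :: 'k) = 1" using q[of c c'] q[of c c] by simp
    then show "c = c'" by (rule contrapos_pp) simp
  qed
  have "independent (q ` F)"
    unfolding independent_explicit
  proof (intro conjI allI impI ballI)
    show "finite (q ` F)" using F by simp
    fix w v assume 0: "(\<Sum>v\<in>q ` F. w v *s v) = 0" and "v \<in> q ` F"
    then obtain c where c: "c \<in> F" "v = q c" by blast
    have cC: "c \<in> C" using c F by blast
    have "0 = snd c (\<Sum>c\<in>F. w (q c) *s q c)"
      using 0 by (simp add: sum.reindex[OF inj] lin_zero[OF lin_character[OF cC]])
    also have "\<dots> = (\<Sum>c'\<in>F. if c' = c then w (q c) else 0)"
      unfolding lin_sum[OF lin_character[OF cC]] lin_scale[OF lin_character[OF cC]]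
      using F(1) by (intro sum.cong) (auto simp: q cC subset_iff)
    also have "\<dots> = w (q c)" using c F by simp
    finally show "w v = 0" using c by simp
  qed
  then have "card (q ` F) \<le> dim UNIV"
    by (intro independent_card_le_dim) auto
  then show False using F by (simp add: card_image[OF inj] dimension_def)
qed

lemma entries_separate:
  assumes "\<And>c i j. c \<in> C \<Longrightarrow> i < fst c \<Longrightarrow> j < fst c \<Longrightarrow> r c i j x = r c i j y"
  shows "x = y"
proof -
  have "x - y = 0"
  proof (rule irreducibles_separate)
    fix n \<rho> assume \<rho>: "irreducible_representation n \<rho>"
    define c where "c = (n, chi n \<rho>)"
    have c: "c \<in> C" "fst c = n" "snd c = chi n \<rho>"
      using \<rho> by (auto simp: c_def irreducible_characters_eq)
    have "rep c (x - y) = 0\<^sub>m n n"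
    proof (rule eq_matI)
      fix i j assume "i < dim_row (0\<^sub>m n n :: 'k mat)" "j < dim_col (0\<^sub>m n n :: 'k mat)"
      then have ij: "i < fst c" "j < fst c" by (simp_all add: c(2))
      have "r c i j (x - y) = 0"
        by (simp add: lin_diff[OF lin_r[OF c(1) ij]] assms[OF c(1) ij])
      then show "rep c (x - y) $$ (i, j) = 0\<^sub>m n n $$ (i, j)"
        using ij by (simp add: r_def c(2))
    qed (use representation_carrier[OF rep_is_representation[OF c(1)], of "x - y"] c(2) in auto)
    then show "\<rho> (x - y) = 0\<^sub>m n n"
      using same_character_kernel[OF \<rho>, of "rep c" "x - y"] rep_irreducible[OF c(1)] chi_rep[OF c(1)]
      by (simp add: c)
  qed
  then show ?thesis by simp
qed

text \<open>On each block this element is the matrix \<open>u\<close> of Schur orthogonality.\<close>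

definition U :: 'a where
  "U = (\<Sum>(a, b)\<leftarrow>\<Delta> \<Lambda>. (\<Sum>c\<in>C. snd c a) *s S b)"

lemma lin_sum_characters: "lin (\<lambda>x. \<Sum>c\<in>C. snd c x)"
  by (intro lin_sum_intro lin_character)

lemma lin_U: "lin p \<Longrightarrow> p U = sw \<Lambda> (\<lambda>a b. (\<Sum>c\<in>C. snd c a) * p (S b))"
  by (simp add: U_def lin_of_sw lin_scale)

lemma orthogonality:
  assumes c: "c \<in> C" "i < fst c" "j < fst c" and c': "c' \<in> C" "k < fst c'" "l < fst c'"
  shows "sw \<Lambda> (\<lambda>a b. r c i j a * r c' k l (S b)) = (if c = c' \<and> i = l then r c k j U else 0)"
proof (cases "c = c'")
  case False
  then show ?thesis
    using orthogonality_distinct[OF rep_irreducible[OF c(1)] rep_irreducible[OF c'(1)] _ c(2,3) c'(2,3)]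
    by (simp add: r_def chi_rep c c')
next
  case True
  obtain u where u: "\<forall>i<fst c. \<forall>j<fst c. \<forall>k<fst c. \<forall>l<fst c.
      sw \<Lambda> (\<lambda>a b. r c i j a * r c (k) l (S b)) = (if i = l then u k j else 0)"
    using orthogonality_self[OF rep_irreducible[OF c(1)]] unfolding r_def by (elim exE conjE)
  have kl: "k < fst c" "l < fst c" using c' True by simp_all
  have "r c k j U = (\<Sum>e\<in>C. \<Sum>p<fst e. sw \<Lambda> (\<lambda>a b. r e p p a * r c k j (S b)))"
    using c c' True by (simp add: lin_U lin_r character_r sum_distrib_right sw_sum)
  also have "\<dots> = (\<Sum>e\<in>C. if e = c then \<Sum>p<fst e. sw \<Lambda> (\<lambda>a b. r e p p a * r c k j (S b)) else 0)"
  proof (intro sum.cong HOL.refl)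
    fix e assume e: "e \<in> C"
    have "(\<Sum>p<fst e. sw \<Lambda> (\<lambda>a b. r e p p a * r c k j (S b))) = 0" if "e \<noteq> c"
      using orthogonality_distinct[OF rep_irreducible[OF e] rep_irreducible[OF c(1)]] that c c' True
      by (intro sum.neutral) (auto simp: r_def chi_rep e)
    then show "(\<Sum>p<fst e. sw \<Lambda> (\<lambda>a b. r e p p a * r c k j (S b))) =
        (if e = c then \<Sum>p<fst e. sw \<Lambda> (\<lambda>a b. r e p p a * r c k j (S b)) else 0)" by simp
  qed
  also have "\<dots> = (\<Sum>p<fst c. sw \<Lambda> (\<lambda>a b. r c p p a * r c k j (S b)))"
    using c finite_irreducible_characters by simp
  also have "\<dots> = (\<Sum>p<fst c. if p = j then u k p else 0)"
    using c kl by (intro sum.cong HOL.refl) (simp add: u)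
  also have "\<dots> = u k j" using c by simp
  finally show ?thesis using u c c' True by simp
qed

lemma character_U: "c \<in> C \<Longrightarrow> snd c U = 1"
proof -
  assume c: "c \<in> C"
  have n: "0 < fst c" by (rule degree_pos[OF c])
  have "snd c U = (\<Sum>k<fst c. sw \<Lambda> (\<lambda>a b. r c 0 k a * r c k 0 (S b)))"
    using n c by (simp add: character_r orthogonality)
  also have "\<dots> = sw \<Lambda> (\<lambda>a b. r c 0 0 (a * S b))"
    using n c by (simp add: sw_sum[symmetric] r_mult)
  also have "\<dots> = \<epsilon> \<Lambda> * r c 0 0 1"
    by (rule sw_antipode_right) (intro lin_r c n)
  finally show ?thesis using n c by (simp add: counit_integral r_one)
qed

lemma casimir_flip:
  assumes F: "bil F"
  shows "sw \<Lambda> (\<lambda>a b. F (S b) (S (S a))) = sw \<Lambda> (\<lambda>a b. F a (S b))"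
  by (rule integral_flip[where F = "\<lambda>a b. F a (S b)", symmetric])
     (intro linear_intros bil_left[OF F] bil_right[OF F])

text \<open>The flip \<open>\<Sum> \<Lambda>\<^sub>1 \<otimes> S \<Lambda>\<^sub>2 = \<Sum> S \<Lambda>\<^sub>2 \<otimes> S\<^sup>2 \<Lambda>\<^sub>1\<close> turns the commutation of the Casimir element with \<open>H\<close> into a
second rule, twisted by \<open>S\<^sup>2\<close>.  Characters do not see the order of a product, so the two rules together move \<open>h\<close>
past \<open>U\<close>.\<close>

lemma antipode_squared_mult_U: "S (S h) * U = U * h"
proof (rule lin_ext)
  fix p assume p: "lin p"
  define \<tau> where "\<tau> x = (\<Sum>c\<in>C. snd c x)" for x
  have \<tau>: "lin \<tau>" unfolding \<tau>_def by (rule lin_sum_characters)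
  have \<tau>_comm: "\<tau> (x * y) = \<tau> (y * x)" for x y
    unfolding \<tau>_def by (intro sum.cong HOL.refl character_commute)
  note li = linear_intros p lin_comp[OF p] \<tau> lin_comp[OF \<tau>] endo_comp[OF endo_inv_antipode] endo_inv_antipode
  have pU: "q U = sw \<Lambda> (\<lambda>a b. \<tau> a * q (S b))" if "lin q" for q
    unfolding \<tau>_def by (rule lin_U[OF that])
  have "p (S (S h) * U) = sw \<Lambda> (\<lambda>a b. \<tau> a * p (S (S h) * S b))"
    by (rule pU) (intro li)
  also have "\<dots> = sw \<Lambda> (\<lambda>a b. \<tau> (T (T (S (S a)))) * p (S (S h) * S b))"
    by simp
  also have "\<dots> = sw \<Lambda> (\<lambda>a b. \<tau> (T (T (S b))) * p (S (S h) * a))"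
    using casimir_flip[of "\<lambda>u v. \<tau> (T (T v)) * p (S (S h) * u)"] by (simp add: li)
  also have "\<dots> = sw \<Lambda> (\<lambda>a b. \<tau> (T (T (S b * S (S h)))) * p a)"
    by (rule casimir_shift[where F = "\<lambda>u v. \<tau> (T (T v)) * p u"]) (intro li)
  also have "\<dots> = sw \<Lambda> (\<lambda>a b. \<tau> (T (T (S (S a) * S (S h)))) * p (S b))"
    by (rule casimir_flip[where F = "\<lambda>u v. \<tau> (T (T (v * S (S h)))) * p u", symmetric]) (intro li)
  also have "\<dots> = sw \<Lambda> (\<lambda>a b. \<tau> (h * a) * p (S b))"
    by (simp add: inv_antipode_mult \<tau>_comm)
  also have "\<dots> = sw \<Lambda> (\<lambda>a b. \<tau> a * p (S b * h))"
    by (rule casimir_shift[where F = "\<lambda>u v. \<tau> u * p v"]) (intro li)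
  also have "\<dots> = p (U * h)"
    by (rule pU[symmetric]) (intro li)
  finally show "p (S (S h) * U) = p (U * h)" .
qed

lemma irreducible_antipode_squared:
  assumes \<rho>: "irreducible_representation n \<rho>"
  shows "irreducible_representation n (\<lambda>x. \<rho> (S (S x)))"
  unfolding irreducible_representation_def
proof (intro conjI allI impI)
  show "is_representation n (\<lambda>x. \<rho> (S (S x)))"
    using irreducible_is_representation[OF \<rho>] unfolding is_representation_def
    by (simp add: endo_add[OF endo_antipode] endo_scale[OF endo_antipode] antipode_mult antipode_one)
  show "0 < n" by (rule irreducible_pos[OF \<rho>])
  fix W assume W: "invariant_subspace n (\<lambda>x. \<rho> (S (S x))) W"
  have "\<rho> x *\<^sub>v v \<in> W" if "v \<in> W" for x v
  proof -
    have "\<rho> (S (S (T (T x)))) *\<^sub>v v \<in> W"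
      using W that unfolding invariant_subspace_def by blast
    then show ?thesis by simp
  qed
  then have "invariant_subspace n \<rho> W"
    using W unfolding invariant_subspace_def by blast
  then show "W = {0\<^sub>v n} \<or> W = carrier_vec n"
    using \<rho> unfolding irreducible_representation_def by blast
qed

text \<open>The matrix of \<open>U\<close> is a nonzero intertwiner of irreducible representations, by
\<open>antipode_squared_mult_U\<close>, and so is invertible.\<close>

lemma U_cancel:
  assumes "U * x = 0" shows "x = 0"
proof (rule entries_separate)
  fix c i j assume c: "c \<in> C" and ij: "i < fst c" "j < fst c"
  note rep = rep_is_representation[OF c]
  have n: "0 < fst c" by (rule degree_pos[OF c])
  have car: "rep c y \<in> carrier_mat (fst c) (fst c)" for y
    by (rule representation_carrier[OF rep])
  have "rep c U \<noteq> 0\<^sub>m (fst c) (fst c)"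
  proof
    assume 0: "rep c U = 0\<^sub>m (fst c) (fst c)"
    then have "snd c U = 0" using c by (simp add: character_r r_def)
    with character_U[OF c] show False by simp
  qed
  moreover have "rep c (S (S y)) * rep c U = rep c U * rep c y" for y
    using antipode_squared_mult_U[of y] by (simp add: representation_mult[OF rep, symmetric])
  ultimately obtain A where A: "A \<in> carrier_mat (fst c) (fst c)" "A * rep c U = 1\<^sub>m (fst c)"
    using schur_lemma[OF irreducible_antipode_squared[OF rep_irreducible[OF c]] rep_irreducible[OF c] car[of U]] by metis
  have "rep c x = A * rep c U * rep c x" using A(2) left_mult_one_mat[OF car[of x]] by simp
  also have "\<dots> = A * (rep c U * rep c x)" by (rule assoc_mult_mat) (use A car in auto)
  also have "rep c U * rep c x = rep c (U * x)" by (rule representation_mult[OF rep, symmetric])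
  also have "A * rep c (U * x) = A * rep c (U * 0)" by (simp add: assms)
  also have "\<dots> = A * (rep c U * rep c 0)" by (simp only: representation_mult[OF rep])
  also have "\<dots> = A * rep c U * rep c 0" by (rule assoc_mult_mat[symmetric]) (use A car in auto)
  also have "\<dots> = rep c 0" using A(2) left_mult_one_mat[OF car[of 0]] by simp
  finally show "r c i j x = r c i j 0" by (simp add: r_def)
qed

definition V :: 'a where "V = (SOME y. U * y = 1 \<and> y * U = 1)"

lemma UV: "U * V = 1" and VU: "V * U = 1"
proof -
  have "endo (\<lambda>x. U * x)" by (intro linear_intros)
  then have lin: "Vector_Spaces.linear scale scale (\<lambda>x. U * x)" by (simp add: endo_iff_linear)
  have "inj (\<lambda>x. U * x)"
  proof (rule injI)
    fix x y assume "U * x = U * y"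
    then have "U * (x - y) = 0" by (simp add: right_diff_distrib)
    then have "x - y = 0" by (rule U_cancel)
    then show "x = y" by simp
  qed
  then have "surj (\<lambda>x. U * x)" by (rule linear_inj_imp_surj[OF lin])
  then obtain y where y: "U * y = 1" by (metis surjD)
  have "U * (y * U - 1) = (U * y) * U - U"
    by (simp add: right_diff_distrib mult.assoc)
  then have "U * (y * U - 1) = 0" by (simp add: y)
  then have "y * U - 1 = 0" by (rule U_cancel)
  then have "\<exists>y. U * y = 1 \<and> y * U = 1" using y by auto
  from someI_ex[OF this] show "U * V = 1" "V * U = 1" by (simp_all add: V_def)
qed

lemma antipode_squared_eq: "S (S h) = U * h * V"
  using arg_cong[OF antipode_squared_mult_U[of h], of "\<lambda>x. x * V"] by (simp add: mult.assoc UV)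

lemma inv_antipode_squared_eq: "T (T h) = V * h * U"
proof -
  have "V * h * U = V * (S (S (T (T h))) * U)" by (simp add: mult.assoc)
  also have "\<dots> = (V * U) * T (T h)" by (simp only: antipode_squared_mult_U mult.assoc)
  finally show ?thesis by (simp add: VU)
qed

text \<open>By orthogonality, contracting the first leg with the matrix entry at \<open>(j, i)\<close> leaves \<open>U\<close> times the
matrix unit at \<open>(i, j)\<close>; the factor \<open>V\<close> removes \<open>U\<close>.\<close>

definition E :: "nat \<times> ('a \<Rightarrow> 'k) \<Rightarrow> nat \<Rightarrow> nat \<Rightarrow> 'a" where
  "E c i j = V * (\<Sum>(a, b)\<leftarrow>\<Delta> \<Lambda>. r c j i a *s S b)"

lemma r_E:
  assumes c: "c \<in> C" "i < fst c" "j < fst c" and c': "c' \<in> C" "k < fst c'" "l < fst c'"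
  shows "r c' k l (E c i j) = (if c = c' \<and> i = k \<and> j = l then 1 else 0)"
proof -
  have *: "r c' p l (\<Sum>(a, b)\<leftarrow>\<Delta> \<Lambda>. r c j i a *s S b) = (if c = c' \<and> j = l then r c p i U else 0)"
    if p: "p < fst c'" for p
    using orthogonality[OF c(1,3,2) c'(1) p c'(3)]
    by (simp add: lin_of_sw[OF lin_r[OF c'(1) p c'(3)]] lin_scale[OF lin_r[OF c'(1) p c'(3)]])
  have "r c' k l (E c i j) = (\<Sum>p<fst c'. r c' k p V * (if c = c' \<and> j = l then r c p i U else 0))"
    unfolding E_def r_mult[OF c'] by (intro sum.cong) (simp_all add: *)
  also have "\<dots> = (if c = c' \<and> j = l then r c k i (V * U) else 0)"
    using c c' by (auto simp: r_mult)
  finally show ?thesis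
    using c c' by (auto simp: VU r_one)
qed

lemma r_mult_E:
  assumes c: "c \<in> C" "i < fst c" "j < fst c" and c': "c' \<in> C" "k < fst c'" "l < fst c'"
  shows "r c' k l (x * E c i j) = (if c = c' \<and> j = l then r c k i x else 0)"
    and "r c' k l (E c i j * x) = (if c = c' \<and> i = k then r c j l x else 0)"
proof -
  have "r c' k l (x * E c i j) = (\<Sum>p<fst c'. if p = i then (if c = c' \<and> j = l then r c k i x else 0) else 0)"
    unfolding r_mult[OF c'] using c c' by (intro sum.cong) (auto simp: r_E)
  also have "\<dots> = (if c = c' \<and> j = l then r c k i x else 0)" using c by auto
  finally show "r c' k l (x * E c i j) = (if c = c' \<and> j = l then r c k i x else 0)" .
  have "r c' k l (E c i j * x) = (\<Sum>p<fst c'. if p = j then (if c = c' \<and> i = k then r c j l x else 0) else 0)"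
    unfolding r_mult[OF c'] using c c' by (intro sum.cong) (auto simp: r_E)
  also have "\<dots> = (if c = c' \<and> i = k then r c j l x else 0)" using c by auto
  finally show "r c' k l (E c i j * x) = (if c = c' \<and> i = k then r c j l x else 0)" .
qed

lemma expand_E: "x = (\<Sum>c\<in>C. \<Sum>i<fst c. \<Sum>j<fst c. r c i j x *s E c i j)"
proof (rule entries_separate)
  fix c' k l assume c': "c' \<in> C" "k < fst c'" "l < fst c'"
  have "r c' k l (\<Sum>c\<in>C. \<Sum>i<fst c. \<Sum>j<fst c. r c i j x *s E c i j)
      = (\<Sum>c\<in>C. \<Sum>i<fst c. \<Sum>j<fst c. r c i j x * r c' k l (E c i j))"
    by (simp add: lin_sum[OF lin_r[OF c']] lin_scale[OF lin_r[OF c']])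
  also have "\<dots> = (\<Sum>c\<in>C. \<Sum>i<fst c. \<Sum>j<fst c. if j = l then (if i = k then (if c = c' then r c' k l x else 0) else 0) else 0)"
    using c' by (intro sum.cong HOL.refl) (auto simp: r_E)
  also have "\<dots> = (\<Sum>c\<in>C. if c = c' then r c' k l x else 0)"
  proof (intro sum.cong HOL.refl)
    fix c
    show "(\<Sum>i<fst c. \<Sum>j<fst c. if j = l then (if i = k then (if c = c' then r c' k l x else 0) else 0) else 0)
        = (if c = c' then r c' k l x else 0)"
    proof (cases "c = c'")
      case False
      then have "(if j = l then (if i = k then (if c = c' then r c' k l x else 0) else 0) else 0) = 0" for i j
        by simp
      then show ?thesis using False by (simp only: if_False sum.neutral_const)
    qed (use c' in simp)
  qed
  also have "\<dots> = r c' k l x" using c' finite_irreducible_characters by simp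
  finally show "r c' k l x = r c' k l (\<Sum>c\<in>C. \<Sum>i<fst c. \<Sum>j<fst c. r c i j x *s E c i j)" ..
qed

lemma tr_matrix_units:
  assumes f: "endo f"
  shows "tr f = (\<Sum>c\<in>C. \<Sum>i<fst c. \<Sum>j<fst c. r c i j (f (E c i j)))"
proof -
  define J where "J = (SIGMA c:C. {..<fst c} \<times> {..<fst c})"
  have J: "(\<Sum>c\<in>C. \<Sum>i<fst c. \<Sum>j<fst c. G c i j) = (\<Sum>(c, i, j)\<in>J. G c i j)"
    for G :: "_ \<Rightarrow> nat \<Rightarrow> nat \<Rightarrow> 'z::comm_monoid_add"
    unfolding J_def by (simp add: sum.Sigma[symmetric] finite_irreducible_characters sum.cartesian_product[symmetric])
  have "tr f = (\<Sum>x\<in>J. case x of (c, i, j) \<Rightarrow> r c i j (f (E c i j)))"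
  proof (rule tr_finite_rank[where p = "\<lambda>(c, i, j) x. r c i j x" and y = "\<lambda>(c, i, j). f (E c i j)", THEN HOL.trans])
    show "lin ((\<lambda>(c, i, j) x. r c i j x) y)" if "y \<in> J" for y
      using that by (auto simp: J_def intro: lin_r)
    show "f x = (\<Sum>j\<in>J. (case j of (c, i, j) \<Rightarrow> \<lambda>x. r c i j x) x *s (case j of (c, i, j) \<Rightarrow> f (E c i j)))" for x
    proof -
      have "f x = (\<Sum>c\<in>C. \<Sum>i<fst c. \<Sum>j<fst c. r c i j x *s f (E c i j))"
        by (subst expand_E[of x]) (simp add: endo_sum[OF f] endo_scale[OF f])
      then show ?thesis by (simp add: J split_def)
    qed
  qed (simp add: split_def)
  then show ?thesis by (simp add: J)
qed

text \<open>Left multiplication by \<open>x\<close> and right multiplication by \<open>y\<close> on a block act as a tensor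
product.\<close>

lemma tr_two_sided_mult: "tr (\<lambda>a. x * a * y) = (\<Sum>c\<in>C. snd c x * snd c y)"
proof -
  have "tr (\<lambda>a. x * a * y) = (\<Sum>c\<in>C. \<Sum>i<fst c. \<Sum>j<fst c. r c i j (x * E c i j * y))"
    by (rule tr_matrix_units) (intro linear_intros)
  also have "\<dots> = (\<Sum>c\<in>C. \<Sum>i<fst c. \<Sum>j<fst c. r c i i x * r c j j y)"
  proof (intro sum.cong HOL.refl)
    fix c i j assume "c \<in> C" "i \<in> {..<fst c}" "j \<in> {..<fst c}"
    then have c: "c \<in> C" "i < fst c" "j < fst c" by auto
    have "r c i j (x * E c i j * y) = (\<Sum>p<fst c. if p = j then r c i i x * r c j j y else 0)"
      unfolding r_mult[OF c] using c by (intro sum.cong) (auto simp: r_mult_E)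
    then show "r c i j (x * E c i j * y) = r c i i x * r c j j y" using c by simp
  qed
  also have "\<dots> = (\<Sum>c\<in>C. snd c x * snd c y)"
    by (intro sum.cong HOL.refl) (simp add: character_r sum_product)
  finally show ?thesis .
qed

lemma character_one: "c \<in> C \<Longrightarrow> snd c 1 = of_nat (fst c)"
  by (simp add: character_r r_one)

lemma regular_character_eq: "regular_character h = (\<Sum>c\<in>C. of_nat (fst c) * snd c h)"
  using tr_two_sided_mult[of h 1] by (simp add: regular_character_tr character_one mult.commute)

text \<open>Since \<open>S\<^sup>2\<close> is conjugation by \<open>U\<close>, the trace that defines \<open>lam\<close> is one of a two-sided multiplication; the factor
coming from \<open>U\<close> is its trace \<open>1\<close>.\<close>

lemma lam_eq: "lam x = (\<Sum>c\<in>C. snd c (V * x))"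
  using tr_two_sided_mult[of U "V * x"]
  by (simp add: lam_def antipode_squared_eq mult.assoc character_U)

lemma lam_antipode_eq: "lam (S x) = (\<Sum>c\<in>C. snd c V * snd c (U * x))"
  using tr_two_sided_mult[of V "U * x"] tr_inv_antipode_squared[of x]
  by (simp add: inv_antipode_squared_eq mult.assoc)

lemma character_mult_E:
  assumes c: "c \<in> C" "i < fst c" "j < fst c" and c': "c' \<in> C"
  shows "snd c' (x * E c i j) = (if c' = c then r c j i x else 0)"
proof -
  have "snd c' (x * E c i j) = (\<Sum>k<fst c'. if k = j then (if c' = c then r c j i x else 0) else 0)"
    unfolding character_r[OF c'] using c c' by (intro sum.cong) (auto simp: r_mult_E)
  then show ?thesis using c by auto
qed

text \<open>The comparison of \<open>lam(S x)\<close> with \<open>lam(g x)\<close> on matrix units \<open>x\<close> shows that \<open>g\<close> is a multiple of \<open>U\<^sup>2\<close> on each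
block.\<close>

lemma r_g:
  assumes c: "c \<in> C" "i < fst c" "j < fst c"
  shows "r c i j g = snd c V * r c i j (U * U)"
proof -
  have Vg: "r c p j (V * g) = snd c V * r c p j U" if p: "p < fst c" for p
  proof -
    have "(\<Sum>e\<in>C. snd e (V * (g * E c j p))) = (\<Sum>e\<in>C. snd e V * snd e (U * E c j p))"
      using lam_antipode_g[of "E c j p"] unfolding lam_antipode_eq by (simp add: lam_eq)
    moreover have "(\<Sum>e\<in>C. snd e (V * (g * E c j p))) = (\<Sum>e\<in>C. if e = c then r c p j (V * g) else 0)"
      using c p by (intro sum.cong) (auto simp: mult.assoc[symmetric] character_mult_E)
    moreover have "(\<Sum>e\<in>C. snd e V * snd e (U * E c j p)) = (\<Sum>e\<in>C. if e = c then snd c V * r c p j U else 0)"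
      using c p by (intro sum.cong) (auto simp: character_mult_E)
    ultimately show ?thesis using c finite_irreducible_characters by simp
  qed
  have "r c i j g = r c i j (U * (V * g))"
    by (simp add: mult.assoc[symmetric] UV)
  also have "\<dots> = snd c V * r c i j (U * U)"
    using c by (simp add: r_mult[OF c] Vg sum_distrib_left mult.left_commute)
  finally show ?thesis .
qed

lemma trivial_character: "(1, \<epsilon>) \<in> C"
proof -
  define \<rho> where "\<rho> h = mat 1 1 (\<lambda>_. \<epsilon> h)" for h
  have rep: "is_representation 1 \<rho>"
    unfolding is_representation_def \<rho>_def
    by (auto simp: lin_add[OF lin_counit] lin_scale[OF lin_counit] counit_mult counit_one scalar_prod_def
        intro!: eq_matI)
  have "irreducible_representation 1 \<rho>"
    unfolding irreducible_representation_def
  proof (intro conjI allI impI rep)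
    fix W assume W: "invariant_subspace 1 \<rho> W"
    then have Wc: "W \<subseteq> carrier_vec 1" "0\<^sub>v 1 \<in> W" and Ws: "\<And>c v. v \<in> W \<Longrightarrow> c \<cdot>\<^sub>v v \<in> W"
      unfolding invariant_subspace_def by auto
    show "W = {0\<^sub>v 1} \<or> W = carrier_vec 1"
    proof (cases "W \<subseteq> {0\<^sub>v 1}")
      case True
      then show ?thesis using Wc(2) by blast
    next
      case False
      then obtain w where w: "w \<in> W" "w \<noteq> 0\<^sub>v 1" by blast
      have wc: "w \<in> carrier_vec 1" using w(1) Wc(1) by blast
      have w0: "w $ 0 \<noteq> 0"
      proof
        assume "w $ 0 = 0"
        then have "w = 0\<^sub>v 1" using wc by (intro eq_vecI) auto
        with w(2) show False ..
      qed
      have "v \<in> W" if v: "v \<in> carrier_vec 1" for v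
      proof -
        have "v = (v $ 0 / w $ 0) \<cdot>\<^sub>v w" using v wc w0 by (intro eq_vecI) auto
        then show ?thesis using Ws[OF w(1)] by metis
      qed
      then have "carrier_vec 1 \<subseteq> W" by blast
      then show ?thesis using Wc(1) by blast
    qed
  qed simp
  moreover have "chi 1 \<rho> = \<epsilon>"
    by (rule ext) (simp add: chi_def \<rho>_def)
  ultimately show ?thesis
    unfolding irreducible_characters_eq by blast
qed

end

section \<open>Roots of unity and sums of squares\<close>

lemma card_roots_of_unity:
  assumes n: "n > 0"
  shows "card {z :: 'k::{alg_closed_field, field_char_0}. z ^ n = 1} = n"
proof -
  define p where "p = (monom 1 n - 1 :: 'k poly)"
  have roots: "poly p z = 0 \<longleftrightarrow> z ^ n = 1" for z
    by (simp add: p_def poly_monom)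
  have deg: "degree p = n"
  proof -
    have "degree (monom 1 n + (-1) :: 'k poly) = n"
      using n by (subst degree_add_eq_left) (simp_all add: degree_monom_eq)
    then show ?thesis by (simp add: p_def)
  qed
  have p0: "p \<noteq> 0" using deg n by auto
  have "rsquarefree p"
    unfolding rsquarefree_roots
  proof (intro allI notI)
    fix z assume *: "poly p z = 0 \<and> poly (pderiv p) z = 0"
    then have "z ^ n = 1" by (simp add: roots)
    then have "z \<noteq> 0" using n by (auto simp: power_0_left)
    moreover have "of_nat n * z ^ (n - 1) = 0"
      using * by (simp add: p_def pderiv_diff pderiv_monom poly_monom)
    ultimately show False using n by simp
  qed
  then have order: "Polynomial.order z p = 1" if "poly p z = 0" for z
    using that p0 by (metis rsquarefree_root_order)
  obtain A where A: "size A = degree p" "p = Polynomial.smult (lead_coeff p) (\<Prod>x\<in>#A. [:-x, 1:])"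
    using alg_closed_imp_factorization[OF p0] by blast
  have "proots p = proots (\<Prod>x\<in>#A. [:-x, 1:])"
    using p0 by (subst A(2)) simp
  also have "\<dots> = A"
  proof (induction A)
    case (add x A)
    have "(\<Prod>x\<in>#A. [:-x, 1:]) \<noteq> 0"
      by (simp add: prod_mset_zero_iff image_iff)
    then show ?case by (simp add: proots_mult add.IH del: mult_pCons_left)
  qed simp
  finally have "size (proots p) = n" by (simp add: A(1) deg)
  moreover have "proots p = mset_set {z. poly p z = 0}"
  proof (rule multiset_eqI)
    fix z
    have fin: "finite {z. poly p z = 0}" by (rule poly_roots_finite[OF p0])
    show "count (proots p) z = count (mset_set {z. poly p z = 0}) z"
    proof (cases "poly p z = 0")
      case True
      then show ?thesis using order[OF True] fin by (simp add: count_proots[OF p0])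
    next
      case False
      then have "Polynomial.order z p = 0" by (rule order_0I)
      then show ?thesis using False fin by (simp add: count_proots[OF p0])
    qed
  qed
  ultimately show ?thesis by (simp add: roots)
qed

text \<open>The sets of elements of exact order \<open>d\<close>, for \<open>d\<close> dividing \<open>n\<close>, partition the \<open>n\<close> roots of unity.
Comparison with \<open>\<Sum>\<^sub>d \<phi>(d) = n\<close> gives \<open>\<phi>(n) > 0\<close> elements of exact order \<open>n\<close>, by induction.\<close>

lemma primitive_root_of_unity_exists:
  assumes n: "n > 0"
  shows "\<exists>\<zeta> :: 'k::{alg_closed_field, field_char_0}. \<zeta> ^ n = 1 \<and> (\<forall>i. 0 < i \<and> i < n \<longrightarrow> \<zeta> ^ i \<noteq> 1)"
proof -
  define P where "P d = {z :: 'k. z ^ d = 1 \<and> (\<forall>i. 0 < i \<and> i < d \<longrightarrow> z ^ i \<noteq> 1)}" for d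
  have fin: "finite {z :: 'k. z ^ m = 1}" if "m > 0" for m
    using card_roots_of_unity[OF that, where 'k = 'k] that by (metis card_gt_0_iff)
  have disj: "P d \<inter> P e = {}" if "d > 0" "e > 0" "d \<noteq> e" for d e
    using that by (auto simp: P_def) (metis linorder_neqE_nat)
  have union: "{z :: 'k. z ^ m = 1} = (\<Union>d\<in>{d. d dvd m}. P d)" if m: "m > 0" for m
  proof (intro equalityI subsetI)
    fix z :: 'k assume z: "z \<in> {z. z ^ m = 1}"
    define d where "d = (LEAST i. 0 < i \<and> z ^ i = 1)"
    have d: "0 < d \<and> z ^ d = 1"
      unfolding d_def by (rule LeastI[of _ m]) (use z m in simp)
    have least: "z ^ i \<noteq> 1" if "0 < i" "i < d" for i
      using not_less_Least[of i "\<lambda>i. 0 < i \<and> z ^ i = 1"] that by (auto simp: d_def)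
    have "z ^ m = (z ^ d) ^ (m div d) * z ^ (m mod d)"
      by (simp add: power_mult[symmetric] power_add[symmetric])
    then have "z ^ (m mod d) = 1" using z d by simp
    then have "m mod d = 0" using least[of "m mod d"] d by auto
    then show "z \<in> (\<Union>d\<in>{d. d dvd m}. P d)"
      using d least by (auto simp: P_def)
  next
    fix z :: 'k assume "z \<in> (\<Union>d\<in>{d. d dvd m}. P d)"
    then obtain d where "d dvd m" "z ^ d = 1" by (auto simp: P_def)
    then show "z \<in> {z. z ^ m = 1}" by (auto simp: power_mult)
  qed
  have "card (P n) = totient n"
    using n
  proof (induction n rule: less_induct)
    case (less n)
    have finD: "finite {d. d dvd n}" using less.prems by simp
    have finP: "finite (P d)" if "d > 0" for d
      by (rule finite_subset[OF _ fin[OF that]]) (auto simp: P_def)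
    have "n = (\<Sum>d | d dvd n. card (P d))"
    proof -
      have "n = card {z :: 'k. z ^ n = 1}" by (rule card_roots_of_unity[OF less.prems, symmetric])
      also have "\<dots> = card (\<Union>d\<in>{d. d dvd n}. P d)" by (simp only: union[OF less.prems])
      also have "\<dots> = (\<Sum>d | d dvd n. card (P d))"
      proof (intro card_UN_disjoint finD ballI impI)
        show "finite (P d)" if "d \<in> {d. d dvd n}" for d
          using that less.prems dvd_pos_nat by (intro finP) auto
        show "P d \<inter> P e = {}" if "d \<in> {d. d dvd n}" "e \<in> {d. d dvd n}" "d \<noteq> e" for d e
          using that less.prems dvd_pos_nat by (intro disj) auto
      qed
      finally show ?thesis .
    qed
    also have "\<dots> = card (P n) + (\<Sum>d\<in>{d. d dvd n} - {n}. card (P d))"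
      by (rule sum.remove[OF finD]) simp
    also have "(\<Sum>d\<in>{d. d dvd n} - {n}. card (P d)) = (\<Sum>d\<in>{d. d dvd n} - {n}. totient d)"
    proof (intro sum.cong HOL.refl less.IH)
      fix d assume d: "d \<in> {d. d dvd n} - {n}"
      then show "0 < d" using less.prems dvd_pos_nat by auto
      have "d \<le> n" using d less.prems by (auto intro: dvd_imp_le)
      then show "d < n" using d by auto
    qed
    finally have 1: "n = card (P n) + (\<Sum>d\<in>{d. d dvd n} - {n}. totient d)" .
    have 2: "n = totient n + (\<Sum>d\<in>{d. d dvd n} - {n}. totient d)"
      using totient_divisor_sum[of n] sum.remove[OF finD, of n totient] by simp
    show ?case using 1 2 by linarith
  qed
  then have "card (P n) > 0" using n by simp
  then obtain \<zeta> where "\<zeta> \<in> P n" by fastforce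
  then show ?thesis by (auto simp: P_def)
qed

definition rat_eval :: "'k::field_char_0 \<Rightarrow> rat poly \<Rightarrow> 'k" where
  "rat_eval x f = poly (map_poly of_rat f) x"

lemma rat_eval_pCons: "rat_eval x (pCons a f) = of_rat a + x * rat_eval x f"
  by (simp add: rat_eval_def Polynomial.map_poly_pCons)

lemma rat_eval_0: "rat_eval x 0 = 0"
  by (simp add: rat_eval_def)

lemma rat_eval_1: "rat_eval x 1 = 1"
  by (simp add: one_pCons rat_eval_pCons rat_eval_0)

lemma rat_eval_add: "rat_eval x (f + g) = rat_eval x f + rat_eval x g"
  by (induction f g rule: poly_induct2) (simp_all add: rat_eval_0 rat_eval_pCons of_rat_add algebra_simps)

lemma rat_eval_smult: "rat_eval x (Polynomial.smult a f) = of_rat a * rat_eval x f"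
  by (induction f) (simp_all add: rat_eval_0 rat_eval_pCons of_rat_mult algebra_simps)

lemma rat_eval_mult: "rat_eval x (f * g) = rat_eval x f * rat_eval x g"
  by (induction f) (simp_all add: rat_eval_0 rat_eval_pCons rat_eval_add rat_eval_smult algebra_simps)

lemma rat_eval_diff: "rat_eval x (f - g) = rat_eval x f - rat_eval x g"
  using rat_eval_add[of x "f - g" g] by (simp add: algebra_simps)

lemma rat_eval_sum: "rat_eval x (\<Sum>i\<in>I. f i) = (\<Sum>i\<in>I. rat_eval x (f i))"
  by (induction I rule: infinite_finite_induct) (simp_all add: rat_eval_0 rat_eval_add)

lemma rat_eval_monom: "rat_eval x (monom a n) = of_rat a * x ^ n"
  by (induction n) (simp_all add: monom_0 monom_Suc rat_eval_pCons rat_eval_0)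

text \<open>The rational polynomials vanishing at \<open>\<zeta>\<close> are the multiples of one nonconstant polynomial; \<open>z\<close> is a
complex root of it.\<close>

lemma root_of_unity_transfer:
  fixes \<zeta> :: "'k::field_char_0"
  assumes M: "M > 0" and \<zeta>: "\<zeta> ^ M = 1"
  shows "\<exists>z::complex. \<forall>f. rat_eval \<zeta> f = 0 \<longrightarrow> rat_eval z f = 0"
proof -
  define P where "P f \<longleftrightarrow> f \<noteq> 0 \<and> rat_eval \<zeta> f = 0" for f
  have "monom 1 M - 1 \<noteq> (0 :: rat poly)"
  proof
    assume "monom 1 M - 1 = (0 :: rat poly)"
    then have "coeff (monom 1 M - 1 :: rat poly) M = 0" by simp
    then show False using M by simp
  qed
  then have "P (monom 1 M - 1)"
    by (simp add: P_def rat_eval_diff rat_eval_monom rat_eval_1 \<zeta>)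
  then obtain p where p: "P p" "\<And>f. P f \<Longrightarrow> degree p \<le> degree f"
    using ex_has_least_nat[of P _ degree] by blast
  have "degree p > 0"
  proof (rule ccontr)
    assume "\<not> degree p > 0"
    then obtain a where "p = [:a:]" by (auto elim: degree_eq_zeroE)
    then show False using p(1) by (simp add: P_def rat_eval_pCons rat_eval_0)
  qed
  then have "degree (map_poly of_rat p :: complex poly) > 0"
    by (simp add: degree_map_poly)
  then obtain z where z: "rat_eval z p = (0 :: complex)"
    using alg_closed_imp_poly_has_root unfolding rat_eval_def by blast
  have "rat_eval z f = 0" if f: "rat_eval \<zeta> f = 0" for f
  proof -
    have "rat_eval \<zeta> (f div p * p + f mod p) = 0" using f by simp
    then have "rat_eval \<zeta> (f mod p) = 0"
      using p(1) unfolding rat_eval_add rat_eval_mult P_def by simp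
    then have "f mod p = 0"
      using p(2)[of "f mod p"] p(1) degree_mod_less[of p f] unfolding P_def by auto
    then have "f = f div p * p" by (metis add.right_neutral div_mult_mod_eq)
    then have "rat_eval z f = rat_eval z (f div p) * rat_eval z p" by (metis rat_eval_mult)
    then show ?thesis by (simp add: z)
  qed
  then show ?thesis by blast
qed

text \<open>The two expressions for \<open>s\<close> say that it is invariant under \<open>\<zeta> \<mapsto> \<zeta>\<^sup>-\<^sup>1\<close>.  This is complex conjugation after
\<open>\<zeta>\<close> has been replaced by a complex root of unity, so the corresponding complex numbers are real.\<close>

lemma sum_squares_nonzero:
  fixes \<zeta> :: "'k::field_char_0" and s :: "'c \<Rightarrow> 'k"
  assumes M: "M > 0" and \<zeta>: "\<zeta> ^ M = 1" and fin: "finite C"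
    and s1: "\<And>c. c \<in> C \<Longrightarrow> of_nat (n c) * s c = (\<Sum>j<M. of_nat (m c j) * \<zeta> ^ j)"
    and s2: "\<And>c. c \<in> C \<Longrightarrow> of_nat (n c) * s c = (\<Sum>j<M. of_nat (m c j) * \<zeta> ^ (M - j))"
    and n: "\<And>c. c \<in> C \<Longrightarrow> n c > (0::nat)"
    and c0: "c0 \<in> C" "(s c0)\<^sup>2 = 1"
  shows "(\<Sum>c\<in>C. (s c)\<^sup>2) \<noteq> 0"
proof
  assume 0: "(\<Sum>c\<in>C. (s c)\<^sup>2) = 0"
  obtain z :: complex where z: "\<And>f. rat_eval \<zeta> f = 0 \<Longrightarrow> rat_eval z f = 0"
    using root_of_unity_transfer[OF M \<zeta>] by blast
  have "rat_eval z (monom 1 M - 1) = 0"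
    by (rule z) (simp add: rat_eval_diff rat_eval_monom rat_eval_1 \<zeta>)
  then have zM: "z ^ M = 1" by (simp add: rat_eval_diff rat_eval_monom rat_eval_1)
  then have "cmod z ^ M = 1" by (metis norm_one norm_power)
  then have "cmod z = 1" using power_eq_imp_eq_base[of "cmod z" M 1] M by simp
  then have cz: "z * cnj z = 1" by (simp add: complex_norm_square[symmetric])
  have cnj_z: "cnj (z ^ j) = z ^ (M - j)" if "j < M" for j
  proof -
    have "cnj (z ^ j) = cnj (z ^ j) * (z ^ j * z ^ (M - j))"
      using that zM by (simp add: power_add[symmetric])
    also have "\<dots> = (z * cnj z) ^ j * z ^ (M - j)"
      by (simp add: power_mult_distrib mult_ac)
    finally show ?thesis by (simp add: cz)
  qed
  \<comment> \<open>Rational polynomials with value \<open>s c\<close> at \<open>\<zeta>\<close>, according to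
    the two expressions.\<close>
  define f where "f c = (\<Sum>j<M. monom (of_nat (m c j) / of_nat (n c) :: rat) j)" for c
  define f' where "f' c = (\<Sum>j<M. monom (of_nat (m c j) / of_nat (n c) :: rat) (M - j))" for c
  have f: "rat_eval \<zeta> (f c) = s c" "rat_eval \<zeta> (f' c) = s c" if "c \<in> C" for c
  proof -
    have n0: "(of_nat (n c) :: 'k) \<noteq> 0" using n[OF that] by simp
    have "of_nat (n c) * rat_eval \<zeta> (f c) = of_nat (n c) * s c"
      "of_nat (n c) * rat_eval \<zeta> (f' c) = of_nat (n c) * s c"
      using n0 by (simp_all only: s1[OF that])
        (simp_all add: f_def f'_def rat_eval_sum rat_eval_monom of_rat_divide sum_distrib_left s1[OF that, symmetric] s2[OF that])
    then show "rat_eval \<zeta> (f c) = s c" "rat_eval \<zeta> (f' c) = s c" using n0 by simp_all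
  qed
  have real: "\<exists>x::real. rat_eval z (f c) = of_real x" if c: "c \<in> C" for c
  proof -
    have "rat_eval z (f c - f' c) = 0"
      by (rule z) (simp add: rat_eval_diff f[OF c])
    then have "rat_eval z (f c) = rat_eval z (f' c)" by (simp add: rat_eval_diff)
    also have "\<dots> = cnj (rat_eval z (f c))"
      by (simp add: f_def f'_def rat_eval_sum rat_eval_monom of_rat_divide cnj_z[symmetric])
    finally have "rat_eval z (f c) \<in> \<real>"
      by (metis Reals_cnj_iff)
    then show ?thesis by (auto elim: Reals_cases)
  qed
  then obtain x where x: "\<And>c. c \<in> C \<Longrightarrow> rat_eval z (f c) = complex_of_real (x c)"
    by metis
  have "rat_eval z (\<Sum>c\<in>C. f c * f c) = 0"
    by (rule z) (use 0 in \<open>simp add: rat_eval_sum rat_eval_mult f power2_eq_square\<close>)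
  then have "complex_of_real (\<Sum>c\<in>C. x c * x c) = 0"
    by (simp add: rat_eval_sum rat_eval_mult x)
  then have "(\<Sum>c\<in>C. x c * x c) = 0" by (simp only: of_real_eq_0_iff)
  then have "x c0 = 0"
    using fin c0 by (subst (asm) sum_nonneg_eq_0_iff) auto
  moreover have "rat_eval z (f c0 * f c0 - 1) = 0"
    by (rule z) (use c0 in \<open>simp add: rat_eval_diff rat_eval_mult rat_eval_1 f power2_eq_square\<close>)
  ultimately show False
    by (simp add: rat_eval_diff rat_eval_mult rat_eval_1 x c0)
qed

section \<open>The antipode is an involution\<close>

context semisimple_hopf_algebra
begin

text \<open>The central element acting as the scalar \<open>\<alpha> c\<close> on the block of \<open>c\<close>.\<close>

definition central :: "(nat \<times> ('a \<Rightarrow> 'k) \<Rightarrow> 'k) \<Rightarrow> 'a" where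
  "central \<alpha> = (\<Sum>c\<in>C. \<Sum>i<fst c. \<alpha> c *s E c i i)"

lemma r_central_mult:
  assumes c: "c \<in> C" "i < fst c" "j < fst c"
  shows "r c i j (central \<alpha> * x) = \<alpha> c * r c i j x"
    and "r c i j (x * central \<alpha>) = \<alpha> c * r c i j x"
proof -
  note l = lin_sum[OF lin_r[OF c]] lin_scale[OF lin_r[OF c]]
  have "r c i j (central \<alpha> * x) = (\<Sum>e\<in>C. \<Sum>k<fst e. \<alpha> e * r c i j (E e k k * x))"
    by (simp add: central_def sum_distrib_right scale_mult_left l)
  also have "\<dots> = (\<Sum>e\<in>C. if e = c then \<alpha> c * r c i j x else 0)"
    using c by (intro sum.cong HOL.refl) (auto simp: r_mult_E if_distrib[of "(*) _"] cong: if_cong)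
  also have "\<dots> = \<alpha> c * r c i j x" using c finite_irreducible_characters by simp
  finally show "r c i j (central \<alpha> * x) = \<alpha> c * r c i j x" .
  have "r c i j (x * central \<alpha>) = (\<Sum>e\<in>C. \<Sum>k<fst e. \<alpha> e * r c i j (x * E e k k))"
    by (simp add: central_def sum_distrib_left scale_mult_right l)
  also have "\<dots> = (\<Sum>e\<in>C. if e = c then \<alpha> c * r c i j x else 0)"
    using c by (intro sum.cong HOL.refl) (auto simp: r_mult_E if_distrib[of "(*) _"] cong: if_cong)
  also have "\<dots> = \<alpha> c * r c i j x" using c finite_irreducible_characters by simp
  finally show "r c i j (x * central \<alpha>) = \<alpha> c * r c i j x" .
qed

lemma r_central: "c \<in> C \<Longrightarrow> i < fst c \<Longrightarrow> j < fst c \<Longrightarrow> r c i j (central \<alpha>) = (if i = j then \<alpha> c else 0)"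
  using r_central_mult(1)[of c i j \<alpha> 1] by (simp add: r_one)

lemma central_commute: "central \<alpha> * x = x * central \<alpha>"
  by (rule entries_separate) (simp add: r_central_mult)

lemma central_mult: "central \<alpha> * central \<beta> = central (\<lambda>c. \<alpha> c * \<beta> c)"
  by (rule entries_separate) (simp add: r_central_mult(1) r_central)

lemma character_central_mult: "c \<in> C \<Longrightarrow> snd c (central \<alpha> * x) = \<alpha> c * snd c x"
  by (simp add: character_r r_central_mult sum_distrib_left)

text \<open>On the block of \<open>c\<close> let \<open>t\<^sub>c\<close> be the trace of \<open>U\<^sup>-\<^sup>1\<close>, so that \<open>lam 1 = \<Sum> t\<^sub>c\<close> and \<open>g = t\<^sub>c U\<^sup>2\<close>.
With \<open>s\<^sub>c\<^sup>2 = t\<^sub>c\<close>, the element \<open>W = s\<^sub>c U\<close> is a square root of \<open>g\<close>, hence of finite order.  Both \<open>W\<close> and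
\<open>W\<^sup>-\<^sup>1 = s\<^sub>c\<^sup>-\<^sup>1 U\<^sup>-\<^sup>1\<close> have the trace \<open>s\<^sub>c\<close>.  The spectral projections of \<open>W\<close> express these traces by roots of
unity, as needed for \<open>sum_squares_nonzero\<close>; the trivial character provides the nonzero summand.\<close>

lemma lam_one_nonzero: "lam 1 \<noteq> 0"
proof -
  obtain N where N: "N > 0" "g ^ N = 1" using g_finite_order by blast
  define M where "M = 2 * N"
  have M: "M > 0" using N by (simp add: M_def)
  define s where "s c = (SOME s. s\<^sup>2 = snd c V)" for c :: "nat \<times> ('a \<Rightarrow> 'k)"
  have s: "(s c)\<^sup>2 = snd c V" for c
    unfolding s_def by (rule someI_ex) (use nth_root_exists[of 2 "snd c V"] in auto)
  define W where "W = central s * U"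
  have rW: "r c i j (W * x) = s c * r c i j (U * x)" "r c i j (x * W) = s c * r c i j (x * U)"
    if "c \<in> C" "i < fst c" "j < fst c" for c i j x
  proof -
    have "W * x = central s * (U * x)" by (simp only: W_def mult.assoc)
    moreover have "x * W = central s * (x * U)"
      by (simp only: W_def mult.assoc[symmetric] central_commute[of s x])
    ultimately show "r c i j (W * x) = s c * r c i j (U * x)" "r c i j (x * W) = s c * r c i j (x * U)"
      using r_central_mult(1)[OF that] by simp_all
  qed
  have W2: "W * W = g"
  proof (rule entries_separate)
    fix c i j assume c: "c \<in> C" "i < fst c" "j < fst c"
    have "r c i j (W * W) = (s c)\<^sup>2 * r c i j (U * U)"
      by (simp add: rW[OF c] power2_eq_square)
    then show "r c i j (W * W) = r c i j g" by (simp add: r_g[OF c] s)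
  qed
  have WM: "W ^ M = 1"
    by (simp add: M_def power_mult power2_eq_square W2 N)
  define Y where "Y = W ^ (M - 1)"
  have WY: "W * Y = 1"
    using WM M unfolding Y_def by (metis Suc_diff_1 power_Suc)
  have s_Y: "r c i j V = s c * r c i j Y" if c: "c \<in> C" "i < fst c" "j < fst c" for c i j
  proof -
    have "r c i j V = r c i j (V * (W * Y))" by (simp add: WY)
    also have "\<dots> = r c i j (central s * (V * U * Y))"
      by (simp add: W_def mult.assoc[symmetric] central_commute[of s V])
    also have "\<dots> = s c * r c i j Y"
      using r_central_mult(1)[OF c] by (simp add: VU)
    finally show ?thesis .
  qed
  have s0: "s c \<noteq> 0" if c: "c \<in> C" for c
  proof
    assume "s c = 0"
    then have "r c 0 0 (W * Y) = 0" using c degree_pos[OF c] by (simp add: rW)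
    then show False using c degree_pos[OF c] by (simp add: WY r_one)
  qed
  have char_W: "snd c W = s c" if c: "c \<in> C" for c
    using character_central_mult[OF c, of s U] by (simp add: W_def character_U[OF c])
  have char_Y: "snd c Y = s c" if c: "c \<in> C" for c
  proof -
    have "(s c)\<^sup>2 = s c * snd c Y"
      unfolding s using c by (simp add: character_r s_Y sum_distrib_left)
    then show ?thesis using s0[OF c] by (simp add: power2_eq_square)
  qed
  obtain \<zeta> :: 'k where \<zeta>: "\<zeta> ^ M = 1" "\<And>i. 0 < i \<Longrightarrow> i < M \<Longrightarrow> \<zeta> ^ i \<noteq> 1"
    using primitive_root_of_unity_exists[OF M] by blast
  have \<zeta>0: "\<zeta> \<noteq> 0" using \<zeta>(1) M by (auto simp: power_0_left)
  define \<omega> where "\<omega> = inverse \<zeta>"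
  have \<omega>: "\<omega> * \<zeta> = 1" "\<omega> ^ M = 1" using \<zeta>0 \<zeta>(1) by (simp_all add: \<omega>_def power_inverse)
  \<comment> \<open>The projection onto the eigenspace of \<open>W\<close> for \<open>\<zeta> ^
    j\<close>.\<close>
  define \<pi> where "\<pi> j = (\<Sum>i<M. (\<omega> ^ (j * i) / of_nat M) *s W ^ i)" for j
  have W\<pi>: "W * \<pi> j = \<zeta> ^ j *s \<pi> j" for j
  proof -
    define h where "h i = (\<omega> ^ (j * i) / of_nat M) *s W ^ i" for i
    have hM: "h M = h 0"
      using \<omega>(2) by (simp add: h_def WM power_mult mult.commute[of j])
    have "W * \<pi> j = (\<Sum>i<M. \<zeta> ^ j *s h (Suc i))"
    proof -
      have "\<zeta> ^ j * (\<omega> ^ (j * Suc i)) = \<omega> ^ (j * i)" for i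
      proof -
        have "\<zeta> ^ j * (\<omega> ^ (j * Suc i)) = (\<omega> * \<zeta>) ^ j * \<omega> ^ (j * i)"
          by (simp add: power_add power_mult_distrib mult_ac)
        then show ?thesis by (simp add: \<omega>)
      qed
      then show ?thesis
        by (simp add: \<pi>_def sum_distrib_left scale_mult_right h_def)
    qed
    also have "\<dots> = \<zeta> ^ j *s (\<Sum>i<M. h (Suc i))" by (simp add: scale_sum_right)
    also have "(\<Sum>i<M. h (Suc i)) = (\<Sum>i<M. h i)"
      using sum.lessThan_Suc_shift[of h M] hM by simp
    finally show ?thesis by (simp add: \<pi>_def h_def)
  qed
  have Wn\<pi>: "W ^ n * \<pi> j = \<zeta> ^ (j * n) *s \<pi> j" for n j
    by (induction n) (simp_all add: mult.assoc scale_mult_right W\<pi> power_add mult.commute)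
  have \<pi>\<pi>: "\<pi> j * \<pi> j = \<pi> j" for j
  proof -
    have "\<omega> ^ (j * i) * \<zeta> ^ (j * i) = 1" for i
      by (simp add: power_mult_distrib[symmetric] \<omega>)
    then have "\<pi> j * \<pi> j = (\<Sum>i<M. (1 / of_nat M) *s \<pi> j)"
      by (subst (1) \<pi>_def) (simp add: sum_distrib_right scale_mult_left Wn\<pi>)
    also have "\<dots> = \<pi> j"
      using M by (simp only: scale_sum_left[symmetric]) simp
    finally show ?thesis .
  qed
  have sum\<pi>: "(\<Sum>j<M. \<pi> j) = 1"
  proof -
    have geo: "(\<Sum>j<M. \<omega> ^ (j * i)) = (if i = 0 then of_nat M else 0)" if i: "i < M" for i
    proof (cases "i = 0")
      case False
      have "\<omega> ^ i \<noteq> 1"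
        using \<zeta>(2)[of i] False i by (simp add: \<omega>_def power_inverse)
      moreover have "(\<omega> ^ i) ^ M = 1" by (metis \<omega>(2) mult.commute power_mult power_one)
      ultimately have "(\<Sum>j<M. (\<omega> ^ i) ^ j) = 0"
        by (simp add: geometric_sum)
      then show ?thesis using False by (simp add: power_mult[symmetric] mult.commute)
    qed simp
    have "(\<Sum>j<M. \<pi> j) = (\<Sum>i<M. ((\<Sum>j<M. \<omega> ^ (j * i)) / of_nat M) *s W ^ i)"
      unfolding \<pi>_def by (subst sum.swap) (simp add: scale_sum_left sum_divide_distrib)
    also have "\<dots> = (\<Sum>i<M. if i = 0 then 1 else 0)"
      using M by (intro sum.cong) (auto simp: geo)
    also have "\<dots> = 1" using M by simp
    finally show ?thesis .
  qed
  define e where "e c = central (\<lambda>c'. if c' = c then 1 else 0)" for c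
  have ee: "e c * x * (e c * y) = e c * (x * y)" for c x y
  proof -
    have "e c * x * (e c * y) = e c * (x * e c) * y" by (simp only: mult.assoc)
    also have "x * e c = e c * x" by (simp only: e_def central_commute)
    also have "e c * (e c * x) * y = (e c * e c) * (x * y)" by (simp only: mult.assoc)
    finally have "e c * x * (e c * y) = (e c * e c) * (x * y)" .
    moreover have "e c * e c = e c" by (simp add: e_def central_mult if_distrib cong: if_cong)
    ultimately show ?thesis by simp
  qed
  have tr_e: "tr (\<lambda>a. e c * x * a) = of_nat (fst c) * snd c x" if c: "c \<in> C" for c x
  proof -
    have "tr (\<lambda>a. e c * x * a) = (\<Sum>c'\<in>C. snd c' (e c * x) * snd c' 1)"
      using tr_two_sided_mult[of "e c * x" 1] by simp
    also have "\<dots> = (\<Sum>c'\<in>C. if c' = c then snd c x * of_nat (fst c) else 0)"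
      by (intro sum.cong) (auto simp: e_def character_central_mult character_one)
    finally show ?thesis using c finite_irreducible_characters by (simp add: mult.commute)
  qed
  \<comment> \<open>Left multiplication by \<open>x\<close> on the block of \<open>c\<close> has \<open>fst
    c\<close> times the trace of the matrix of \<open>x\<close>; this factor is the coefficient of \<open>s
    c\<close> in \<open>sum_squares_nonzero\<close>.\<close>
  have "\<exists>n. tr (\<lambda>a. e c * \<pi> j * a) = of_nat n" for c j
  proof -
    have "endo (\<lambda>a. e c * \<pi> j * a)" by (intro linear_intros)
    moreover have "e c * \<pi> j * (e c * \<pi> j * a) = e c * \<pi> j * a" for a
    proof -
      have "e c * \<pi> j * (e c * \<pi> j * a) = e c * (\<pi> j * (\<pi> j * a))"
        using ee[of c "\<pi> j" "\<pi> j * a"] by (simp only: mult.assoc)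
      also have "\<pi> j * (\<pi> j * a) = \<pi> j * a" by (simp only: mult.assoc[symmetric] \<pi>\<pi>)
      finally show ?thesis by (simp only: mult.assoc)
    qed
    ultimately show ?thesis using tr_idempotent by metis
  qed
  then obtain m where m: "\<And>c j. tr (\<lambda>a. e c * \<pi> j * a) = of_nat (m c j)" by metis
  have expand: "of_nat (fst c) * snd c (W ^ n) = (\<Sum>j<M. of_nat (m c j) * \<zeta> ^ (j * n))" if c: "c \<in> C" for c n
  proof -
    have "W ^ n = W ^ n * (\<Sum>j<M. \<pi> j)" by (simp add: sum\<pi>)
    also have "\<dots> = (\<Sum>j<M. \<zeta> ^ (j * n) *s \<pi> j)" by (simp add: sum_distrib_left Wn\<pi>)
    finally have "snd c (W ^ n) = (\<Sum>j<M. \<zeta> ^ (j * n) * snd c (\<pi> j))"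
      by (simp add: lin_sum[OF lin_character[OF c]] lin_scale[OF lin_character[OF c]])
    moreover have "of_nat (m c j) = of_nat (fst c) * snd c (\<pi> j)" for j
      by (simp only: m[symmetric] tr_e[OF c])
    ultimately show ?thesis
      by (simp add: sum_distrib_left mult_ac)
  qed
  have "(\<Sum>c\<in>C. (s c)\<^sup>2) \<noteq> 0"
  proof (rule sum_squares_nonzero[OF M \<zeta>(1) finite_irreducible_characters, where n = fst and m = m and ?c0.0 = "(1, \<epsilon>)"])
    fix c assume c: "c \<in> C"
    show "of_nat (fst c) * s c = (\<Sum>j<M. of_nat (m c j) * \<zeta> ^ j)"
      using expand[OF c, of 1] by (simp add: char_W[OF c])
    have "\<zeta> ^ (j * (M - 1)) = \<zeta> ^ (M - j)" if "j < M" for j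
    proof -
      have "\<zeta> ^ (j * (M - 1)) * \<zeta> ^ j = \<zeta> ^ (M - j) * \<zeta> ^ j"
      proof -
        have "j * (M - 1) + j = M * j" using M by (cases M) auto
        moreover have "M - j + j = M" using that by simp
        ultimately show ?thesis
          by (simp only: power_add[symmetric]) (simp only: power_mult \<zeta>(1) power_one)
      qed
      then show ?thesis using \<zeta>0 by simp
    qed
    then show "of_nat (fst c) * s c = (\<Sum>j<M. of_nat (m c j) * \<zeta> ^ (M - j))"
      using expand[OF c, of "M - 1"] char_Y[OF c] unfolding Y_def by simp
    show "fst c > 0" by (rule degree_pos[OF c])
  next
    show "(1, \<epsilon>) \<in> C" by (rule trivial_character)
    have "\<epsilon> U * \<epsilon> V = 1" using arg_cong[OF UV, of \<epsilon>] by (simp add: counit_mult counit_one)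
    then show "(s (1, \<epsilon>))\<^sup>2 = 1"
      using character_U[OF trivial_character] by (simp add: s)
  qed
  then show ?thesis by (simp add: s lam_eq)
qed

lemma g_one: "g = 1"
proof (rule lin_ext)
  fix p assume p: "lin p"
  have "p 1 * lam 1 = p g * lam 1"
    using lam_coinvariant_g[OF p, of 1] sw_one[of "\<lambda>a b. p a * lam b"] by (simp add: linear_intros p lin_lam)
  then show "p g = p 1" using lam_one_nonzero by simp
qed

text \<open>By \<open>g = 1\<close> and \<open>r_g\<close>, \<open>U\<^sup>2\<close> is central.\<close>

lemma antipode_power4: "S (S (S (S x))) = x"
proof -
  have UU: "snd c V * r c i j (U * U) = r c i j 1" if "c \<in> C" "i < fst c" "j < fst c" for c i j
    using r_g[OF that] by (simp add: g_one)
  have "U * U * x = x * (U * U)"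
  proof (rule entries_separate)
    fix c i j assume c: "c \<in> C" "i < fst c" "j < fst c"
    have t0: "snd c V \<noteq> 0" using UU[OF c(1,2,2)] c by (auto simp: r_one)
    have "snd c V * r c i j (U * U * x) = (\<Sum>p<fst c. snd c V * r c i p (U * U) * r c p j x)"
      by (simp only: r_mult[OF c, of "U * U"] sum_distrib_left mult.assoc[of "snd c V"])
    also have "\<dots> = (\<Sum>p<fst c. r c i p 1 * r c p j x)" using c by (simp add: UU)
    also have "\<dots> = (\<Sum>p<fst c. r c i p x * r c p j 1)"
      by (simp only: r_mult[OF c, symmetric] mult_1_left mult_1_right)
    also have "\<dots> = (\<Sum>p<fst c. r c i p x * (snd c V * r c p j (U * U)))" using c by (simp add: UU)
    also have "\<dots> = snd c V * r c i j (x * (U * U))"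
      by (simp only: r_mult[OF c, of x] sum_distrib_left mult.left_commute[of "snd c V"])
    finally show "r c i j (U * U * x) = r c i j (x * (U * U))" using t0 by simp
  qed
  then have "U * (U * x) = x * (U * U)" by (simp add: mult.assoc)
  then have "S (S (S (S x))) = x * (U * (U * V) * V)"
    by (simp add: antipode_squared_eq mult.assoc[symmetric])
  then show ?thesis by (simp add: UV)
qed

text \<open>The theorem of Larson and Radford.\<close>

theorem antipode_involutive: "S (S x) = x"
  by (rule antipode_involutive_if_power4[OF lam_one_nonzero antipode_power4])

lemma inv_antipode_eq_antipode: "T x = S x"
  by (rule antipode_inject) (simp add: antipode_involutive)

text \<open>As \<open>S\<^sup>2 = id\<close>, \<open>U\<close> commutes with all matrix units; the scalar on a block is determined by the trace
\<open>1\<close>.\<close>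

lemma U_eq_central: "U = central (\<lambda>c. 1 / of_nat (fst c))"
proof (rule entries_separate)
  fix c i j assume c: "c \<in> C" "i < fst c" "j < fst c"
  have UE: "U * x = x * U" for x
    using antipode_squared_mult_U[of x] by (simp add: antipode_involutive)
  have diag: "r c i j U = (if i = j then r c k k U else 0)" if "i < fst c" "j < fst c" "k < fst c" for i j k
    using arg_cong[OF UE[of "E c j k"], of "r c i k"] c that by (auto simp: r_mult_E)
  have "1 = (\<Sum>k<fst c. r c k k U)"
    using character_U[OF c(1)] by (simp add: character_r c)
  also have "\<dots> = (\<Sum>k<fst c. r c i i U)"
  proof (rule sum.cong[OF HOL.refl])
    fix k assume "k \<in> {..<fst c}"
    then show "r c k k U = r c i i U" using diag[of k k i] c by simp
  qed
  finally have ii: "r c i i U = 1 / of_nat (fst c)"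
    using degree_pos[OF c(1)] by (simp add: field_simps)
  show "r c i j U = r c i j (central (\<lambda>c. 1 / of_nat (fst c)))"
    unfolding diag[OF c(2,3,2)] ii by (simp add: r_central c)
qed

lemma r_U:
  assumes "c \<in> C" "i < fst c" "j < fst c"
  shows "r c i j U = (if i = j then 1 / of_nat (fst c) else 0)"
  by (subst U_eq_central) (rule r_central[OF assms])

lemma V_eq_central: "V = central (\<lambda>c. of_nat (fst c))"
proof -
  have "U * central (\<lambda>c. of_nat (fst c)) = 1"
    by (subst U_eq_central, rule entries_separate) (use degree_pos in \<open>simp add: central_mult r_central r_one\<close>)
  then have "V = V * (U * central (\<lambda>c. of_nat (fst c)))" by simp
  then show ?thesis by (simp add: mult.assoc[symmetric] VU)
qed

section \<open>The symmetric Casimir element and the elements z\<close>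

lemma lam_eq_regular_character: "lam = regular_character"
  by (rule ext) (simp add: lam_eq regular_character_eq V_eq_central character_central_mult)

lemma lam_antipode: "lam (S x) = lam x"
  by (simp add: lam_antipode_g g_one)

text \<open>Both sides are dual bases for the form \<open>lam(x y)\<close>, which is invariant under the antipode; dual bases are
unique, so substituting one expansion into the other proves the equality.\<close>

lemma casimir_symmetric:
  assumes F: "bil F"
  shows "sw \<Lambda> (\<lambda>a b. F (S a) b) = sw \<Lambda> (\<lambda>a b. F a (S b))"
proof -
  note li = linear_intros bil_left[OF F] bil_right[OF F] lin_lam lin_comp[OF lin_lam] bilD[OF F]
  have "sw \<Lambda> (\<lambda>a' b'. F (S a') b') = sw \<Lambda> (\<lambda>a' b'. sw \<Lambda> (\<lambda>a b. F a b' * lam (S a' * T b)))"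
    by (rule sw_cong, rule lin_lam_expand_left[symmetric]) (intro li)
  also have "\<dots> = sw \<Lambda> (\<lambda>a' b'. sw \<Lambda> (\<lambda>a b. lam (S (S b) * a') * F a b'))"
  proof (intro sw_cong)
    fix a b a' b'
    have "lam (S a' * T b) = lam (S (b * a'))" by (simp add: inv_antipode_eq_antipode antipode_mult)
    then show "F a b' * lam (S a' * T b) = lam (S (S b) * a') * F a b'"
      by (simp add: lam_antipode antipode_involutive mult.commute)
  qed
  also have "\<dots> = sw \<Lambda> (\<lambda>a b. sw \<Lambda> (\<lambda>a' b'. lam (S (S b) * a') * F a b'))"
    by (rule sw_swap)
  also have "\<dots> = sw \<Lambda> (\<lambda>a b. F a (S b))"
    by (rule sw_cong, rule lin_lam_expand_right) (intro li)
  finally show ?thesis .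
qed

text \<open>Equivalently, \<open>\<Sum> \<Lambda>\<^sub>1 \<otimes> \<Lambda>\<^sub>2\<close> is symmetric: the flip, which involves \<open>S\<^sup>2 = id\<close>, removes the
antipode from the first leg.\<close>

lemma casimir_swap:
  assumes F: "bil F"
  shows "sw \<Lambda> (\<lambda>a b. F b (S a)) = sw \<Lambda> (\<lambda>a b. F a (S b))"
proof -
  note li = linear_intros bil_left[OF F] bil_right[OF F] bilD[OF F]
  have "sw \<Lambda> (\<lambda>a b. F b (S a)) = sw \<Lambda> (\<lambda>a b. F (S b) a)"
    by (rule casimir_symmetric[where F = "\<lambda>u v. F v u"]) (intro li)
  also have "\<dots> = sw \<Lambda> (\<lambda>a b. F a (S b))"
    using casimir_flip[OF F] by (simp add: antipode_involutive)
  finally show ?thesis .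
qed

lemmas field_ac = mult.assoc[where 'a = 'k] mult.commute[where 'a = 'k] mult.left_commute[where 'a = 'k]

lemma casimir_conjugation:
  assumes c: "c \<in> C" "i < fst c" "l < fst c"
  shows "sw \<Lambda> (\<lambda>a b. r c i l (a * y * S b)) = (if i = l then snd c y / of_nat (fst c) else 0)"
proof -
  have "sw \<Lambda> (\<lambda>a b. r c i l (a * y * S b))
      = (\<Sum>k<fst c. \<Sum>j<fst c. r c j k y * sw \<Lambda> (\<lambda>a b. r c i j a * r c k l (S b)))"
    using c by (simp add: r_mult sw_sum sw_mult_left sum_distrib_right sum_distrib_left field_ac)
  also have "\<dots> = (\<Sum>k<fst c. \<Sum>j<fst c. if j = k then (if i = l then r c k k y / of_nat (fst c) else 0) else 0)"
    using c by (intro sum.cong HOL.refl) (auto simp: orthogonality r_U)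
  also have "\<dots> = (if i = l then snd c y / of_nat (fst c) else 0)"
    using c by (simp add: character_r sum_divide_distrib)
  finally show ?thesis .
qed

text \<open>The inner sum over \<open>a'\<close> replaces \<open>a y\<close> by a scalar, the normalised trace of \<open>a y\<close>; the outer one
recovers \<open>y\<close> from its traces against the legs of \<open>\<Lambda>\<close>.\<close>

lemma casimir_commutator:
  assumes c: "c \<in> C" "i < fst c" "l < fst c"
  shows "sw \<Lambda> (\<lambda>a b. sw \<Lambda> (\<lambda>a' b'. r c i l (a' * a * y * S b' * S b))) = r c i l y / (of_nat (fst c))\<^sup>2"
proof -
  have "sw \<Lambda> (\<lambda>a' b'. r c i l (a' * a * y * S b' * S b)) = snd c (a * y) / of_nat (fst c) * r c i l (S b)" for a b
  proof -
    have "sw \<Lambda> (\<lambda>a' b'. r c i l (a' * a * y * S b' * S b))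
        = (\<Sum>p<fst c. sw \<Lambda> (\<lambda>a' b'. r c i p (a' * (a * y) * S b')) * r c p l (S b))"
      unfolding r_mult[OF c, of _ "S b"] by (simp add: sw_sum sw_mult_right mult.assoc)
    also have "\<dots> = (\<Sum>p<fst c. if p = i then snd c (a * y) / of_nat (fst c) * r c i l (S b) else 0)"
      using c by (intro sum.cong) (auto simp: casimir_conjugation)
    finally show ?thesis using c by simp
  qed
  then have "sw \<Lambda> (\<lambda>a b. sw \<Lambda> (\<lambda>a' b'. r c i l (a' * a * y * S b' * S b)))
      = sw \<Lambda> (\<lambda>a b. snd c (a * y) * r c i l (S b)) / of_nat (fst c)"
    by (simp add: divide_inverse sw_mult_left field_ac)
  also have "sw \<Lambda> (\<lambda>a b. snd c (a * y) * r c i l (S b))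
      = (\<Sum>j<fst c. \<Sum>k<fst c. r c k j y * sw \<Lambda> (\<lambda>a b. r c j k a * r c i l (S b)))"
    using c by (simp add: character_mult sw_sum sw_mult_left sum_distrib_right sum_distrib_left field_ac)
  also have "\<dots> = (\<Sum>j<fst c. \<Sum>k<fst c. if k = i then (if j = l then r c i l y / of_nat (fst c) else 0) else 0)"
    using c by (intro sum.cong HOL.refl) (auto simp: orthogonality r_U)
  also have "\<dots> = r c i l y / of_nat (fst c)"
    using c by simp
  finally show ?thesis by (simp add: power2_eq_square)
qed

text \<open>The same contraction as it appears after applying the antipode, which reverses the order of the factors.\<close>

lemma casimir_commutator_reversed:
  assumes c: "c \<in> C" "i < fst c" "l < fst c"
  shows "sw \<Lambda> (\<lambda>a b. sw \<Lambda> (\<lambda>a' b'. r c i l (b * b' * y * S a * S a'))) = r c i l y / (of_nat (fst c))\<^sup>2"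
proof -
  note li = linear_intros lin_r[OF c] lin_comp[OF lin_r[OF c]]
  have "sw \<Lambda> (\<lambda>a b. sw \<Lambda> (\<lambda>a' b'. r c i l (b * b' * y * S a * S a')))
      = sw \<Lambda> (\<lambda>a b. sw \<Lambda> (\<lambda>a' b'. r c i l (b * a' * y * S a * S b')))"
    by (rule sw_cong, rule casimir_swap[where F = "\<lambda>u v. r c i l (_ * u * y * S _ * v)"]) (intro li)
  also have "\<dots> = sw \<Lambda> (\<lambda>a b. sw \<Lambda> (\<lambda>a' b'. r c i l (a * a' * y * S b * S b')))"
    by (rule casimir_swap[where F = "\<lambda>u v. sw \<Lambda> (\<lambda>a' b'. r c i l (u * a' * y * v * S b'))"]) (intro li)
  also have "\<dots> = sw \<Lambda> (\<lambda>a b. sw \<Lambda> (\<lambda>a' b'. r c i l (a' * a * y * S b' * S b)))"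
    by (rule sw_swap)
  finally show ?thesis by (simp add: casimir_commutator[OF c])
qed

lemma sum_list_n_lists_Suc:
  "(\<Sum>ps\<leftarrow>List.n_lists (Suc n) xs. f ps) = (\<Sum>ps\<leftarrow>List.n_lists n xs. \<Sum>x\<leftarrow>xs. f (x # ps))"
  for f :: "'x list \<Rightarrow> 'k"
  by (simp add: map_concat sum_list_concat o_def)

text \<open>The two outermost copies of \<open>\<Lambda>\<close> can be contracted, which leaves the same expression with
two copies fewer.  The statement is about \<open>S z\<close>, not about \<open>z\<close>, as the Frobenius map involves the antipode.\<close>

lemma antipode_z: "S (z (2 * l)) = central (\<lambda>c. 1 / of_nat (fst c) ^ (2 * l))"
proof -
  have r_S_z: "r c i j (S (z (2 * l))) = r c i j (central (\<lambda>c. 1 / of_nat (fst c) ^ (2 * l)))"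
    if c: "c \<in> C" "i < fst c" "j < fst c" for c i j
  proof (induction l)
    case 0
    show ?case by (simp add: z_def antipode_mult antipode_one r_central r_one c)
  next
    case (Suc l)
    define f where "f ps = r c i j (S (prod_list (map fst ps) * prod_list (map (\<lambda>p. S (snd p)) ps)))" for ps
    have rz: "r c i j (S (z n)) = (\<Sum>ps\<leftarrow>List.n_lists n (\<Delta> \<Lambda>). f ps)" for n
      unfolding z_def f_def
      by (rule lin_sum_list[OF lin_comp[OF lin_r[OF c] endo_antipode], THEN HOL.trans]) simp
    have step: "(\<Sum>q\<leftarrow>\<Delta> \<Lambda>. \<Sum>q'\<leftarrow>\<Delta> \<Lambda>. f (q' # q # ps)) = f ps / (of_nat (fst c))\<^sup>2" for ps
    proof -
      define A B where "A = prod_list (map fst ps)" and "B = prod_list (map (\<lambda>p. S (snd p)) ps)"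
      have "(\<Sum>q\<leftarrow>\<Delta> \<Lambda>. \<Sum>q'\<leftarrow>\<Delta> \<Lambda>. f (q' # q # ps)) =
          sw \<Lambda> (\<lambda>a b. sw \<Lambda> (\<lambda>a' b'. r c i j (S B * (b * b' * S A * S a * S a'))))"
        by (simp add: sw_def split_def f_def A_def B_def antipode_mult antipode_involutive mult.assoc)
      also have "\<dots> = (\<Sum>p<fst c. r c i p (S B) *
          sw \<Lambda> (\<lambda>a b. sw \<Lambda> (\<lambda>a' b'. r c p j (b * b' * S A * S a * S a'))))"
        unfolding r_mult[OF c, of "S B"] by (simp add: sw_sum sw_mult_left)
      also have "\<dots> = r c i j (S B * S A) / (of_nat (fst c))\<^sup>2"
        using c by (simp add: casimir_commutator_reversed r_mult[OF c, of "S B"] sum_divide_distrib)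
      finally show ?thesis by (simp add: f_def A_def B_def antipode_mult)
    qed
    have "r c i j (S (z (Suc (Suc (2 * l))))) = r c i j (S (z (2 * l))) / (of_nat (fst c))\<^sup>2"
      unfolding rz sum_list_n_lists_Suc step by (simp add: divide_inverse sum_list_mult_const)
    then show ?case
      using Suc c by (simp add: r_central power2_eq_square)
  qed
  then show ?thesis by (rule entries_separate)
qed

section \<open>Convolution powers\<close>

lemma frobenius_map_eq: "frobenius_map h x = regular_character (S h * x)"
  by (simp add: frobenius_map_def dual_act_def)

lemma inj_frobenius_map: "inj frobenius_map"
proof (rule injI, rule lin_ext)
  fix x y p assume eq: "frobenius_map x = frobenius_map y" and p: "lin p"
  have "lam (S x * a) = lam (S y * a)" for a
    using fun_cong[OF eq, of a] by (simp add: frobenius_map_eq lam_eq_regular_character)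
  then have "sw \<Lambda> (\<lambda>a b. lam (S x * a) * p b) = sw \<Lambda> (\<lambda>a b. lam (S y * a) * p b)"
    by simp
  then show "p x = p y"
    by (simp only: lin_lam_expand_right[OF p])
qed

lemma convolution_frobenius_map:
  "convolution (frobenius_map x) (frobenius_map y) a = of_nat dimension * frobenius_map (x * y) a"
  by (simp add: convolution_def inv_into_f_f[OF inj_frobenius_map])

text \<open>The antipode in front of the central element cancels the one in the Frobenius map, so the dual characters never appear.\<close>

lemma frobenius_map_S_central:
  "frobenius_map (S (central \<alpha>)) h = (\<Sum>c\<in>C. of_nat (fst c) * \<alpha> c * snd c h)"
  by (simp add: frobenius_map_eq antipode_involutive regular_character_eq character_central_mult mult.assoc)

lemma convolution_central:
  "convolution (frobenius_map (S (central \<alpha>))) (frobenius_map (S (central \<beta>))) =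
    frobenius_map (S (central (\<lambda>c. of_nat dimension * \<alpha> c * \<beta> c)))"
  by (rule ext)
    (simp add: convolution_frobenius_map antipode_mult[symmetric] central_mult frobenius_map_S_central
      sum_distrib_left mult_ac)

lemma f_rob_eq:
  "f_rob = frobenius_map (S (central (\<lambda>c. of_nat dimension / (of_nat (fst c))\<^sup>2)))"
proof
  fix h
  have "of_nat n * (of_nat dimension / (of_nat n)\<^sup>2) = (of_nat dimension / of_nat n :: 'k)" for n
    by (simp add: power2_eq_square)
  then show "f_rob h = frobenius_map (S (central (\<lambda>c. of_nat dimension / (of_nat (fst c))\<^sup>2))) h"
    by (simp add: f_rob_def frobenius_map_S_central split_def)
qed

lemma convolution_power_f_rob:
  "((\<lambda>q. convolution q f_rob) ^^ m) f_rob =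
    frobenius_map (S (central (\<lambda>c. of_nat dimension ^ m * (of_nat dimension / (of_nat (fst c))\<^sup>2) ^ Suc m)))"
proof (induction m)
  case 0
  show ?case by (simp add: f_rob_eq)
next
  case (Suc m)
  have "((\<lambda>q. convolution q f_rob) ^^ Suc m) f_rob =
      convolution (frobenius_map (S (central (\<lambda>c. of_nat dimension ^ m * (of_nat dimension / (of_nat (fst c))\<^sup>2) ^ Suc m)))) f_rob"
    by (simp add: Suc)
  then show ?case
    unfolding f_rob_eq convolution_central by (simp add: mult_ac)
qed

theorem frobenius_z_and_convolution_power:
  assumes l: "l > 0"
  shows "of_nat dimension ^ (2 * l - 1) * frobenius_map (z (2 * l)) h =
      (\<Sum>(n, \<chi>)\<in>C. of_nat dimension ^ (2 * l - 1) / of_nat n ^ (2 * l - 1) * \<chi> h)"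
    and "(\<Sum>(n, \<chi>)\<in>C. of_nat dimension ^ (2 * l - 1) / of_nat n ^ (2 * l - 1) * \<chi> h) =
      convolution_power f_rob l h"
proof -
  obtain m where m: "l = Suc m" using l by (cases l) auto
  have deg: "(of_nat (fst c) :: 'k) \<noteq> 0" if "c \<in> C" for c
    using degree_pos[OF that] by simp
  have "of_nat dimension ^ (2 * l - 1) * frobenius_map (z (2 * l)) h =
      of_nat dimension ^ (2 * l - 1) * frobenius_map (S (central (\<lambda>c. 1 / of_nat (fst c) ^ (2 * l)))) h"
    by (simp only: antipode_z[symmetric] antipode_involutive)
  also have "\<dots> = (\<Sum>c\<in>C. of_nat dimension ^ (2 * l - 1) *
      (of_nat (fst c) * (1 / of_nat (fst c) ^ (2 * l)) * snd c h))"
    by (simp only: frobenius_map_S_central sum_distrib_left)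
  also have "\<dots> = (\<Sum>c\<in>C. of_nat dimension ^ (2 * l - 1) / of_nat (fst c) ^ (2 * l - 1) * snd c h)"
  proof (rule sum.cong[OF HOL.refl])
    fix c assume "c \<in> C"
    then have "of_nat (fst c) * (1 / of_nat (fst c) ^ (2 * l)) = (1 / of_nat (fst c) ^ (2 * l - 1) :: 'k)"
      using deg by (simp add: m)
    then show "of_nat dimension ^ (2 * l - 1) * (of_nat (fst c) * (1 / of_nat (fst c) ^ (2 * l)) * snd c h) =
        of_nat dimension ^ (2 * l - 1) / of_nat (fst c) ^ (2 * l - 1) * snd c h"
      by (simp only:) simp
  qed
  finally show "of_nat dimension ^ (2 * l - 1) * frobenius_map (z (2 * l)) h =
      (\<Sum>(n, \<chi>)\<in>C. of_nat dimension ^ (2 * l - 1) / of_nat n ^ (2 * l - 1) * \<chi> h)"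
    by (simp add: split_def)
  have key: "of_nat n * (of_nat dimension ^ m * (of_nat dimension / (of_nat n)\<^sup>2) ^ Suc m) =
      (of_nat dimension ^ (2 * l - 1) / of_nat n ^ (2 * l - 1) :: 'k)" if "(of_nat n :: 'k) \<noteq> 0" for n
  proof -
    have "((of_nat n :: 'k)\<^sup>2) ^ Suc m = of_nat n * of_nat n ^ (2 * l - 1)"
    proof -
      have "2 * Suc m = Suc (2 * l - 1)" by (simp add: m)
      then show ?thesis by (metis power_Suc power_mult)
    qed
    moreover have "of_nat dimension ^ m * (of_nat dimension :: 'k) ^ Suc m = of_nat dimension ^ (2 * l - 1)"
      by (simp only: power_add[symmetric]) (simp add: m mult_2)
    ultimately show ?thesis
      using that by (simp add: power_divide field_simps power2_eq_square)
  qed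
  have "convolution_power f_rob l h = (\<Sum>c\<in>C. of_nat (fst c) *
      (of_nat dimension ^ m * (of_nat dimension / (of_nat (fst c))\<^sup>2) ^ Suc m) * snd c h)"
    by (simp only: convolution_power_def m diff_Suc_1 convolution_power_f_rob frobenius_map_S_central)
  also have "\<dots> = (\<Sum>c\<in>C. of_nat dimension ^ (2 * l - 1) / of_nat (fst c) ^ (2 * l - 1) * snd c h)"
    by (intro sum.cong[OF HOL.refl], subst key) (simp_all add: degree_pos)
  finally show "(\<Sum>(n, \<chi>)\<in>C. of_nat dimension ^ (2 * l - 1) / of_nat n ^ (2 * l - 1) * \<chi> h) =
      convolution_power f_rob l h"
    by (simp add: split_def)
qed

end

theorem theorem3p3:
  fixes scale :: "'k::{alg_closed_field, field_char_0} \<Rightarrow> 'a::ring_1 \<Rightarrow> 'a"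
    and Basis :: "'a set"
    and \<Delta> :: "'a \<Rightarrow> ('a \<times> 'a) list" and \<epsilon> :: "'a \<Rightarrow> 'k" and S :: "'a \<Rightarrow> 'a"
    and d l :: nat
  assumes "hopf_algebra scale Basis \<Delta> \<epsilon> S"
    and "hopf_algebra.semisimple scale"
    and "vector_space.dim scale (UNIV :: 'a set) = d"
    and "l > 0"
  shows "(\<lambda>h. of_nat d ^ (2 * l - 1) *
             hopf_algebra.frobenius_map scale Basis S (hopf_algebra.z scale \<Delta> \<epsilon> S (2 * l)) h) =
         (\<lambda>h. \<Sum>(n, \<chi>)\<in>hopf_algebra.irreducible_characters scale.
             of_nat d ^ (2 * l - 1) / of_nat n ^ (2 * l - 1) * \<chi> h) \<and>
         (\<lambda>h. \<Sum>(n, \<chi>)\<in>hopf_algebra.irreducible_characters scale.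
             of_nat d ^ (2 * l - 1) / of_nat n ^ (2 * l - 1) * \<chi> h) =
         hopf_algebra.convolution_power scale Basis S
           (hopf_algebra.f_rob scale Basis) l"
proof -
  interpret hopf_algebra scale Basis \<Delta> \<epsilon> S by fact
  interpret semisimple_hopf_algebra scale Basis \<Delta> \<epsilon> S
    by unfold_locales (rule assms(2))
  have d: "d = dimension"
    using assms(3) by (simp add: dimension_def)
  show ?thesis
    unfolding d using frobenius_z_and_convolution_power[OF assms(4)] by (intro conjI ext)
qed

end
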